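(* Let $V\subset\underline{\mathbb{C}}^{n+2}$ be a non-degenerate subbundle, $\rho=\pi_V-\pi_{V^\perp}$ reflection across $V$, and $q$ a $1$-form with values in $\wedge^2V\oplus\wedge^2V^\perp$ such that $V$ is $q$-constrained harmonic. Let $\lambda\mapsto r(\lambda)\in\Gamma(O(\underline{\mathbb{C}}^{n+2}))$ be rational in $\lambda$, holomorphic and invertible at $\lambda=0$ and $\lambda=\infty$, with $1\in\mathrm{dom}(r)$, and twisted in the sense that $\rho\,r(\lambda)\,\rho^{-1}=r(-\lambda)$ for $\lambda\in\mathrm{dom}(r)$. Suppose that $\lambda\mapsto r(\lambda)\circ d^{\lambda,q}_V\circ r(\lambda)^{-1}$ admits a holomorphic extension to $\lambda\in\mathbb{C}\backslash\{0\}$ through metric connections on $\underline{\mathbb{C}}^{n+2}$. Define $\hat q\in\Omega^1(\wedge^2V\oplus\wedge^2V^\perp)$ by $\hat q^{1,0}:=\mathrm{Ad}_{r(0)}q^{1,0}$ and $\hat q^{0,1}:=\mathrm{Ad}_{r(\infty)}q^{0,1}$. Then $r(1)^{-1}V$ is an $(\mathrm{Ad}_{r(1)^{-1}}\hat q)$-constrained harmonic bundle.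
   Context: $M$ is an oriented surface with a fixed conformal structure; $J$ is the induced complex structure, all $(1,0)$- and $(0,1)$-parts refer to it, and $*\omega=-\omega\circ J$ on $1$-forms. $\mathbb{R}^{n+1,1}$ ($n\ge 3$) has metric $(\,,\,)$ of signature $(n+1,1)$, extended complex bilinearly to $\mathbb{C}^{n+2}=(\mathbb{R}^{n+1,1})^{\mathbb{C}}$; $\underline{\mathbb{C}}^{n+2}=M\times\mathbb{C}^{n+2}$ with trivial flat connection $d$. We identify $\wedge^{2}\mathbb{C}^{n+2}\cong o(\mathbb{C}^{n+2})$ by $(v_1\wedge v_2)(w)=(w,v_1)v_2-(w,v_2)v_1$. For $1$-forms with values in a bundle of Lie algebras, $[\mu\wedge\eta](X,Y)=[\mu_X,\eta_Y]-[\mu_Y,\eta_X]$. $d^\nabla$ is the exterior derivative on endomorphism-valued forms. A metric connection is one for which $(\,,\,)$ is parallel. For a non-degenerate subbundle $V$ with orthogonal projections $\pi_V,\pi_{V^\perp}$: $\mathcal{D}_V:=\pi_V\circ d\circ\pi_V+\pi_{V^\perp}\circ d\circ\pi_{V^\perp}$, $\mathcal{N}_V:=d-\mathcal{D}_V$, and for $q\in\Omega^1(\wedge^2V\oplus\wedge^2V^\perp)$, $\lambda\in\mathbb{C}\backslash\{0\}$, $d^{\lambda,q}_V:=\mathcal{D}_V+\lambda^{-1}\mathcal{N}_V^{1,0}+\lambda\mathcal{N}_V^{0,1}+(\lambda^{-2}-1)q^{1,0}+(\lambda^2-1)q^{0,1}$. $V$ is $q$-constrained harmonic if $d^{\mathcal{D}_V}q^{1,0}=\frac12[q\wedge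 q]=d^{\mathcal{D}_V}q^{0,1}$ and $d^{\mathcal{D}_V}*\mathcal{N}_V=2[q\wedge*\mathcal{N}_V]$. The twisting condition makes $r(0)$ and $r(\infty)$ commute with $\rho$, so they preserve $V$ and $V^\perp$ and $\hat q$ takes values in $\wedge^2V\oplus\wedge^2V^\perp$. *)

theory Defs
  imports "HOL-Analysis.Analysis" "HOL-Computational_Algebra.Polynomial"
begin

section \<open>Smooth maps and differential forms on a surface\<close>

text \<open>Meaningful for open \<open>S\<close> only.\<close>

primrec Ck_on :: "nat \<Rightarrow> 'a::real_normed_vector set \<Rightarrow> ('a \<Rightarrow> 'b::real_normed_vector) \<Rightarrow> bool" where
  "Ck_on 0 S f \<longleftrightarrow> continuous_on S f"
| "Ck_on (Suc k) S f \<longleftrightarrow> (\<forall>x\<in>S. f differentiable (at x)) \<and>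
     (\<forall>v. Ck_on k S (\<lambda>x. frechet_derivative f (at x) v))"

definition smooth_on :: "'a::real_normed_vector set \<Rightarrow> ('a \<Rightarrow> 'b::real_normed_vector) \<Rightarrow> bool" where
  "smooth_on S f \<longleftrightarrow> (\<forall>k. Ck_on k S f)"

type_synonym 'm chart = "'m set \<times> ('m \<Rightarrow> real^2)"

abbreviation chart_dom :: "'m chart \<Rightarrow> 'm set" where "chart_dom \<equiv> fst"
abbreviation chart_map :: "'m chart \<Rightarrow> 'm \<Rightarrow> real^2" where "chart_map \<equiv> snd"

definition chart_inv :: "'m chart \<Rightarrow> real^2 \<Rightarrow> 'm" where
  "chart_inv c = inv_into (chart_dom c) (chart_map c)"

text \<open>Differential forms are given by their coordinate expressions: a \<open>1\<close>-form assigns to a chart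
  \<open>c\<close>, a point \<open>p\<close> of its domain and the coordinates \<open>u\<close> of a tangent vector at \<open>p\<close> with
  respect to \<open>c\<close> a value; a \<open>2\<close>-form takes two coordinate vectors. Values at a chart outside the
  atlas or a point outside the chart domain are irrelevant.\<close>

type_synonym ('m, 'b) form1 = "'m chart \<Rightarrow> 'm \<Rightarrow> real^2 \<Rightarrow> 'b"
type_synonym ('m, 'b) form2 = "'m chart \<Rightarrow> 'm \<Rightarrow> real^2 \<Rightarrow> real^2 \<Rightarrow> 'b"

definition extd :: "('m \<Rightarrow> 'b::real_normed_vector) \<Rightarrow> ('m, 'b) form1" where
  "extd f c p u = frechet_derivative (f \<circ> chart_inv c) (at (chart_map c p)) u"

definition eq_form1 :: "'m chart set \<Rightarrow> ('m, 'b) form1 \<Rightarrow> ('m, 'b) form1 \<Rightarrow> bool" where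
  "eq_form1 \<A> \<omega> \<eta> \<longleftrightarrow> (\<forall>c\<in>\<A>. \<forall>p\<in>chart_dom c. \<forall>u. \<omega> c p u = \<eta> c p u)"

definition eq_form2 :: "'m chart set \<Rightarrow> ('m, 'b) form2 \<Rightarrow> ('m, 'b) form2 \<Rightarrow> bool" where
  "eq_form2 \<A> \<Omega> \<Theta> \<longleftrightarrow> (\<forall>c\<in>\<A>. \<forall>p\<in>chart_dom c. \<forall>u v. \<Omega> c p u v = \<Theta> c p u v)"

text \<open>\<open>extd (chart_map c') c p\<close> is the Jacobian at \<open>p\<close> of the change of coordinates from \<open>c\<close>
  to \<open>c'\<close>.\<close>

definition oriented_surface_atlas :: "'m::{t2_space,second_countable_topology} chart set \<Rightarrow> bool" where
  "oriented_surface_atlas \<A> \<longleftrightarrow>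
     (\<Union>c\<in>\<A>. chart_dom c) = UNIV \<and>
     (\<forall>c\<in>\<A>. open (chart_dom c) \<and> open (chart_map c ` chart_dom c) \<and>
        homeomorphism (chart_dom c) (chart_map c ` chart_dom c) (chart_map c) (chart_inv c)) \<and>
     (\<forall>c\<in>\<A>. \<forall>c'\<in>\<A>.
        smooth_on (chart_map c ` (chart_dom c \<inter> chart_dom c')) (chart_map c' \<circ> chart_inv c) \<and>
        (\<forall>p\<in>chart_dom c \<inter> chart_dom c'. det (matrix (extd (chart_map c') c p)) > 0))"

definition smooth_map_on :: "'m chart set \<Rightarrow> 'm set \<Rightarrow> ('m \<Rightarrow> 'b::real_normed_vector) \<Rightarrow> bool" where
  "smooth_map_on \<A> W f \<longleftrightarrow>
     (\<forall>c\<in>\<A>. smooth_on (chart_map c ` (chart_dom c \<inter> W)) (f \<circ> chart_inv c))"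

abbreviation smooth_map :: "'m chart set \<Rightarrow> ('m \<Rightarrow> 'b::real_normed_vector) \<Rightarrow> bool" where
  "smooth_map \<A> f \<equiv> smooth_map_on \<A> UNIV f"

definition smooth_form1 :: "'m chart set \<Rightarrow> ('m, 'b::real_normed_vector) form1 \<Rightarrow> bool" where
  "smooth_form1 \<A> \<omega> \<longleftrightarrow>
     (\<forall>c\<in>\<A>. (\<forall>p\<in>chart_dom c. linear (\<omega> c p)) \<and>
        (\<forall>u. smooth_on (chart_map c ` chart_dom c) (\<lambda>x. \<omega> c (chart_inv c x) u)) \<and>
        (\<forall>c'\<in>\<A>. \<forall>p\<in>chart_dom c \<inter> chart_dom c'. \<forall>u.
           \<omega> c p u = \<omega> c' p (extd (chart_map c') c p u)))"

section \<open>Conformal structure\<close>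

text \<open>A conformal structure is represented by a Riemannian metric in it.\<close>

definition riemannian_metric :: "'m chart set \<Rightarrow> ('m, real) form2 \<Rightarrow> bool" where
  "riemannian_metric \<A> g \<longleftrightarrow>
     (\<forall>c\<in>\<A>. (\<forall>p\<in>chart_dom c. bilinear (g c p) \<and> (\<forall>u v. g c p u v = g c p v u) \<and>
                (\<forall>u. u \<noteq> 0 \<longrightarrow> g c p u u > 0)) \<and>
        (\<forall>u v. smooth_on (chart_map c ` chart_dom c) (\<lambda>x. g c (chart_inv c x) u v)) \<and>
        (\<forall>c'\<in>\<A>. \<forall>p\<in>chart_dom c \<inter> chart_dom c'. \<forall>u v.
           g c p u v = g c' p (extd (chart_map c') c p u) (extd (chart_map c') c p v)))"

text \<open>The complex structure \<open>J\<close>: rotation through \<open>+90\<close> degrees, in coordinates of a positively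
  oriented chart. See \<open>rotJ_characterisation\<close> and \<open>rotJ_conformal\<close> below.\<close>

definition rotJ :: "('m, real) form2 \<Rightarrow> ('m, real^2) form1" where
  "rotJ g c p u =
     (let e1 = axis 1 1; e2 = axis 2 1 in
      (1 / sqrt (g c p e1 e1 * g c p e2 e2 - (g c p e1 e2)\<^sup>2)) *\<^sub>R
        (g c p u e1 *\<^sub>R e2 - g c p u e2 *\<^sub>R e1))"

definition cscale :: "complex \<Rightarrow> complex^'n^'k \<Rightarrow> complex^'n^'k" where
  "cscale z A = (\<chi> i j. z * A $ i $ j)"

text \<open>For a \<open>(1,0)\<close>-form \<open>\<omega>\<close>, \<open>\<omega> \<circ> J = \<i> \<omega>\<close>.\<close>

definition part10 :: "('m, real) form2 \<Rightarrow> ('m, complex^'n^'n) form1 \<Rightarrow> ('m, complex^'n^'n) form1" where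
  "part10 g \<omega> c p u = cscale (1/2) (\<omega> c p u - cscale \<i> (\<omega> c p (rotJ g c p u)))"

definition part01 :: "('m, real) form2 \<Rightarrow> ('m, complex^'n^'n) form1 \<Rightarrow> ('m, complex^'n^'n) form1" where
  "part01 g \<omega> c p u = cscale (1/2) (\<omega> c p u + cscale \<i> (\<omega> c p (rotJ g c p u)))"

definition star :: "('m, real) form2 \<Rightarrow> ('m, complex^'n^'n) form1 \<Rightarrow> ('m, complex^'n^'n) form1" where
  "star g \<omega> c p u = - \<omega> c p (rotJ g c p u)"

section \<open>The bundle\<close>

text \<open>The form of signature \<open>(N-1,1)\<close> on \<open>\<real>\<^sup>N\<close>, \<open>N = CARD('n)\<close>, with timelike coordinate \<open>\<tau>\<close>. At the
  type of complex numbers it is the complex bilinear (not Hermitian) extension.\<close>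

definition mink :: "'n::finite \<Rightarrow> 'a::comm_ring_1^'n \<Rightarrow> 'a^'n \<Rightarrow> 'a" where
  "mink \<tau> v w = (\<Sum>i\<in>UNIV. (if i = \<tau> then - 1 else 1) * v $ i * w $ i)"

lemma mink_complexify:
  "mink \<tau> (\<chi> i. complex_of_real (x $ i)) (\<chi> i. complex_of_real (y $ i)) =
   complex_of_real (mink \<tau> x y)"
  by (auto simp: mink_def intro!: sum.cong)

definition perp :: "'n::finite \<Rightarrow> (complex^'n) set \<Rightarrow> (complex^'n) set" where
  "perp \<tau> W = {v. \<forall>w\<in>W. mink \<tau> v w = 0}"

text \<open>Orthogonal projection onto a non-degenerate subspace.\<close>

definition proj :: "'n::finite \<Rightarrow> (complex^'n) set \<Rightarrow> complex^'n^'n" where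
  "proj \<tau> W = matrix (\<lambda>v. THE w. w \<in> W \<and> v - w \<in> perp \<tau> W)"

definition smooth_subbundle :: "'m::topological_space chart set \<Rightarrow> ('m \<Rightarrow> (complex^'n) set) \<Rightarrow> bool" where
  "smooth_subbundle \<A> V \<longleftrightarrow>
     (\<forall>p. \<exists>W k (s :: nat \<Rightarrow> 'm \<Rightarrow> complex^'n). open W \<and> p \<in> W \<and>
        (\<forall>j<k. smooth_map_on \<A> W (s j)) \<and>
        (\<forall>x\<in>W. inj_on (\<lambda>j. s j x) {..<k} \<and> vec.independent ((\<lambda>j. s j x) ` {..<k}) \<and>
                vec.span ((\<lambda>j. s j x) ` {..<k}) = V x))"

definition nondegenerate :: "'n::finite \<Rightarrow> ('m \<Rightarrow> (complex^'n) set) \<Rightarrow> bool" where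
  "nondegenerate \<tau> V \<longleftrightarrow> (\<forall>p. \<forall>v\<in>V p. (\<forall>w\<in>V p. mink \<tau> v w = 0) \<longrightarrow> v = 0)"

definition reflection :: "'n::finite \<Rightarrow> ('m \<Rightarrow> (complex^'n) set) \<Rightarrow> 'm \<Rightarrow> complex^'n^'n" where
  "reflection \<tau> V p = proj \<tau> (V p) - proj \<tau> (perp \<tau> (V p))"

definition wedge :: "'n::finite \<Rightarrow> complex^'n \<Rightarrow> complex^'n \<Rightarrow> complex^'n^'n" where
  "wedge \<tau> v1 v2 = matrix (\<lambda>w. mink \<tau> w v1 *s v2 - mink \<tau> w v2 *s v1)"

text \<open>\<open>span\<close> is the real span, but for a complex subspace \<open>W\<close> it is also the complex one, since
  \<open>z (v1 \<and> v2) = (z v1) \<and> v2\<close>.\<close>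

definition wedge2 :: "'n::finite \<Rightarrow> (complex^'n) set \<Rightarrow> (complex^'n^'n) set" where
  "wedge2 \<tau> W = span {wedge \<tau> v1 v2 |v1 v2. v1 \<in> W \<and> v2 \<in> W}"

definition split_endos :: "'n::finite \<Rightarrow> (complex^'n) set \<Rightarrow> (complex^'n^'n) set" where
  "split_endos \<tau> W = {A + B |A B. A \<in> wedge2 \<tau> W \<and> B \<in> wedge2 \<tau> (perp \<tau> W)}"

definition split_form1 :: "'m chart set \<Rightarrow> 'n::finite \<Rightarrow> ('m \<Rightarrow> (complex^'n) set) \<Rightarrow>
    ('m, complex^'n^'n) form1 \<Rightarrow> bool" where
  "split_form1 \<A> \<tau> V \<omega> \<longleftrightarrow> smooth_form1 \<A> \<omega> \<and>
     (\<forall>c\<in>\<A>. \<forall>p\<in>chart_dom c. \<forall>u. \<omega> c p u \<in> split_endos \<tau> (V p))"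

definition orthogonal_section :: "'m chart set \<Rightarrow> 'n::finite \<Rightarrow> ('m \<Rightarrow> complex^'n^'n) \<Rightarrow> bool" where
  "orthogonal_section \<A> \<tau> R \<longleftrightarrow> smooth_map \<A> R \<and>
     (\<forall>p v w. mink \<tau> (R p *v v) (R p *v w) = mink \<tau> v w)"

section \<open>Connections\<close>

text \<open>A connection is an operator taking a section to a bundle-valued \<open>1\<close>-form.\<close>

type_synonym ('m, 'n) conn = "('m \<Rightarrow> (complex, 'n) vec) \<Rightarrow> ('m, (complex, 'n) vec) form1"

definition connection :: "'m chart set \<Rightarrow> ('m, 'n::finite) conn \<Rightarrow> bool" where
  "connection \<A> C \<longleftrightarrow>
     (\<forall>s. smooth_map \<A> s \<longrightarrow> smooth_form1 \<A> (C s)) \<and>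
     (\<forall>s s'. smooth_map \<A> s \<and> smooth_map \<A> s' \<longrightarrow>
        eq_form1 \<A> (C (\<lambda>p. s p + s' p)) (\<lambda>c p u. C s c p u + C s' c p u)) \<and>
     (\<forall>(f :: 'm \<Rightarrow> complex) s. smooth_map \<A> f \<and> smooth_map \<A> s \<longrightarrow>
        eq_form1 \<A> (C (\<lambda>p. f p *s s p)) (\<lambda>c p u. extd f c p u *s s p + f p *s C s c p u))"

definition metric_connection :: "'m chart set \<Rightarrow> 'n::finite \<Rightarrow> ('m, 'n) conn \<Rightarrow> bool" where
  "metric_connection \<A> \<tau> C \<longleftrightarrow> connection \<A> C \<and>
     (\<forall>s s'. smooth_map \<A> s \<and> smooth_map \<A> s' \<longrightarrow>
        eq_form1 \<A> (extd (\<lambda>p. mink \<tau> (s p) (s' p)))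
          (\<lambda>c p u. mink \<tau> (C s c p u) (s' p) + mink \<tau> (s p) (C s' c p u)))"

definition connD :: "'n::finite \<Rightarrow> ('m \<Rightarrow> (complex^'n) set) \<Rightarrow> ('m, 'n) conn" where
  "connD \<tau> V s c p u =
     proj \<tau> (V p) *v extd (\<lambda>x. proj \<tau> (V x) *v s x) c p u +
     proj \<tau> (perp \<tau> (V p)) *v extd (\<lambda>x. proj \<tau> (perp \<tau> (V x)) *v s x) c p u"

text \<open>\<open>d - connD\<close> is tensorial, so its matrix is read off from constant sections.\<close>

definition formN :: "'n::finite \<Rightarrow> ('m \<Rightarrow> (complex^'n) set) \<Rightarrow> ('m, complex^'n^'n) form1" where
  "formN \<tau> V c p u = matrix (\<lambda>w. extd (\<lambda>_. w) c p u - connD \<tau> V (\<lambda>_. w) c p u)"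

text \<open>\<open>d\<^sup>C\<omega>(u,v) = [C\<^sub>u, \<omega>(v)] - [C\<^sub>v, \<omega>(u)]\<close> for coordinate vector fields \<open>u\<close>, \<open>v\<close> (whose Lie bracket
  vanishes). The commutators are tensorial, hence again evaluated on constant sections.\<close>

definition dnabla :: "('m, 'n::finite) conn \<Rightarrow> ('m, complex^'n^'n) form1 \<Rightarrow> ('m, complex^'n^'n) form2" where
  "dnabla C \<omega> c p u v = matrix (\<lambda>w.
     (C (\<lambda>x. \<omega> c x v *v w) c p u - \<omega> c p v *v C (\<lambda>_. w) c p u) -
     (C (\<lambda>x. \<omega> c x u *v w) c p v - \<omega> c p u *v C (\<lambda>_. w) c p v))"

definition commutator :: "complex^'n^'n \<Rightarrow> complex^'n^'n \<Rightarrow> complex^'n^'n" where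
  "commutator A B = A ** B - B ** A"

definition bracket_wedge :: "('m, complex^'n^'n) form1 \<Rightarrow> ('m, complex^'n^'n) form1 \<Rightarrow>
    ('m, complex^'n^'n) form2" where
  "bracket_wedge \<mu> \<eta> c p u v = commutator (\<mu> c p u) (\<eta> c p v) - commutator (\<mu> c p v) (\<eta> c p u)"

definition d_lambda :: "('m, real) form2 \<Rightarrow> 'n::finite \<Rightarrow> ('m \<Rightarrow> (complex^'n) set) \<Rightarrow>
    ('m, complex^'n^'n) form1 \<Rightarrow> complex \<Rightarrow> ('m, 'n) conn" where
  "d_lambda g \<tau> V q z s c p u =
     connD \<tau> V s c p u
     + inverse z *s (part10 g (formN \<tau> V) c p u *v s p)
     + z *s (part01 g (formN \<tau> V) c p u *v s p)
     + (inverse (z\<^sup>2) - 1) *s (part10 g q c p u *v s p)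
     + (z\<^sup>2 - 1) *s (part01 g q c p u *v s p)"

definition constrained_harmonic :: "'m::topological_space chart set \<Rightarrow> ('m, real) form2 \<Rightarrow> 'n::finite \<Rightarrow>
    ('m \<Rightarrow> (complex^'n) set) \<Rightarrow> ('m, complex^'n^'n) form1 \<Rightarrow> bool" where
  "constrained_harmonic \<A> g \<tau> V q \<longleftrightarrow>
     smooth_subbundle \<A> V \<and> nondegenerate \<tau> V \<and> split_form1 \<A> \<tau> V q \<and>
     eq_form2 \<A> (dnabla (connD \<tau> V) (part10 g q))
       (\<lambda>c p u v. cscale (1/2) (bracket_wedge q q c p u v)) \<and>
     eq_form2 \<A> (dnabla (connD \<tau> V) (part01 g q))
       (\<lambda>c p u v. cscale (1/2) (bracket_wedge q q c p u v)) \<and>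
     eq_form2 \<A> (dnabla (connD \<tau> V) (star g (formN \<tau> V)))
       (\<lambda>c p u v. cscale 2 (bracket_wedge q (star g (formN \<tau> V)) c p u v))"

section \<open>Rational families of gauge transformations\<close>

text \<open>\<open>r\<close> is a rational function with values in the complex vector space of smooth sections of the
  endomorphism bundle, and \<open>D\<close> is the set of finite points of its domain. The quotient is reduced:
  no zero of the denominator is a zero of the numerator, so \<open>D\<close> omits genuine poles only. Values of
  \<open>r\<close> off \<open>D\<close> are unconstrained.\<close>

definition rational_family :: "'m chart set \<Rightarrow> (complex \<Rightarrow> 'm \<Rightarrow> complex^'n^'n) \<Rightarrow> complex set \<Rightarrow> bool" where
  "rational_family \<A> r D \<longleftrightarrow>
     (\<exists>(Q :: complex poly) (N :: nat) (A :: nat \<Rightarrow> 'm \<Rightarrow> complex^'n^'n).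
        Q \<noteq> 0 \<and> (\<forall>k\<le>N. smooth_map \<A> (A k)) \<and>
        (\<forall>z. poly Q z = 0 \<longrightarrow> (\<exists>p. (\<Sum>k\<le>N. cscale (z ^ k) (A k p)) \<noteq> 0)) \<and>
        D = {z. poly Q z \<noteq> 0} \<and>
        (\<forall>z\<in>D. \<forall>p. r z p = cscale (inverse (poly Q z)) (\<Sum>k\<le>N. cscale (z ^ k) (A k p))))"

definition at_inf :: "(complex \<Rightarrow> 'm \<Rightarrow> complex^'n^'n) \<Rightarrow> 'm \<Rightarrow> complex^'n^'n" where
  "at_inf r p = Lim at_infinity (\<lambda>z. r z p)"

definition holomorphic_at_inf :: "(complex \<Rightarrow> 'm \<Rightarrow> complex^'n^'n) \<Rightarrow> bool" where
  "holomorphic_at_inf r \<longleftrightarrow>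
     (\<forall>p i j. (\<lambda>w. if w = 0 then at_inf r p $ i $ j else r (inverse w) p $ i $ j) analytic_on {0})"

definition twisted :: "'n::finite \<Rightarrow> ('m \<Rightarrow> (complex^'n) set) \<Rightarrow> (complex \<Rightarrow> 'm \<Rightarrow> complex^'n^'n) \<Rightarrow>
    complex set \<Rightarrow> bool" where
  "twisted \<tau> V r D \<longleftrightarrow>
     (\<forall>z\<in>D. - z \<in> D \<and>
        (\<forall>p. reflection \<tau> V p ** r z p ** matrix_inv (reflection \<tau> V p) = r (- z) p))"

definition gauge_conn :: "('m \<Rightarrow> complex^'n^'n) \<Rightarrow> ('m, 'n::finite) conn \<Rightarrow> ('m, 'n) conn" where
  "gauge_conn R C s c p u = R p *v C (\<lambda>x. matrix_inv (R x) *v s x) c p u"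

definition extends_metrically :: "'m chart set \<Rightarrow> 'n::finite \<Rightarrow> complex set \<Rightarrow> (complex \<Rightarrow> ('m, 'n) conn) \<Rightarrow> bool" where
  "extends_metrically \<A> \<tau> D F \<longleftrightarrow>
     (\<exists>E :: complex \<Rightarrow> ('m, 'n) conn.
        (\<forall>z. z \<noteq> 0 \<longrightarrow> metric_connection \<A> \<tau> (E z)) \<and>
        (\<forall>z\<in>D - {0}. \<forall>s. smooth_map \<A> s \<longrightarrow> eq_form1 \<A> (E z s) (F z s)) \<and>
        (\<forall>s. smooth_map \<A> s \<longrightarrow> (\<forall>c\<in>\<A>. \<forall>p\<in>chart_dom c. \<forall>u i.
           (\<lambda>z. E z s c p u $ i) holomorphic_on (- {0}))))"

definition Ad_form :: "('m \<Rightarrow> complex^'n^'n) \<Rightarrow> ('m, complex^'n^'n) form1 \<Rightarrow> ('m, complex^'n^'n) form1" where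
  "Ad_form R \<omega> c p u = R p ** \<omega> c p u ** matrix_inv (R p)"

text \<open>The form whose \<open>(1,0)\<close>- and \<open>(0,1)\<close>-parts are \<open>Ad\<^bsub>r(0)\<^esub> q\<^bsup>1,0\<^esup>\<close> and \<open>Ad\<^bsub>r(\<infinity>)\<^esub> q\<^bsup>0,1\<^esup>\<close>; see
  \<open>dressed_form_parts\<close> below.\<close>

definition dressed_form :: "('m, real) form2 \<Rightarrow> (complex \<Rightarrow> 'm \<Rightarrow> complex^'n^'n) \<Rightarrow>
    ('m, complex^'n^'n) form1 \<Rightarrow> ('m, complex^'n^'n) form1" where
  "dressed_form g r q c p u =
     Ad_form (r 0) (part10 g q) c p u + Ad_form (at_inf r) (part01 g q) c p u"

section \<open>Consistency of the conventions\<close>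

lemma axis2_expand: "(u::real^2) = u$1 *\<^sub>R axis 1 1 + u$2 *\<^sub>R axis 2 1"
  by (simp add: vec_eq_iff forall_2 axis_def)

context
  fixes g :: "('m, real) form2" and c :: "'m chart" and p :: 'm
  assumes bil: "bilinear (g c p)" and sym: "\<And>u v. g c p u v = g c p v u"
    and pos: "\<And>u. u \<noteq> 0 \<Longrightarrow> g c p u u > 0"
begin

lemma metric_coords:
  "g c p u v = g c p (axis 1 1) (axis 1 1) * u$1 * v$1
     + g c p (axis 1 1) (axis 2 1) * (u$1 * v$2 + u$2 * v$1)
     + g c p (axis 2 1) (axis 2 1) * u$2 * v$2"
proof -
  have "g c p u v = g c p (u$1 *\<^sub>R axis 1 1 + u$2 *\<^sub>R axis 2 1) (v$1 *\<^sub>R axis 1 1 + v$2 *\<^sub>R axis 2 1)"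
    by (metis axis2_expand)
  also have "\<dots> = u$1 * v$1 * g c p (axis 1 1) (axis 1 1) + u$1 * v$2 * g c p (axis 1 1) (axis 2 1)
     + u$2 * v$1 * g c p (axis 2 1) (axis 1 1) + u$2 * v$2 * g c p (axis 2 1) (axis 2 1)"
    by (simp add: bilinear_ladd[OF bil] bilinear_radd[OF bil] bilinear_lmul[OF bil]
        bilinear_rmul[OF bil] algebra_simps)
  finally show ?thesis using sym[of "axis 2 1" "axis 1 1"] by (simp add: algebra_simps)
qed

lemma metric_det_pos:
  "g c p (axis 1 1) (axis 1 1) * g c p (axis 2 1) (axis 2 1) - (g c p (axis 1 1) (axis 2 1))\<^sup>2 > 0"
proof -
  define E F G where "E = g c p (axis 1 1) (axis 1 1)" and "F = g c p (axis 1 1) (axis 2 1)"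
    and "G = g c p (axis 2 1) (axis 2 1)"
  have E: "E > 0" unfolding E_def by (rule pos) (simp add: axis_eq_0_iff)
  define u :: "real^2" where "u = vector [- F, E]"
  have "u \<noteq> 0" using E by (simp add: u_def vec_eq_iff forall_2)
  then have "g c p u u > 0" by (rule pos)
  also have "g c p u u = E * (E * G - F\<^sup>2)"
    using metric_coords[of u u]
    by (simp add: u_def E_def[symmetric] F_def[symmetric] G_def[symmetric] power2_eq_square algebra_simps)
  finally show ?thesis using E by (simp add: zero_less_mult_iff E_def F_def G_def)
qed

lemma rotJ_characterisation:
  shows "g c p u (rotJ g c p u) = 0" (is ?orth)
    and "g c p (rotJ g c p u) (rotJ g c p u) = g c p u u" (is ?norm)
    and "u \<noteq> 0 \<Longrightarrow> u$1 * rotJ g c p u $ 2 - u$2 * rotJ g c p u $ 1 > 0"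
    and "rotJ g c p (rotJ g c p u) = - u" (is ?sq)
proof -
  define E F G where "E = g c p (axis 1 1) (axis 1 1)" and "F = g c p (axis 1 1) (axis 2 1)"
    and "G = g c p (axis 2 1) (axis 2 1)"
  define d where "d = sqrt (E * G - F\<^sup>2)"
  have dpos: "d > 0" using metric_det_pos by (simp add: d_def E_def F_def G_def)
  have d2: "d * d = E * G - F * F"
    using metric_det_pos by (simp add: d_def E_def F_def G_def power2_eq_square)
  have gc: "g c p u v = E * u$1 * v$1 + F * (u$1 * v$2 + u$2 * v$1) + G * u$2 * v$2" for u v
    unfolding E_def F_def G_def by (rule metric_coords)
  have ge1: "g c p u (axis 1 1) = E * u$1 + F * u$2" and ge2: "g c p u (axis 2 1) = F * u$1 + G * u$2" for u
    by (subst gc, simp add: axis_def)+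
  have J: "rotJ g c p u =
      (1 / d) *\<^sub>R ((E * u$1 + F * u$2) *\<^sub>R axis 2 1 - (F * u$1 + G * u$2) *\<^sub>R axis 1 1)" for u
    by (simp only: rotJ_def Let_def E_def[symmetric] F_def[symmetric] G_def[symmetric]
        d_def[symmetric] ge1[of u] ge2[of u])
  have J1: "rotJ g c p u $ 1 = - (F * u$1 + G * u$2) / d"
    and J2: "rotJ g c p u $ 2 = (E * u$1 + F * u$2) / d" for u
    by (simp_all add: J axis_def)
  have D1: "d * rotJ g c p u $ 1 = - (F * u$1 + G * u$2)" for u
    using dpos by (simp add: J1)
  have D2: "d * rotJ g c p u $ 2 = E * u$1 + F * u$2" for u
    using dpos by (simp add: J2)
  define x y where "x = rotJ g c p u $ 1" and "y = rotJ g c p u $ 2"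
  have x: "d * x = - (F * u$1 + G * u$2)" and y: "d * y = E * u$1 + F * u$2"
    using D1 D2 by (simp_all add: x_def y_def)
  have "d * g c p u (rotJ g c p u) = E * u$1 * (d * x) + F * (u$1 * (d * y) + u$2 * (d * x)) + G * u$2 * (d * y)"
    by (simp add: gc x_def y_def algebra_simps)
  also have "\<dots> = 0" unfolding x y by (simp add: algebra_simps)
  finally show ?orth using dpos by simp
  have "d * d * g c p (rotJ g c p u) (rotJ g c p u)
      = E * (d * x) * (d * x) + F * ((d * x) * (d * y) + (d * y) * (d * x)) + G * (d * y) * (d * y)"
    by (simp add: gc x_def y_def algebra_simps)
  also have "\<dots> = (E * G - F * F) * g c p u u"
    unfolding x y gc by (simp add: algebra_simps)
  also have "\<dots> = d * d * g c p u u" by (simp only: d2)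
  finally show ?norm using dpos by simp
  show "u$1 * rotJ g c p u $ 2 - u$2 * rotJ g c p u $ 1 > 0" if "u \<noteq> 0"
  proof -
    have "d * (u$1 * y - u$2 * x) = u$1 * (d * y) - u$2 * (d * x)"
      by (simp add: algebra_simps)
    also have "\<dots> = g c p u u" unfolding x y gc by (simp add: algebra_simps)
    finally have "d * (u$1 * y - u$2 * x) > 0" using pos[OF that] by simp
    then show ?thesis using dpos by (simp add: zero_less_mult_iff x_def y_def)
  qed
  have "d * d * rotJ g c p (rotJ g c p u) $ 1 = - (F * (d * x) + G * (d * y))"
    by (simp only: mult.assoc D1[of "rotJ g c p u"] x_def[symmetric] y_def[symmetric])
       (simp add: algebra_simps)
  also have "\<dots> = d * d * - u$1" unfolding x y d2 by (simp add: algebra_simps)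
  finally have 1: "rotJ g c p (rotJ g c p u) $ 1 = - u$1"
    using dpos by (simp only: mult_cancel_left) simp
  have "d * d * rotJ g c p (rotJ g c p u) $ 2 = E * (d * x) + F * (d * y)"
    by (simp only: mult.assoc D2[of "rotJ g c p u"] x_def[symmetric] y_def[symmetric])
       (simp add: algebra_simps)
  also have "\<dots> = d * d * - u$2" unfolding x y d2 by (simp add: algebra_simps)
  finally have 2: "rotJ g c p (rotJ g c p u) $ 2 = - u$2"
    using dpos by (simp only: mult_cancel_left) simp
  show ?sq using 1 2 by (simp add: vec_eq_iff forall_2)
qed

lemma rotJ_conformal:
  assumes a: "a > 0" and h: "\<And>u v. h c p u v = a * g c p u v"
  shows "rotJ h c p u = rotJ g c p u"
proof -
  have "sqrt (a * x * (a * y) - (a * z)\<^sup>2) = a * sqrt (x * y - z\<^sup>2)" for x y z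
  proof -
    have "a * x * (a * y) - (a * z)\<^sup>2 = a\<^sup>2 * (x * y - z\<^sup>2)"
      by (simp add: power2_eq_square algebra_simps)
    then show ?thesis using a by (simp add: real_sqrt_mult)
  qed
  note sqrt_eq = this
  show ?thesis using a
    unfolding rotJ_def Let_def h sqrt_eq
    by (simp add: scaleR_right_diff_distrib)
qed

end

lemma Ad_cscale: "R ** cscale a A ** S = cscale a (R ** A ** S)"
  for R A S :: "complex^'n^'n"
proof -
  have 1: "R ** cscale a A = cscale a (R ** A)"
    by (simp add: cscale_def vec_eq_iff matrix_matrix_mult_def sum_distrib_left mult.left_commute)
  have 2: "cscale a B ** S = cscale a (B ** S)" for B :: "complex^'n^'n"
    by (simp add: cscale_def vec_eq_iff matrix_matrix_mult_def sum_distrib_left mult.assoc)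
  show ?thesis by (simp only: 1 2)
qed

lemma dressed_form_parts:
  assumes g: "riemannian_metric \<A> g" and q: "smooth_form1 \<A> q" and c: "c \<in> \<A>" "p \<in> chart_dom c"
  shows "part10 g (dressed_form g r q) c p u = Ad_form (r 0) (part10 g q) c p u"
    and "part01 g (dressed_form g r q) c p u = Ad_form (at_inf r) (part01 g q) c p u"
proof -
  have JJ: "rotJ g c p (rotJ g c p u) = - u"
  proof (rule rotJ_characterisation(4))
    show "bilinear (g c p)"
      using g c unfolding riemannian_metric_def by blast
    show "g c p v v > 0" if "v \<noteq> 0" for v
      using g c that unfolding riemannian_metric_def by blast
    show "g c p v w = g c p w v" for v w
      using g c unfolding riemannian_metric_def by blast
  qed
  have lin: "linear (q c p)" using q c by (auto simp: smooth_form1_def)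
  have qm: "q c p (- u) = - q c p u" by (rule linear_neg[OF lin])
  define X Y where "X = q c p u" and "Y = q c p (rotJ g c p u)"
  have 10: "part10 g q c p u = cscale (1/2) (X - cscale \<i> Y)"
    "part10 g q c p (rotJ g c p u) = cscale \<i> (cscale (1/2) (X - cscale \<i> Y))"
    by (simp_all add: part10_def X_def Y_def JJ qm cscale_def vec_eq_iff complex_eq_iff algebra_simps)
  have 01: "part01 g q c p u = cscale (1/2) (X + cscale \<i> Y)"
    "part01 g q c p (rotJ g c p u) = cscale (-\<i>) (cscale (1/2) (X + cscale \<i> Y))"
    by (simp_all add: part01_def X_def Y_def JJ qm cscale_def vec_eq_iff complex_eq_iff algebra_simps)
  define A B where "A = Ad_form (r 0) (part10 g q) c p u" and "B = Ad_form (at_inf r) (part01 g q) c p u"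
  have d: "dressed_form g r q c p u = A + B"
    "dressed_form g r q c p (rotJ g c p u) = cscale \<i> A - cscale \<i> B"
    by (simp_all only: A_def B_def dressed_form_def Ad_form_def 10 01 Ad_cscale)
       (simp add: cscale_def vec_eq_iff)
  show "part10 g (dressed_form g r q) c p u = Ad_form (r 0) (part10 g q) c p u"
    unfolding A_def[symmetric] part10_def d by (simp add: cscale_def vec_eq_iff complex_eq_iff algebra_simps)
  show "part01 g (dressed_form g r q) c p u = Ad_form (at_inf r) (part01 g q) c p u"
    unfolding B_def[symmetric] part01_def d by (simp add: cscale_def vec_eq_iff complex_eq_iff algebra_simps)
qed

end

theory Submission
  imports Defs "HOL-Complex_Analysis.Complex_Analysis"
begin

text \<open>Write \<open>d\<^sup>z\<close> for \<open>d_lambda\<close>. On the trivial bundle \<open>d\<^sup>z = d + \<alpha>\<^sub>z\<close> with \<open>\<alpha>\<^sub>z\<close> a Laurent polynomial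
  in \<open>z\<close>, and by the Gauss and Codazzi equations (flatness of \<open>d\<close>) constrained harmonicity of \<open>V\<close> is
  flatness of \<open>d\<^sup>z\<close> for infinitely many \<open>z\<close>. Gauging by \<open>G\<^sub>z = r(1)\<^sup>-\<^sup>1 r(z)\<close> gives a flat family with
  connection forms \<open>\<beta>\<^sub>z\<close> which, by hypothesis, extends holomorphically to \<open>z \<noteq> 0\<close>; since \<open>r\<close> is regular
  at \<open>0\<close> and \<open>\<infinity>\<close>, Liouville's theorem makes \<open>\<beta>\<^sub>z\<close> a Laurent polynomial of the same shape as \<open>\<alpha>\<^sub>z\<close>.
  Its extreme coefficients are the parts of the dressed form, the next ones are of type \<open>(1,0)\<close> and
  \<open>(0,1)\<close>, and the values \<open>\<beta>\<^sub>1 = 0\<close> and, by twisting, \<open>\<beta>\<^sub>-\<^sub>1\<close> determine the rest: \<open>\<beta>\<^sub>z\<close> is the connection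
  form of the family belonging to \<open>r(1)\<^sup>-\<^sup>1 V\<close> and the dressed form.\<close>

section \<open>Calculus of smooth maps\<close>

text \<open>The pivot is \<open>z = -1\<close>. With \<open>a = \<rho> dP\<close> one has
  \<open>D = d + a\<close> and \<open>N = - a\<close>, so the member of the family at -1,
  \<open>D - N = d + 2 a\<close>, is \<open>\<rho> d \<rho>\<close>. Twisting turns the gauge at -1
  into (new reflection)(old reflection), so the gauged connection there is \<open>d\<close>
  conjugated by the new reflection, with form twice the new \<open>a\<close>. This is how the new
  bundle enters: its \<open>D\<close> and \<open>N\<close> are never computed from those of
  \<open>V\<close>. A Laurent polynomial from order -2 to 2 has five coefficients. The extreme ones
  are limits; the values at 1 and -1 give the middle one and the sum of the other two, which is the
  new \<open>N\<close>; the types split that sum. Types are controlled only for nonzero powers of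
  \<open>z\<close>: the gauge term \<open>G dH\<close> has no type, but it is regular at 0 and
  infinity and so cannot reach the coefficients of \<open>inverse z\<close> and \<open>z\<close>.
  Regularity of \<open>dH\<close> exchanges a derivative along the surface with a limit in
  \<open>z\<close>; hence the rewriting of \<open>r\<close> as a finite sum of smooth sections with
  scalar rational factors. Gauge covariance of curvature rests on symmetry of second derivatives,
  proved for the iterated Frechet derivatives used here.\<close>

lemma Ck_on_cong:
  assumes "open S" "\<And>x. x \<in> S \<Longrightarrow> f x = h x" "Ck_on k S f"
  shows "Ck_on k S h"
  using assms(2,3)
proof (induction k arbitrary: f h)
  case 0
  then show ?case by (simp cong: continuous_on_cong)
next
  case (Suc k)
  have d: "f differentiable (at x)" if "x \<in> S" for x using Suc.prems that by simp
  have "(h has_derivative frechet_derivative f (at x)) (at x)" if "x \<in> S" for x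
    using d[OF that, unfolded frechet_derivative_works] assms(1) that Suc.prems(1)
    by (rule has_derivative_transform_within_open)
  then have "h differentiable (at x)" "frechet_derivative h (at x) = frechet_derivative f (at x)"
    if "x \<in> S" for x
    using that by (auto simp: differentiable_def dest: frechet_derivative_at[symmetric])
  then show ?case using Suc.prems(2) by (auto intro: Suc.IH[rotated])
qed

lemma Ck_on_subset: "Ck_on k S f \<Longrightarrow> T \<subseteq> S \<Longrightarrow> Ck_on k T f"
  by (induction k arbitrary: f) (auto intro: continuous_on_subset)

text \<open>Serves the projection onto a subbundle, which has an explicit formula only near each
  point, in a local frame.\<close>

lemma Ck_on_locally:
  assumes "\<And>x. x \<in> S \<Longrightarrow> \<exists>T. open T \<and> x \<in> T \<and> Ck_on k T f"
  shows "Ck_on k S f"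
  using assms
proof (induction k arbitrary: f)
  case 0
  have "isCont f x" if "x \<in> S" for x
    using 0[OF that] by (auto simp: continuous_on_eq_continuous_at)
  then show ?case by (simp add: continuous_at_imp_continuous_on)
next
  case (Suc k)
  then show ?case by (fastforce intro: Suc.IH)
qed

lemma Ck_on_SucD: "Ck_on (Suc k) S f \<Longrightarrow> Ck_on k S f"
proof (induction k arbitrary: f)
  case 0
  then show ?case
    by (auto intro!: continuous_at_imp_continuous_on differentiable_imp_continuous_within)
qed auto

text \<open>Trades \<open>frechet_derivative\<close> for an explicit derivative formula, so that
  each closure property becomes an induction on \<open>k\<close> applied to that formula.\<close>

lemma Ck_on_SucI:
  assumes "open S" "\<And>x. x \<in> S \<Longrightarrow> (f has_derivative f' x) (at x)"
    "\<And>v. Ck_on k S (\<lambda>x. f' x v)"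
  shows "Ck_on (Suc k) S f"
proof -
  have "frechet_derivative f (at x) = f' x" if "x \<in> S" for x
    using frechet_derivative_at[OF assms(2)[OF that]] by simp
  then show ?thesis
    using assms(2,3) by (auto simp: differentiable_def intro: Ck_on_cong[OF assms(1) _ assms(3)])
qed

lemma Ck_on_has_derivative:
  "Ck_on (Suc k) S f \<Longrightarrow> x \<in> S \<Longrightarrow> (f has_derivative frechet_derivative f (at x)) (at x)"
  by (simp add: frechet_derivative_works[symmetric])

lemma Ck_on_const: "open S \<Longrightarrow> Ck_on k S (\<lambda>_. a)"
  by (induction k arbitrary: a) auto

lemma Ck_on_linear:
  assumes "open S" "bounded_linear L"
  shows "Ck_on k S f \<Longrightarrow> Ck_on k S (\<lambda>x. L (f x))"
proof (induction k arbitrary: f)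
  case 0
  then show ?case by (auto intro: bounded_linear.continuous_on[OF assms(2)])
next
  case (Suc k)
  show ?case
  proof (rule Ck_on_SucI[OF assms(1)])
    show "((\<lambda>x. L (f x)) has_derivative (\<lambda>v. L (frechet_derivative f (at x) v))) (at x)" if "x \<in> S" for x
      using Ck_on_has_derivative[OF Suc.prems that] by (rule bounded_linear.has_derivative[OF assms(2)])
  qed (use Suc in auto)
qed

lemma Ck_on_add:
  assumes "open S"
  shows "Ck_on k S f \<Longrightarrow> Ck_on k S h \<Longrightarrow> Ck_on k S (\<lambda>x. f x + h x)"
proof (induction k arbitrary: f h)
  case 0
  then show ?case by (auto intro: continuous_on_add)
next
  case (Suc k)
  show ?case
  proof (rule Ck_on_SucI[OF assms(1)])
    show "((\<lambda>x. f x + h x) has_derivative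
        (\<lambda>v. frechet_derivative f (at x) v + frechet_derivative h (at x) v)) (at x)" if "x \<in> S" for x
      using Suc.prems that by (intro has_derivative_add Ck_on_has_derivative) auto
  qed (use Suc in auto)
qed

lemma Ck_on_bilinear:
  assumes "open S" "bounded_bilinear B"
  shows "Ck_on k S f \<Longrightarrow> Ck_on k S h \<Longrightarrow> Ck_on k S (\<lambda>x. B (f x) (h x))"
proof (induction k arbitrary: f h)
  case 0
  then show ?case by (auto intro: bounded_bilinear.continuous_on[OF assms(2)])
next
  case (Suc k)
  show ?case
  proof (rule Ck_on_SucI[OF assms(1)])
    show "((\<lambda>x. B (f x) (h x)) has_derivative
        (\<lambda>v. B (f x) (frechet_derivative h (at x) v) + B (frechet_derivative f (at x) v) (h x))) (at x)"
      if "x \<in> S" for x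
      using Suc.prems that by (intro bounded_bilinear.FDERIV[OF assms(2)] Ck_on_has_derivative) auto
    \<comment> \<open>The product rule pairs a derivative of one factor with the other factor
      undifferentiated, so the induction hypothesis also needs \<open>f\<close> and \<open>h\<close>
      at order \<open>k\<close>; \<open>Ck_on_SucD\<close> supplies this.\<close>
    show "Ck_on k S (\<lambda>x. B (f x) (frechet_derivative h (at x) v) + B (frechet_derivative f (at x) v) (h x))" for v
      using Suc.prems Suc.prems[THEN Ck_on_SucD] by (intro Ck_on_add Suc.IH assms) auto
  qed
qed

section \<open>Closure properties of smooth maps\<close>

lemma smooth_on_cong:
  "open S \<Longrightarrow> (\<And>x. x \<in> S \<Longrightarrow> f x = h x) \<Longrightarrow> smooth_on S f \<Longrightarrow> smooth_on S h"
  unfolding smooth_on_def by (blast intro: Ck_on_cong)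

lemma smooth_on_subset: "smooth_on S f \<Longrightarrow> T \<subseteq> S \<Longrightarrow> smooth_on T f"
  unfolding smooth_on_def by (blast intro: Ck_on_subset)

lemma smooth_on_locally:
  "(\<And>x. x \<in> S \<Longrightarrow> \<exists>T. open T \<and> x \<in> T \<and> smooth_on T f) \<Longrightarrow> smooth_on S f"
  unfolding smooth_on_def by (meson Ck_on_locally)

lemma smooth_on_const: "open S \<Longrightarrow> smooth_on S (\<lambda>_. a)"
  unfolding smooth_on_def by (blast intro: Ck_on_const)

lemma smooth_on_linear:
  "open S \<Longrightarrow> bounded_linear L \<Longrightarrow> smooth_on S f \<Longrightarrow> smooth_on S (\<lambda>x. L (f x))"
  unfolding smooth_on_def by (blast intro: Ck_on_linear)

lemma smooth_on_add:
  "open S \<Longrightarrow> smooth_on S f \<Longrightarrow> smooth_on S h \<Longrightarrow> smooth_on S (\<lambda>x. f x + h x)"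
  unfolding smooth_on_def by (blast intro: Ck_on_add)

lemma smooth_on_bilinear:
  "open S \<Longrightarrow> bounded_bilinear B \<Longrightarrow> smooth_on S f \<Longrightarrow> smooth_on S h \<Longrightarrow> smooth_on S (\<lambda>x. B (f x) (h x))"
  unfolding smooth_on_def by (blast intro: Ck_on_bilinear)

lemma smooth_on_minus: "open S \<Longrightarrow> smooth_on S f \<Longrightarrow> smooth_on S (\<lambda>x. - f x)"
  by (rule smooth_on_linear[where L = uminus]) (auto intro: bounded_linear_minus bounded_linear_ident)

lemma smooth_on_diff:
  "open S \<Longrightarrow> smooth_on S f \<Longrightarrow> smooth_on S h \<Longrightarrow> smooth_on S (\<lambda>x. f x - h x)"
  using smooth_on_add[of S f "\<lambda>x. - h x"] smooth_on_minus[of S h] by simp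

lemma smooth_on_mult:
  fixes f h :: "_ \<Rightarrow> 'b::real_normed_algebra"
  shows "open S \<Longrightarrow> smooth_on S f \<Longrightarrow> smooth_on S h \<Longrightarrow> smooth_on S (\<lambda>x. f x * h x)"
  by (rule smooth_on_bilinear[OF _ bounded_bilinear_mult])

lemma smooth_on_sum:
  "open S \<Longrightarrow> (\<And>i. i \<in> I \<Longrightarrow> smooth_on S (f i)) \<Longrightarrow> smooth_on S (\<lambda>x. \<Sum>i\<in>I. f i x)"
  by (induction I rule: infinite_finite_induct) (auto intro: smooth_on_const smooth_on_add)

lemma smooth_on_prod:
  fixes f :: "_ \<Rightarrow> _ \<Rightarrow> 'b::{real_normed_algebra,comm_ring_1}"
  shows "open S \<Longrightarrow> (\<And>i. i \<in> I \<Longrightarrow> smooth_on S (f i)) \<Longrightarrow> smooth_on S (\<lambda>x. \<Prod>i\<in>I. f i x)"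
  by (induction I rule: infinite_finite_induct) (auto intro: smooth_on_const smooth_on_mult)

text \<open>The derivative of the reciprocal is a polynomial in the reciprocal itself and the
  derivative of \<open>f\<close>, so the order of differentiability climbs by induction.\<close>

lemma smooth_on_inverse:
  fixes f :: "'a::real_normed_vector \<Rightarrow> 'b::real_normed_field"
  assumes "open S" "smooth_on S f" "\<And>x. x \<in> S \<Longrightarrow> f x \<noteq> 0"
  shows "smooth_on S (\<lambda>x. inverse (f x))"
proof -
  have f: "Ck_on k S f" for k using assms(2) by (simp add: smooth_on_def)
  have "Ck_on k S (\<lambda>x. inverse (f x))" for k
  proof (induction k)
    case 0
    show ?case using f[of 0] assms(3) by (auto intro: continuous_on_inverse)
  next
    case (Suc k)
    show ?case
    proof (rule Ck_on_SucI[OF assms(1)])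
      show "((\<lambda>x. inverse (f x)) has_derivative
          (\<lambda>v. - (inverse (f x) * frechet_derivative f (at x) v * inverse (f x)))) (at x)" if "x \<in> S" for x
        using Ck_on_has_derivative[OF f that] assms(3)[OF that] by (simp add: Deriv.has_derivative_inverse)
      show "Ck_on k S (\<lambda>x. - (inverse (f x) * frechet_derivative f (at x) v * inverse (f x)))" for v
        using f[of "Suc k"]
        by (intro Ck_on_linear[OF assms(1), where L = uminus] Ck_on_bilinear[OF assms(1) bounded_bilinear_mult] Suc)
          (auto intro: bounded_linear_minus bounded_linear_ident)
    qed
  qed
  then show ?thesis by (simp add: smooth_on_def)
qed

text \<open>The same bootstrapping: the derivative is -1/2 times the derivative of \<open>f\<close>
  times the cube of the function itself. It serves the normalising factor of
  \<open>rotJ\<close>.\<close>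

lemma smooth_on_inverse_sqrt:
  fixes f :: "'a::real_normed_vector \<Rightarrow> real"
  assumes "open S" "smooth_on S f" "\<And>x. x \<in> S \<Longrightarrow> f x > 0"
  shows "smooth_on S (\<lambda>x. 1 / sqrt (f x))"
proof -
  have f: "Ck_on k S f" for k using assms(2) by (simp add: smooth_on_def)
  have "Ck_on k S (\<lambda>x. 1 / sqrt (f x))" for k
  proof (induction k)
    case 0
    show ?case using f[of 0] assms(3) by (fastforce intro: continuous_intros)
  next
    case (Suc k)
    let ?g = "\<lambda>x. 1 / sqrt (f x)"
    show ?case
    proof (rule Ck_on_SucI[OF assms(1)])
      show "(?g has_derivative
          (\<lambda>v. (- 1 / 2) * (frechet_derivative f (at x) v * (?g x * (?g x * ?g x))))) (at x)" if "x \<in> S" for x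
        using assms(3)[OF that]
        by (auto intro!: derivative_eq_intros Ck_on_has_derivative[OF f that] simp: field_simps)
      show "Ck_on k S (\<lambda>x. (- 1 / 2) * (frechet_derivative f (at x) v * (?g x * (?g x * ?g x))))" for v
        using f[of "Suc k"]
        by (intro Ck_on_bilinear[OF assms(1) bounded_bilinear_mult] Suc Ck_on_const assms) auto
    qed
  qed
  then show ?thesis by (simp add: smooth_on_def)
qed

lemma smooth_on_frechet:
  "smooth_on S f \<Longrightarrow> smooth_on S (\<lambda>x. frechet_derivative f (at x) v)"
  by (simp add: smooth_on_def) (metis Ck_on.simps(2))

lemma smooth_on_has_derivative:
  "smooth_on S f \<Longrightarrow> x \<in> S \<Longrightarrow> (f has_derivative frechet_derivative f (at x)) (at x)"
  unfolding smooth_on_def by (blast intro: Ck_on_has_derivative)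

lemma smooth_on_continuous: "smooth_on S f \<Longrightarrow> continuous_on S f"
  by (auto simp: smooth_on_def dest: spec[of _ 0])

lemma smooth_on_vec_iff:
  fixes f :: "'a::real_normed_vector \<Rightarrow> 'b::euclidean_space^'n"
  assumes "open S"
  shows "smooth_on S f \<longleftrightarrow> (\<forall>i. smooth_on S (\<lambda>x. f x $ i))"
proof (intro iffI allI)
  show "smooth_on S (\<lambda>x. f x $ i)" if "smooth_on S f" for i
    by (rule smooth_on_linear[OF assms _ that]) (rule bounded_linear_vec_nth)
  have L: "bounded_linear (axis i :: 'b \<Rightarrow> 'b^'n)" for i
    unfolding linear_conv_bounded_linear[symmetric]
    by (rule linearI) (auto simp: axis_def vec_eq_iff)
  assume *: "\<forall>i. smooth_on S (\<lambda>x. f x $ i)"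
  have "smooth_on S (\<lambda>x. \<Sum>i\<in>UNIV. axis i (f x $ i))"
    using * by (intro smooth_on_sum assms smooth_on_linear[OF assms L]) auto
  then show "smooth_on S f"
    by (rule smooth_on_cong[OF assms, rotated])
      (simp add: vec_eq_iff axis_def if_distrib cong: if_cong)
qed

text \<open>Both second-order difference quotients are evaluated by the mean value theorem on the same
  parallelogram.\<close>

lemma second_difference_mvt:
  fixes f :: "'a::real_normed_vector \<Rightarrow> real"
  assumes S: "\<And>a b. 0 \<le> a \<Longrightarrow> a \<le> s \<Longrightarrow> 0 \<le> b \<Longrightarrow> b \<le> s \<Longrightarrow> x + a *\<^sub>R u + b *\<^sub>R v \<in> S"
    and f: "smooth_on S f" and s: "s > 0"
  obtains a b where "0 \<le> a" "a \<le> s" "0 \<le> b" "b \<le> s"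
    "f (x + s *\<^sub>R u + s *\<^sub>R v) - f (x + s *\<^sub>R u) - f (x + s *\<^sub>R v) + f x
     = s * s * frechet_derivative (\<lambda>y. frechet_derivative f (at y) u) (at (x + a *\<^sub>R u + b *\<^sub>R v)) v"
proof -
  let ?fu = "\<lambda>y. frechet_derivative f (at y) u"
  have d: "((\<lambda>t. h (w + t *\<^sub>R z)) has_real_derivative frechet_derivative h (at (w + t *\<^sub>R z)) z) (at t)"
    if "smooth_on S h" "w + t *\<^sub>R z \<in> S" for h :: "'a \<Rightarrow> real" and w z t
  proof -
    have hd: "(h has_derivative frechet_derivative h (at (w + t *\<^sub>R z))) (at (w + t *\<^sub>R z))"
      by (rule smooth_on_has_derivative[OF that])
    have "((\<lambda>t. w + t *\<^sub>R z) has_derivative (\<lambda>e. e *\<^sub>R z)) (at t)"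
      by (auto intro!: derivative_eq_intros)
    from has_derivative_compose[OF this hd] show ?thesis
      by (rule has_derivative_imp_has_field_derivative)
        (simp add: linear_cmul[OF has_derivative_linear[OF hd]])
  qed
  define \<phi> where "\<phi> t = f ((x + s *\<^sub>R v) + t *\<^sub>R u) - f (x + t *\<^sub>R u)" for t
  have "\<exists>z>0. z < s \<and> \<phi> s - \<phi> 0 = (s - 0) * (?fu ((x + s *\<^sub>R v) + z *\<^sub>R u) - ?fu (x + z *\<^sub>R u))"
    unfolding \<phi>_def
  proof (rule MVT2[OF s])
    fix t assume t: "0 \<le> t" "t \<le> s"
    have "(x + s *\<^sub>R v) + t *\<^sub>R u \<in> S" "x + t *\<^sub>R u \<in> S"
      using S[of t s] S[of t 0] t s by (simp_all add: ac_simps)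
    then show "((\<lambda>t. f ((x + s *\<^sub>R v) + t *\<^sub>R u) - f (x + t *\<^sub>R u)) has_real_derivative
        ?fu ((x + s *\<^sub>R v) + t *\<^sub>R u) - ?fu (x + t *\<^sub>R u)) (at t)"
      by (intro DERIV_diff d f)
  qed
  then obtain a where a: "0 < a" "a < s"
    "\<phi> s - \<phi> 0 = s * (?fu ((x + s *\<^sub>R v) + a *\<^sub>R u) - ?fu (x + a *\<^sub>R u))" by auto
  have "\<exists>z>0. z < s \<and> ?fu ((x + a *\<^sub>R u) + s *\<^sub>R v) - ?fu ((x + a *\<^sub>R u) + 0 *\<^sub>R v)
      = (s - 0) * frechet_derivative ?fu (at ((x + a *\<^sub>R u) + z *\<^sub>R v)) v"
    using a by (intro MVT2[OF s] d smooth_on_frechet f S) auto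
  then obtain b where b: "0 < b" "b < s"
    "?fu ((x + a *\<^sub>R u) + s *\<^sub>R v) - ?fu (x + a *\<^sub>R u)
      = s * frechet_derivative ?fu (at ((x + a *\<^sub>R u) + b *\<^sub>R v)) v" by auto
  have "f (x + s *\<^sub>R u + s *\<^sub>R v) - f (x + s *\<^sub>R u) - f (x + s *\<^sub>R v) + f x = \<phi> s - \<phi> 0"
    by (simp add: \<phi>_def algebra_simps)
  also have "\<dots> = s * (?fu ((x + a *\<^sub>R u) + s *\<^sub>R v) - ?fu (x + a *\<^sub>R u))"
    unfolding a(3) by (simp add: ac_simps)
  also have "\<dots> = s * s * frechet_derivative ?fu (at (x + a *\<^sub>R u + b *\<^sub>R v)) v"
    unfolding b(3) by simp
  finally show ?thesis using a b by (intro that[of a b]) auto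
qed

text \<open>Schwarz's theorem. One second difference over a small parallelogram, divided by
  \<open>s * s\<close>, is a value of each mixed derivative at a nearby point; continuity forces the
  two to agree at \<open>x\<close>.\<close>

lemma mixed_derivatives_real:
  fixes f :: "'a::real_normed_vector \<Rightarrow> real"
  assumes S: "open S" and f: "smooth_on S f" and x: "x \<in> S"
  shows "frechet_derivative (\<lambda>y. frechet_derivative f (at y) u) (at x) v
       = frechet_derivative (\<lambda>y. frechet_derivative f (at y) v) (at x) u" (is "?A x = ?B x")
proof (rule ccontr)
  assume "?A x \<noteq> ?B x"
  define \<epsilon> where "\<epsilon> = dist (?A x) (?B x) / 2"
  have e: "\<epsilon> > 0" using \<open>?A x \<noteq> ?B x\<close> by (simp add: \<epsilon>_def)
  have cont: "isCont ?A x" "isCont ?B x"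
    using smooth_on_continuous[OF smooth_on_frechet[OF smooth_on_frechet[OF f]]] S x
    by (auto simp: continuous_on_eq_continuous_at)
  have near: "\<forall>\<^sub>F y in nhds x. dist (h y) (h x) < \<epsilon>" if "isCont h x" for h :: "'a \<Rightarrow> real"
    using that e unfolding isCont_def tendsto_at_iff_tendsto_nhds by (rule tendstoD)
  have "\<forall>\<^sub>F y in nhds x. y \<in> S" using S x by (rule eventually_nhds_in_open)
  with near[OF cont(1)] near[OF cont(2)] have "\<forall>\<^sub>F y in nhds x. y \<in> S \<and> dist (?A y) (?A x) < \<epsilon> \<and> dist (?B y) (?B x) < \<epsilon>"
    by (intro eventually_conj)
  then obtain \<delta> where \<delta>: "\<delta> > 0" "\<And>y. dist y x < \<delta> \<Longrightarrow> y \<in> S \<and> dist (?A y) (?A x) < \<epsilon> \<and> dist (?B y) (?B x) < \<epsilon>"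
    by (auto simp: eventually_nhds_metric)
  \<comment> \<open>Keeps the whole parallelogram within distance \<open>\<delta> / 2\<close> of
    \<open>x\<close>; the summand 1 avoids division by zero when \<open>u\<close> and
    \<open>v\<close> vanish.\<close>
  define s where "s = \<delta> / (2 * (norm u + norm v + 1))"
  have s: "s > 0" using \<delta>(1) by (simp add: s_def add_nonneg_pos)
  have near: "dist (x + a *\<^sub>R u + b *\<^sub>R v) x < \<delta>" if "0 \<le> a" "a \<le> s" "0 \<le> b" "b \<le> s" for a b
  proof -
    have "dist (x + a *\<^sub>R u + b *\<^sub>R v) x = norm (a *\<^sub>R u + b *\<^sub>R v)"
      by (simp add: dist_norm)
    also have "\<dots> \<le> norm (a *\<^sub>R u) + norm (b *\<^sub>R v)" by (rule norm_triangle_ineq)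
    also have "\<dots> \<le> s * norm u + s * norm v"
      using that by (intro add_mono) (auto intro: mult_right_mono)
    also have "\<dots> \<le> s * (norm u + norm v + 1)" using s by (simp add: algebra_simps)
    also have "\<dots> = \<delta> / 2"
    proof -
      have "norm u + norm v + 1 > 0" by (simp add: add_nonneg_pos)
      then show ?thesis by (simp add: s_def field_simps)
    qed
    finally show ?thesis using \<delta>(1) by simp
  qed
  obtain a b where ab: "0 \<le> a" "a \<le> s" "0 \<le> b" "b \<le> s"
    "f (x + s *\<^sub>R u + s *\<^sub>R v) - f (x + s *\<^sub>R u) - f (x + s *\<^sub>R v) + f x = s * s * ?A (x + a *\<^sub>R u + b *\<^sub>R v)"
    by (rule second_difference_mvt[where x = x and u = u and v = v, OF _ f s]) (use near \<delta>(2) in blast)+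
  obtain b' a' where ab': "0 \<le> b'" "b' \<le> s" "0 \<le> a'" "a' \<le> s"
    "f (x + s *\<^sub>R v + s *\<^sub>R u) - f (x + s *\<^sub>R v) - f (x + s *\<^sub>R u) + f x = s * s * ?B (x + b' *\<^sub>R v + a' *\<^sub>R u)"
  proof (rule second_difference_mvt[where x = x and u = v and v = u, OF _ f s])
    show "x + a *\<^sub>R v + b *\<^sub>R u \<in> S" if "0 \<le> a" "a \<le> s" "0 \<le> b" "b \<le> s" for a b
      using \<delta>(2)[OF near[OF that(3,4,1,2)]] by (simp add: ac_simps)
  qed blast
  have "s * s * ?A (x + a *\<^sub>R u + b *\<^sub>R v) = s * s * ?B (x + a' *\<^sub>R u + b' *\<^sub>R v)"
    unfolding ab(5)[symmetric] using ab'(5) by (simp add: algebra_simps)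
  then have eq: "?A (x + a *\<^sub>R u + b *\<^sub>R v) = ?B (x + a' *\<^sub>R u + b' *\<^sub>R v)"
    using s by simp
  have "dist (?A x) (?B x) \<le> dist (?A (x + a *\<^sub>R u + b *\<^sub>R v)) (?A x) + dist (?B (x + a' *\<^sub>R u + b' *\<^sub>R v)) (?B x)"
    unfolding eq by (rule dist_triangle3)
  also have "\<dots> < \<epsilon> + \<epsilon>"
    using \<delta>(2)[OF near[OF ab(1-4)]] \<delta>(2)[OF near[OF ab'(3,4,1,2)]] by (intro add_strict_mono) auto
  finally show False by (simp add: \<epsilon>_def)
qed

lemma frechet_derivative_linear:
  assumes "bounded_linear L" "f differentiable (at x)"
  shows "frechet_derivative (\<lambda>y. L (f y)) (at x) v = L (frechet_derivative f (at x) v)"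
  using frechet_derivative_at[OF bounded_linear.has_derivative[OF assms(1)
      assms(2)[unfolded frechet_derivative_works]]] by metis

lemma mixed_derivatives:
  fixes f :: "'a::real_normed_vector \<Rightarrow> 'b::euclidean_space"
  assumes S: "open S" and f: "smooth_on S f" and x: "x \<in> S"
  shows "frechet_derivative (\<lambda>y. frechet_derivative f (at y) u) (at x) v
       = frechet_derivative (\<lambda>y. frechet_derivative f (at y) v) (at x) u"
proof (rule euclidean_eqI)
  fix b :: 'b
  let ?L = "\<lambda>y. y \<bullet> b"
  have L: "bounded_linear ?L" by (rule bounded_linear_inner_left)
  have Lf: "smooth_on S (\<lambda>y. ?L (f y))" by (rule smooth_on_linear[OF S L f])
  have *: "?L (frechet_derivative (\<lambda>y. frechet_derivative f (at y) u) (at x) v)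
     = frechet_derivative (\<lambda>y. frechet_derivative (\<lambda>y. ?L (f y)) (at y) u) (at x) v" for u v
  proof -
    have sm: "smooth_on S (\<lambda>y. frechet_derivative f (at y) u)" by (rule smooth_on_frechet[OF f])
    have e: "?L (frechet_derivative f (at y) u) = frechet_derivative (\<lambda>y. ?L (f y)) (at y) u" if "y \<in> S" for y
      using smooth_on_has_derivative[OF f that] frechet_derivative_linear[OF L] by (metis differentiableI)
    have "?L (frechet_derivative (\<lambda>y. frechet_derivative f (at y) u) (at x) v)
       = frechet_derivative (\<lambda>y. ?L (frechet_derivative f (at y) u)) (at x) v"
      using smooth_on_has_derivative[OF sm x] by (metis frechet_derivative_linear[OF L] differentiableI)
    also have "frechet_derivative (\<lambda>y. ?L (frechet_derivative f (at y) u)) (at x)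
        = frechet_derivative (\<lambda>y. frechet_derivative (\<lambda>y. ?L (f y)) (at y) u) (at x)"
      using smooth_on_has_derivative[OF smooth_on_linear[OF S L sm] x]
      by (intro frechet_derivative_transform_within_open[OF _ S x] e) (auto intro: differentiableI)
    finally show ?thesis .
  qed
  show "?L (frechet_derivative (\<lambda>y. frechet_derivative f (at y) u) (at x) v)
     = ?L (frechet_derivative (\<lambda>y. frechet_derivative f (at y) v) (at x) u)"
    unfolding * by (rule mixed_derivatives_real[OF S Lf x])
qed

section \<open>Calculus in a chart\<close>

lemma matrix_mult_diff_left: "(A - B) ** C = A ** C - B ** (C :: 'a::ring_1^'n^'m)"
  by (simp add: vec_eq_iff matrix_matrix_mult_def algebra_simps sum_subtractf)

lemma matrix_mult_diff_right: "C ** (A - B) = C ** A - C ** (B :: 'a::ring_1^'n^'m)"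
  by (simp add: vec_eq_iff matrix_matrix_mult_def algebra_simps sum_subtractf)

lemma matrix_mult_minus_left: "(- A) ** C = - (A ** (C :: 'a::ring_1^'n^'m))"
  by (simp add: vec_eq_iff matrix_matrix_mult_def sum_negf)

lemma matrix_mult_minus_right: "C ** (- A) = - (C ** (A :: 'a::ring_1^'n^'m))"
  by (simp add: vec_eq_iff matrix_matrix_mult_def sum_negf)

lemma matrix_mult_zero_left: "0 ** C = (0 :: 'a::ring_1^'n^'m)"
  by (simp add: vec_eq_iff matrix_matrix_mult_def)

lemma matrix_mult_zero_right: "C ** 0 = (0 :: 'a::ring_1^'n^'m)"
  by (simp add: vec_eq_iff matrix_matrix_mult_def)

lemma cscale_nth: "cscale z A $ i $ j = z * A $ i $ j"
  by (simp add: cscale_def)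

lemma cscale_add: "cscale z (A + B) = cscale z A + cscale z B"
  and cscale_diff: "cscale z (A - B) = cscale z A - cscale z B"
  and cscale_minus: "cscale z (- A) = - cscale z A"
  and cscale_zero: "cscale z 0 = 0"
  and cscale_cscale: "cscale z (cscale w A) = cscale (z * w) A"
  and cscale_1: "cscale 1 A = A"
  and cscale_0: "cscale 0 A = 0"
  and cscale_mult_left: "cscale z A ** C = cscale z (A ** C)"
  and cscale_mult_right: "C' ** cscale z A = cscale z (C' ** A)"
  and cscale_scaleR: "cscale z (x *\<^sub>R A) = x *\<^sub>R cscale z A"
  by (auto simp: vec_eq_iff cscale_nth matrix_matrix_mult_def algebra_simps sum_distrib_left)

lemma scaleR_cscale: "x *\<^sub>R A = cscale (of_real x) A"
  by (simp only: vec_eq_iff cscale_nth vector_scaleR_component) (simp add: scaleR_conv_of_real)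

lemma cscale_mult_vec: "cscale z A *v x = z *s (A *v x)"
  by (simp add: vec_eq_iff cscale_nth matrix_vector_mult_def sum_distrib_left algebra_simps)

lemma matrix_mult_add_left: "(A + B) ** C = A ** C + B ** (C :: 'a::ring_1^'n^'m)"
  by (simp add: vec_eq_iff matrix_matrix_mult_def algebra_simps sum.distrib)

lemmas matrix_ring = matrix_add_ldistrib matrix_mult_add_left matrix_mult_diff_left
  matrix_mult_diff_right matrix_mult_minus_left matrix_mult_minus_right matrix_mult_zero_left
  matrix_mult_zero_right matrix_mul_assoc[symmetric] cscale_add cscale_diff cscale_minus cscale_zero
  cscale_cscale cscale_mult_left cscale_mult_right

lemma bounded_bilinear_matrix_mult:
  "bounded_bilinear ((**) :: complex^'n^'k \<Rightarrow> complex^'m^'n \<Rightarrow> complex^'m^'k)"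
  unfolding bilinear_conv_bounded_bilinear[symmetric] bilinear_def
  by (auto intro!: linearI simp: matrix_ring scaleR_cscale)

lemma bounded_bilinear_matrix_vec:
  "bounded_bilinear ((*v) :: complex^'n^'k \<Rightarrow> complex^'n \<Rightarrow> complex^'k)"
  unfolding bilinear_conv_bounded_bilinear[symmetric] bilinear_def
  by (auto intro!: linearI simp: algebra_simps scaleR_cscale cscale_mult_vec)
    (simp only: vec_eq_iff vector_scaleR_component vector_smult_component, simp add: scaleR_conv_of_real)

lemma bounded_linear_cscale: "bounded_linear (cscale z :: complex^'n^'k \<Rightarrow> _)"
  unfolding linear_conv_bounded_linear[symmetric]
  by (auto intro!: linearI simp: cscale_add cscale_scaleR)

section \<open>Smooth functions and their differentials in a single chart\<close>

definition chart_smooth :: "'m chart \<Rightarrow> ('m \<Rightarrow> 'b::real_normed_vector) \<Rightarrow> bool" where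
  "chart_smooth c f \<longleftrightarrow> smooth_on (chart_map c ` chart_dom c) (f \<circ> chart_inv c)"

lemma smooth_map_chart_smooth: "smooth_map \<A> f \<Longrightarrow> c \<in> \<A> \<Longrightarrow> chart_smooth c f"
  by (simp add: smooth_map_on_def chart_smooth_def)

locale surface_chart =
  fixes c :: "'m::topological_space chart"
  assumes open_dom: "open (chart_dom c)"
    and open_img: "open (chart_map c ` chart_dom c)"
    and homeo: "homeomorphism (chart_dom c) (chart_map c ` chart_dom c) (chart_map c) (chart_inv c)"
begin

lemma inv_chart[simp]: "p \<in> chart_dom c \<Longrightarrow> chart_inv c (chart_map c p) = p"
  using homeo by (simp add: homeomorphism_def)

lemma open_chart_image:
  assumes W: "open W"
  shows "open (chart_map c ` (chart_dom c \<inter> W))"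
proof -
  have "chart_map c ` (chart_dom c \<inter> W) = chart_map c ` chart_dom c \<inter> chart_inv c -` W"
    by (auto simp: rev_image_eqI)
  moreover have "open (chart_map c ` chart_dom c \<inter> chart_inv c -` W)"
    using homeo open_img W by (intro continuous_open_preimage) (auto simp: homeomorphism_def)
  ultimately show ?thesis by simp
qed

lemma chart_smooth_const: "chart_smooth c (\<lambda>_. a)"
  unfolding chart_smooth_def o_def by (rule smooth_on_const[OF open_img])

lemma chart_smooth_add: "chart_smooth c f \<Longrightarrow> chart_smooth c h \<Longrightarrow> chart_smooth c (\<lambda>p. f p + h p)"
  unfolding chart_smooth_def o_def by (rule smooth_on_add[OF open_img])

lemma chart_smooth_diff: "chart_smooth c f \<Longrightarrow> chart_smooth c h \<Longrightarrow> chart_smooth c (\<lambda>p. f p - h p)"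
  unfolding chart_smooth_def o_def by (rule smooth_on_diff[OF open_img])

lemma chart_smooth_minus: "chart_smooth c f \<Longrightarrow> chart_smooth c (\<lambda>p. - f p)"
  unfolding chart_smooth_def o_def by (rule smooth_on_minus[OF open_img])

lemma chart_smooth_linear: "bounded_linear L \<Longrightarrow> chart_smooth c f \<Longrightarrow> chart_smooth c (\<lambda>p. L (f p))"
  unfolding chart_smooth_def o_def by (rule smooth_on_linear[OF open_img])

lemma chart_smooth_bilinear:
  "bounded_bilinear B \<Longrightarrow> chart_smooth c f \<Longrightarrow> chart_smooth c h \<Longrightarrow> chart_smooth c (\<lambda>p. B (f p) (h p))"
  unfolding chart_smooth_def o_def by (rule smooth_on_bilinear[OF open_img])

lemma chart_smooth_sum:
  "(\<And>i. i \<in> I \<Longrightarrow> chart_smooth c (f i)) \<Longrightarrow> chart_smooth c (\<lambda>p. \<Sum>i\<in>I. f i p)"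
  unfolding chart_smooth_def o_def by (rule smooth_on_sum[OF open_img])

lemma chart_smooth_cong:
  assumes "\<And>p. p \<in> chart_dom c \<Longrightarrow> f p = h p" "chart_smooth c f"
  shows "chart_smooth c h"
  using assms(2) unfolding chart_smooth_def
  by (rule smooth_on_cong[OF open_img, rotated]) (use assms(1) in auto)

lemmas chart_smooth_matrix_mult = chart_smooth_bilinear[OF bounded_bilinear_matrix_mult]
lemmas chart_smooth_matrix_vec = chart_smooth_bilinear[OF bounded_bilinear_matrix_vec]
lemmas chart_smooth_cscale = chart_smooth_linear[OF bounded_linear_cscale]

lemma chart_smooth_extd: "chart_smooth c f \<Longrightarrow> chart_smooth c (\<lambda>p. extd f c p u)"
  unfolding chart_smooth_def
  by (rule smooth_on_cong[OF open_img _ smooth_on_frechet[where f = "f \<circ> chart_inv c" and v = u]])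
    (auto simp: extd_def)

lemma chart_smooth_has_derivative:
  assumes "chart_smooth c f" "p \<in> chart_dom c"
  shows "((f \<circ> chart_inv c) has_derivative extd f c p) (at (chart_map c p))"
  using smooth_on_has_derivative[OF assms(1)[unfolded chart_smooth_def]] assms(2)
  by (simp add: extd_def[abs_def])

lemma linear_extd: "chart_smooth c f \<Longrightarrow> p \<in> chart_dom c \<Longrightarrow> linear (extd f c p)"
  by (blast intro: has_derivative_linear chart_smooth_has_derivative)

lemma extd_eqI:
  assumes "((f \<circ> chart_inv c) has_derivative L) (at (chart_map c p))"
  shows "extd f c p u = L u"
  using frechet_derivative_at[OF assms] by (simp add: extd_def)

lemma extd_const: "extd (\<lambda>_. a) c p u = 0"
  by (simp add: extd_def o_def)

lemma extd_cong:
  assumes "\<And>x. x \<in> chart_dom c \<Longrightarrow> f x = h x" "chart_smooth c f" "p \<in> chart_dom c"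
  shows "extd h c p u = extd f c p u"
  by (rule extd_eqI, rule has_derivative_transform_within_open[OF chart_smooth_has_derivative[OF assms(2,3)] open_img])
    (use assms in auto)

lemma extd_linear:
  assumes "bounded_linear L" "chart_smooth c f" "p \<in> chart_dom c"
  shows "extd (\<lambda>x. L (f x)) c p u = L (extd f c p u)"
  by (rule extd_eqI, use bounded_linear.has_derivative[OF assms(1) chart_smooth_has_derivative[OF assms(2,3)]]
      in \<open>simp add: o_def\<close>)

lemma extd_add:
  assumes "chart_smooth c f" "chart_smooth c h" "p \<in> chart_dom c"
  shows "extd (\<lambda>x. f x + h x) c p u = extd f c p u + extd h c p u"
  by (rule extd_eqI, use has_derivative_add[OF assms(1,2)[THEN chart_smooth_has_derivative, OF assms(3)]]
      in \<open>simp add: o_def\<close>)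

lemma extd_diff:
  assumes "chart_smooth c f" "chart_smooth c h" "p \<in> chart_dom c"
  shows "extd (\<lambda>x. f x - h x) c p u = extd f c p u - extd h c p u"
  by (rule extd_eqI, use has_derivative_diff[OF assms(1,2)[THEN chart_smooth_has_derivative, OF assms(3)]]
      in \<open>simp add: o_def\<close>)

lemma extd_minus:
  assumes "chart_smooth c f" "p \<in> chart_dom c"
  shows "extd (\<lambda>x. - f x) c p u = - extd f c p u"
  by (rule extd_linear[OF _ assms]) (auto intro: bounded_linear_minus bounded_linear_ident)

lemma extd_bilinear:
  assumes "bounded_bilinear B" "chart_smooth c f" "chart_smooth c h" "p \<in> chart_dom c"
  shows "extd (\<lambda>x. B (f x) (h x)) c p u = B (extd f c p u) (h p) + B (f p) (extd h c p u)"
  by (rule extd_eqI, use bounded_bilinear.FDERIV[OF assms(1) assms(2,3)[THEN chart_smooth_has_derivative, OF assms(4)]]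
      assms(4) in \<open>simp add: o_def add.commute\<close>)

lemma extd_sum:
  assumes "\<And>i. i \<in> I \<Longrightarrow> chart_smooth c (f i)" "p \<in> chart_dom c"
  shows "extd (\<lambda>x. \<Sum>i\<in>I. f i x) c p u = (\<Sum>i\<in>I. extd (f i) c p u)"
  using assms(1)
  by (induction I rule: infinite_finite_induct)
    (simp_all add: extd_const extd_add chart_smooth_sum assms(2))

lemmas extd_matrix_mult = extd_bilinear[OF bounded_bilinear_matrix_mult]
lemmas extd_matrix_vec = extd_bilinear[OF bounded_bilinear_matrix_vec]
lemmas extd_cscale = extd_linear[OF bounded_linear_cscale]

text \<open>Coordinate vector fields commute. This removes the second derivatives in
  \<open>curv_gauge\<close> and in \<open>dext_a\<close>.\<close>

lemma extd_commute:
  fixes f :: "'m \<Rightarrow> 'b::euclidean_space"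
  assumes f: "chart_smooth c f" and p: "p \<in> chart_dom c"
  shows "extd (\<lambda>x. extd f c x u) c p v = extd (\<lambda>x. extd f c x v) c p u"
proof -
  let ?F = "f \<circ> chart_inv c"
  have "extd (\<lambda>x. extd f c x u) c p v = frechet_derivative (\<lambda>y. frechet_derivative ?F (at y) u) (at (chart_map c p)) v"
    for u v
  proof (rule extd_eqI)
    have "smooth_on (chart_map c ` chart_dom c) (\<lambda>y. frechet_derivative ?F (at y) u)"
      using f unfolding chart_smooth_def by (rule smooth_on_frechet)
    from smooth_on_has_derivative[OF this]
    have "((\<lambda>y. frechet_derivative ?F (at y) u) has_derivative
        frechet_derivative (\<lambda>y. frechet_derivative ?F (at y) u) (at (chart_map c p))) (at (chart_map c p))"
      using p by blast
    then show "((\<lambda>x. extd f c x u) \<circ> chart_inv c has_derivative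
        frechet_derivative (\<lambda>y. frechet_derivative ?F (at y) u) (at (chart_map c p))) (at (chart_map c p))"
      by (rule has_derivative_transform_within_open[OF _ open_img]) (use p in \<open>auto simp: extd_def\<close>)
  qed
  then show ?thesis
    using mixed_derivatives[OF open_img f[unfolded chart_smooth_def]] p by simp
qed

end

lemma surface_chart_atlas: "oriented_surface_atlas \<A> \<Longrightarrow> c \<in> \<A> \<Longrightarrow> surface_chart c"
  unfolding oriented_surface_atlas_def by (auto intro: surface_chart.intro)

section \<open>The bilinear form and orthogonal projections\<close>

lemma mink_sym: "mink \<tau> v w = mink \<tau> w (v :: 'a::comm_ring_1^'n)"
  by (simp add: mink_def ac_simps)

lemma mink_add_left: "mink \<tau> (v + v') w = mink \<tau> v w + mink \<tau> v' w"
  and mink_add_right: "mink \<tau> w (v + v') = mink \<tau> w v + mink \<tau> w v'"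
  and mink_diff_left: "mink \<tau> (v - v') w = mink \<tau> v w - mink \<tau> v' w"
  and mink_diff_right: "mink \<tau> w (v - v') = mink \<tau> w v - mink \<tau> w v'"
  and mink_scale_left: "mink \<tau> (z *s v) w = z * mink \<tau> v w"
  and mink_scale_right: "mink \<tau> w (z *s v) = z * mink \<tau> w v"
  and mink_zero_left: "mink \<tau> 0 w = 0"
  and mink_zero_right: "mink \<tau> w 0 = 0"
  by (simp_all add: mink_def algebra_simps sum.distrib sum_subtractf sum_distrib_left)

lemmas mink_linear = mink_add_left mink_add_right mink_diff_left mink_diff_right mink_scale_left
  mink_scale_right mink_zero_left mink_zero_right

lemma mink_axis: "mink \<tau> (axis i 1) w = (if i = \<tau> then - 1 else 1) * w $ i"
proof -
  have "mink \<tau> (axis i 1) w = (\<Sum>j\<in>UNIV. if j = i then (if i = \<tau> then - 1 else 1) * w $ i else 0)"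
    unfolding mink_def by (rule sum.cong) (auto simp: axis_def)
  then show ?thesis by simp
qed

lemma mink_nondegenerate: "(\<And>w. mink \<tau> v w = 0) \<Longrightarrow> v = (0 :: complex^'n)"
  using mink_axis[of \<tau> _ v] by (simp add: vec_eq_iff mink_sym[of \<tau> v]) (metis mult_eq_0_iff neg_equal_0_iff_equal one_neq_zero)

lemma mink_eqI: "(\<And>w. mink \<tau> v w = mink \<tau> v' w) \<Longrightarrow> v = (v' :: complex^'n)"
  using mink_nondegenerate[of \<tau> "v - v'"] by (simp add: mink_linear)

section \<open>Adjoints and isometries of the bilinear form\<close>

definition eta :: "'n::finite \<Rightarrow> complex^'n^'n" where
  "eta \<tau> = (\<chi> i j. if i = j then (if i = \<tau> then - 1 else 1) else 0)"

text \<open>The adjoint with respect to \<open>mink\<close>. For an isometry it is the inverse and,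
  unlike \<open>matrix_inv\<close>, it is linear in the matrix, so smoothness, derivatives and
  limits of the inverse follow from those of the isometry.\<close>

definition madj :: "'n::finite \<Rightarrow> complex^'n^'n \<Rightarrow> complex^'n^'n" where
  "madj \<tau> R = eta \<tau> ** transpose R ** eta \<tau>"

lemma madj_nth:
  fixes R :: "complex^'n^'n"
  shows "madj \<tau> R $ i $ j = (if i = \<tau> then - 1 else 1) * R $ j $ i * (if j = \<tau> then - 1 else 1)"
proof -
  have 1: "(eta \<tau> ** B) $ i $ j = (if i = \<tau> then - 1 else 1) * B $ i $ j" for B :: "complex^'n^'n" and i j
  proof -
    have "(eta \<tau> ** B) $ i $ j = (\<Sum>k\<in>UNIV. if k = i then (if i = \<tau> then - 1 else 1) * B $ i $ j else 0)"
      unfolding matrix_matrix_mult_def eta_def vec_lambda_beta by (rule sum.cong) auto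
    then show ?thesis by simp
  qed
  have 2: "(B ** eta \<tau>) $ i $ j = B $ i $ j * (if j = \<tau> then - 1 else 1)" for B :: "complex^'n^'n" and i j
  proof -
    have "(B ** eta \<tau>) $ i $ j = (\<Sum>k\<in>UNIV. if k = j then B $ i $ j * (if j = \<tau> then - 1 else 1) else 0)"
      unfolding matrix_matrix_mult_def eta_def vec_lambda_beta by (rule sum.cong) auto
    then show ?thesis by simp
  qed
  show ?thesis by (simp add: madj_def 1 2 transpose_def)
qed

lemma mink_madj: "mink \<tau> (R *v v) w = mink \<tau> v (madj \<tau> R *v w)"
proof -
  have "mink \<tau> (R *v v) w = (\<Sum>i\<in>UNIV. \<Sum>j\<in>UNIV. (if i = \<tau> then - 1 else 1) * R $ i $ j * v $ j * w $ i)"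
    unfolding mink_def matrix_vector_mult_def by (simp add: sum_distrib_left sum_distrib_right algebra_simps)
  also have "\<dots> = (\<Sum>j\<in>UNIV. \<Sum>i\<in>UNIV. (if i = \<tau> then - 1 else 1) * R $ i $ j * v $ j * w $ i)"
    by (rule sum.swap)
  also have "\<dots> = mink \<tau> v (madj \<tau> R *v w)"
    unfolding mink_def matrix_vector_mult_def madj_nth
    by (auto simp add: sum_distrib_left intro!: sum.cong)
  finally show ?thesis .
qed

definition isometry :: "'n::finite \<Rightarrow> complex^'n^'n \<Rightarrow> bool" where
  "isometry \<tau> R \<longleftrightarrow> (\<forall>v w. mink \<tau> (R *v v) (R *v w) = mink \<tau> v w)"

lemma madj_mult_isometry:
  assumes "isometry \<tau> R"
  shows "madj \<tau> R ** R = mat 1" "R ** madj \<tau> R = mat 1"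
proof -
  have "(madj \<tau> R ** R) *v w = mat 1 *v w" for w
    using assms by (intro mink_eqI[of \<tau>])
      (metis isometry_def matrix_vector_mul_assoc matrix_vector_mul_lid mink_madj mink_sym)
  then show "madj \<tau> R ** R = mat 1" by (simp add: matrix_eq)
  then show "R ** madj \<tau> R = mat 1" by (simp add: matrix_left_right_inverse)
qed

lemma matrix_inv_unique:
  fixes A :: "complex^'n^'n"
  assumes "B ** A = mat 1"
  shows "matrix_inv A = B"
proof -
  have AB: "A ** B = mat 1" using assms by (simp add: matrix_left_right_inverse)
  have "invertible A" using assms AB unfolding invertible_def by blast
  then have "A ** matrix_inv A = mat 1"
    unfolding matrix_inv_def invertible_def by (rule someI2_ex) simp
  then have "B ** A ** matrix_inv A = B" by (metis matrix_mul_assoc matrix_mul_rid)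
  then show ?thesis by (simp add: assms)
qed

lemma matrix_inv_isometry: "isometry \<tau> R \<Longrightarrow> matrix_inv R = madj \<tau> R"
  by (rule matrix_inv_unique[OF madj_mult_isometry(1)])

lemma isometry_madj: "isometry \<tau> R \<Longrightarrow> isometry \<tau> (madj \<tau> R)"
  unfolding isometry_def
  by (metis isometry_def madj_mult_isometry(2) matrix_vector_mul_assoc matrix_vector_mul_lid)

lemma bounded_linear_madj: "bounded_linear (madj \<tau>)"
  unfolding linear_conv_bounded_linear[symmetric]
  by (rule linearI) (simp_all add: vec_eq_iff madj_nth algebra_simps)

lemma madj_cscale: "madj \<tau> (cscale z A) = cscale z (madj \<tau> A)"
  by (simp add: vec_eq_iff madj_nth cscale_nth)

lemma madj_madj: "madj \<tau> (madj \<tau> A) = A"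
  by (simp add: vec_eq_iff madj_nth)

section \<open>Orthogonal projections onto non-degenerate subspaces\<close>

definition nondeg_proj :: "'n::finite \<Rightarrow> (complex^'n) set \<Rightarrow> complex^'n^'n \<Rightarrow> bool" where
  "nondeg_proj \<tau> W P \<longleftrightarrow> vec.subspace W \<and> (\<forall>v\<in>W. (\<forall>w\<in>W. mink \<tau> v w = 0) \<longrightarrow> v = 0) \<and>
     (\<forall>v. P *v v \<in> W \<and> v - P *v v \<in> perp \<tau> W)"

lemma proj_eqI:
  assumes "\<And>v. P *v v \<in> W \<and> v - P *v v \<in> perp \<tau> W"
    "\<And>v w w'. w \<in> W \<Longrightarrow> v - w \<in> perp \<tau> W \<Longrightarrow> w' \<in> W \<Longrightarrow> v - w' \<in> perp \<tau> W \<Longrightarrow> w = w'"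
  shows "proj \<tau> W = P"
proof -
  have "(THE w. w \<in> W \<and> v - w \<in> perp \<tau> W) = P *v v" for v
    by (rule the_equality) (use assms in blast)+
  then show ?thesis unfolding proj_def by simp
qed

context
  fixes \<tau> :: "'n::finite" and W P
  assumes np: "nondeg_proj \<tau> W P"
begin

lemma np_subspace: "vec.subspace W" and np_in: "P *v v \<in> W" and np_perp: "v - P *v v \<in> perp \<tau> W"
  and np_nondeg: "v \<in> W \<Longrightarrow> (\<And>w. w \<in> W \<Longrightarrow> mink \<tau> v w = 0) \<Longrightarrow> v = 0"
  using np by (auto simp: nondeg_proj_def)

lemma np_proj: "proj \<tau> W = P"
proof (rule proj_eqI)
  fix v w w' assume *: "w \<in> W" "v - w \<in> perp \<tau> W" "w' \<in> W" "v - w' \<in> perp \<tau> W"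
  have "w - w' = 0"
  proof (rule np_nondeg)
    show "w - w' \<in> W" using * np_subspace by (simp add: vec.subspace_diff)
    show "mink \<tau> (w - w') y = 0" if "y \<in> W" for y
      using *(2,4) that by (auto simp: perp_def mink_linear)
  qed
  then show "w = w'" by simp
qed (simp add: np_in np_perp)

lemma np_self: "v \<in> W \<Longrightarrow> P *v v = v"
proof -
  assume v: "v \<in> W"
  have "v - P *v v = 0"
    using v np_perp[of v] by (intro np_nondeg) (auto simp: perp_def vec.subspace_diff np_subspace np_in)
  then show ?thesis by simp
qed

lemma np_idem: "P ** P = P"
  by (simp add: matrix_eq matrix_vector_mul_assoc[symmetric] np_self np_in)

lemma np_mem_iff: "v \<in> W \<longleftrightarrow> P *v v = v"
  using np_self np_in by metis

text \<open>The double complement is never identified with \<open>W\<close>: two candidates are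
  compared by pairing their difference with an arbitrary \<open>y\<close>, split into
  \<open>P y\<close> and \<open>y - P y\<close>.\<close>

lemma np_proj_perp: "proj \<tau> (perp \<tau> W) = mat 1 - P"
proof (rule proj_eqI)
  show "(mat 1 - P) *v v \<in> perp \<tau> W \<and> v - (mat 1 - P) *v v \<in> perp \<tau> (perp \<tau> W)" for v
    using np_perp[of v] np_in[of v]
    by (auto simp: algebra_simps perp_def) (metis mink_sym)
  fix v w w' assume *: "w \<in> perp \<tau> W" "v - w \<in> perp \<tau> (perp \<tau> W)" "w' \<in> perp \<tau> W" "v - w' \<in> perp \<tau> (perp \<tau> W)"
  have "w' - w = 0"
  proof (rule mink_nondegenerate[of \<tau>])
    fix y
    have "mink \<tau> (v - w) (y - P *v y) = 0" "mink \<tau> (v - w') (y - P *v y) = 0"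
      using *(2,4) np_perp[of y] unfolding perp_def[of \<tau> "perp \<tau> W"] by blast+
    moreover have "mink \<tau> (w' - w) x = mink \<tau> (v - w) x - mink \<tau> (v - w') x" for x
      by (simp add: mink_diff_left)
    ultimately have 1: "mink \<tau> (w' - w) (y - P *v y) = 0" by simp
    have "mink \<tau> w (P *v y) = 0" "mink \<tau> w' (P *v y) = 0"
      using *(1,3) np_in[of y] unfolding perp_def by blast+
    then have 2: "mink \<tau> (w' - w) (P *v y) = 0" by (simp add: mink_linear)
    show "mink \<tau> (w' - w) y = 0" using 1 2 by (simp add: mink_linear)
  qed
  then show "w = w'" by simp
qed

end

lemma nondeg_proj_isometry:
  assumes np: "nondeg_proj \<tau> W P" and R: "isometry \<tau> R"
  shows "nondeg_proj \<tau> ((*v) R ` W) (R ** P ** madj \<tau> R)"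
  unfolding nondeg_proj_def
proof (intro conjI ballI allI impI)
  note inv = madj_mult_isometry[OF R]
  show "vec.subspace ((*v) R ` W)"
    by (rule vec.subspace_image[OF np_subspace[OF np]])
  show "v = 0" if v: "v \<in> (*v) R ` W" and o: "\<forall>w\<in>(*v) R ` W. mink \<tau> v w = 0" for v
  proof -
    obtain x where x: "v = R *v x" "x \<in> W" using v by auto
    have "x = 0" using o x R by (intro np_nondeg[OF np]) (auto simp: isometry_def)
    then show ?thesis by (simp add: x)
  qed
  show "(R ** P ** madj \<tau> R) *v v \<in> (*v) R ` W" for v
    by (simp add: matrix_vector_mul_assoc[symmetric] np_in[OF np])
  show "v - (R ** P ** madj \<tau> R) *v v \<in> perp \<tau> ((*v) R ` W)" for v
  proof -
    define x where "x = madj \<tau> R *v v"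
    have v: "v = R *v x" by (simp add: x_def matrix_vector_mul_assoc inv)
    have "v - (R ** P ** madj \<tau> R) *v v = R *v (x - P *v x)"
      by (simp add: x_def[symmetric] matrix_vector_mul_assoc[symmetric] algebra_simps) (simp add: v)
    then show ?thesis
      using np_perp[OF np, of x] R by (auto simp: perp_def isometry_def)
  qed
qed

lemma perp_isometry:
  assumes R: "isometry \<tau> R"
  shows "perp \<tau> ((*v) R ` W) = (*v) R ` perp \<tau> W"
proof -
  have "v \<in> (*v) R ` perp \<tau> W" if "v \<in> perp \<tau> ((*v) R ` W)" for v
  proof
    show "v = R *v (madj \<tau> R *v v)" by (simp add: matrix_vector_mul_assoc madj_mult_isometry[OF R])
    show "madj \<tau> R *v v \<in> perp \<tau> W"
      using that by (auto simp: perp_def) (metis mink_madj mink_sym)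
  qed
  then show ?thesis using R by (auto simp: perp_def isometry_def)
qed

section \<open>Decomposable and split endomorphisms\<close>

lemma wedge_apply: "wedge \<tau> v1 v2 *v w = mink \<tau> w v1 *s v2 - mink \<tau> w v2 *s v1"
  unfolding wedge_def
  by (rule matrix_works) (auto intro!: Vector_Spaces.linear.intro simp: module_hom_iff
      vec.vector_space_axioms Vector_Spaces.linear_iff mink_linear algebra_simps)

lemma cscale_wedge: "cscale z (wedge \<tau> v w) = wedge \<tau> (z *s v) w"
  by (simp add: matrix_eq cscale_mult_vec wedge_apply mink_linear vec.scale_right_diff_distrib)

lemma wedge_isometry:
  assumes R: "isometry \<tau> R"
  shows "R ** wedge \<tau> v w ** madj \<tau> R = wedge \<tau> (R *v v) (R *v w)"
proof -
  have "mink \<tau> (madj \<tau> R *v x) v = mink \<tau> x (R *v v)" for x v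
    by (metis madj_madj mink_madj)
  then show ?thesis
    by (simp add: matrix_eq matrix_vector_mul_assoc[symmetric] wedge_apply vec.diff vec.scale)
qed

lemma wedge2_map:
  assumes "A \<in> wedge2 \<tau> W" "linear L"
    "\<And>v w. v \<in> W \<Longrightarrow> w \<in> W \<Longrightarrow> L (wedge \<tau> v w) \<in> wedge2 \<tau> W'"
  shows "L A \<in> wedge2 \<tau> W'"
proof -
  have "A \<in> {A. L A \<in> wedge2 \<tau> W'}"
    using assms(1) unfolding wedge2_def[of \<tau> W]
    by (rule span_induct) (use assms(3) in \<open>auto simp: wedge2_def subspace_def linear_0[OF assms(2)]
      linear_add[OF assms(2)] linear_cmul[OF assms(2)] intro: span_zero span_add span_mul\<close>)
  then show ?thesis by simp
qed

lemma wedge_in_wedge2: "v \<in> W \<Longrightarrow> w \<in> W \<Longrightarrow> wedge \<tau> v w \<in> wedge2 \<tau> W"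
  unfolding wedge2_def by (rule span_base) blast

lemma split_endos_map:
  assumes "A \<in> split_endos \<tau> W" "linear L"
    "\<And>v w. v \<in> W \<Longrightarrow> w \<in> W \<Longrightarrow> L (wedge \<tau> v w) \<in> wedge2 \<tau> W'"
    "\<And>v w. v \<in> perp \<tau> W \<Longrightarrow> w \<in> perp \<tau> W \<Longrightarrow> L (wedge \<tau> v w) \<in> wedge2 \<tau> (perp \<tau> W')"
  shows "L A \<in> split_endos \<tau> W'"
proof -
  obtain B C where "A = B + C" "B \<in> wedge2 \<tau> W" "C \<in> wedge2 \<tau> (perp \<tau> W)"
    using assms(1) by (auto simp: split_endos_def)
  then have "L A = L B + L C" "L B \<in> wedge2 \<tau> W'" "L C \<in> wedge2 \<tau> (perp \<tau> W')"
    using assms(2-) by (auto simp: linear_add intro: wedge2_map)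
  then show ?thesis by (auto simp: split_endos_def)
qed

lemma split_endos_cscale:
  assumes "A \<in> split_endos \<tau> W" "vec.subspace W"
  shows "cscale z A \<in> split_endos \<tau> W"
  using assms
  by (intro split_endos_map[OF assms(1)])
    (auto simp: cscale_wedge linear_conv_bounded_linear bounded_linear_cscale vec.subspace_scale perp_def
      mink_linear intro!: wedge_in_wedge2)

lemma split_endos_add:
  assumes "A \<in> split_endos \<tau> W" "B \<in> split_endos \<tau> W"
  shows "A + B \<in> split_endos \<tau> W"
proof -
  obtain A1 A2 B1 B2 where "A = A1 + A2" "B = B1 + B2" "A1 \<in> wedge2 \<tau> W" "B1 \<in> wedge2 \<tau> W"
    "A2 \<in> wedge2 \<tau> (perp \<tau> W)" "B2 \<in> wedge2 \<tau> (perp \<tau> W)"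
    using assms by (auto simp: split_endos_def)
  then have "A + B = (A1 + B1) + (A2 + B2)" "A1 + B1 \<in> wedge2 \<tau> W" "A2 + B2 \<in> wedge2 \<tau> (perp \<tau> W)"
    by (simp_all add: wedge2_def span_add)
  then show ?thesis unfolding split_endos_def by blast
qed

lemma split_endos_isometry:
  assumes "A \<in> split_endos \<tau> W" and R: "isometry \<tau> R"
  shows "R ** A ** madj \<tau> R \<in> split_endos \<tau> ((*v) R ` W)"
proof (rule split_endos_map[OF assms(1)])
  show "linear (\<lambda>A. R ** A ** madj \<tau> R)"
    by (rule linearI) (simp_all add: matrix_ring scaleR_cscale)
qed (auto simp: wedge_isometry[OF R] perp_isometry[OF R] intro!: wedge_in_wedge2)

section \<open>Smoothness of the orthogonal projections\<close>

lemma smooth_on_matrix_iff: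
  fixes f :: "'a::real_normed_vector \<Rightarrow> complex^'n^'k"
  assumes "open S"
  shows "smooth_on S f \<longleftrightarrow> (\<forall>i j. smooth_on S (\<lambda>x. f x $ i $ j))"
  by (simp add: smooth_on_vec_iff[OF assms])

lemma smooth_on_if:
  "(b \<Longrightarrow> smooth_on S f) \<Longrightarrow> (\<not> b \<Longrightarrow> smooth_on S h) \<Longrightarrow> smooth_on S (\<lambda>x. if b then f x else h x)"
  by (cases b) simp_all

lemma smooth_on_det:
  fixes A :: "'a::real_normed_vector \<Rightarrow> complex^'n^'n"
  assumes S: "open S" and A: "\<And>i j. smooth_on S (\<lambda>x. A x $ i $ j)"
  shows "smooth_on S (\<lambda>x. det (A x))"
  unfolding det_def by (intro smooth_on_sum smooth_on_mult smooth_on_prod smooth_on_const S A)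

lemma matrix_vec_axis: "(A :: complex^'n^'k) *v axis j 1 = column j A"
  by (simp add: vec_eq_iff matrix_vector_mult_def column_def axis_def if_distrib cong: if_cong)

lemma matrix_mult_inv:
  fixes A :: "complex^'n^'n"
  assumes "invertible A"
  shows "A ** matrix_inv A = mat 1" "matrix_inv A ** A = mat 1"
proof -
  have "A ** matrix_inv A = mat 1 \<and> matrix_inv A ** A = mat 1"
    using assms unfolding matrix_inv_def invertible_def by (rule someI_ex)
  then show "A ** matrix_inv A = mat 1" "matrix_inv A ** A = mat 1" by simp_all
qed

text \<open>Cramer's rule. It presents the entries of the inverse through determinants and one
  reciprocal, which are visibly smooth in the entries of \<open>A\<close>.\<close>

lemma matrix_inv_nth:
  fixes A :: "complex^'n^'n"
  assumes "det A \<noteq> 0"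
  shows "matrix_inv A $ i $ j = det (\<chi> a b. if b = i then axis j 1 $ a else A $ a $ b) * inverse (det A)"
proof -
  have "A *v (matrix_inv A *v axis j 1) = axis j 1"
    using assms by (simp add: matrix_vector_mul_assoc matrix_mult_inv invertible_det_nz)
  then have "matrix_inv A *v axis j 1 = (\<chi> k. det (\<chi> a b. if b = k then axis j 1 $ a else A $ a $ b) / det A)"
    by (simp only: cramer[OF assms])
  then have "(matrix_inv A *v axis j 1) $ i = det (\<chi> a b. if b = i then axis j 1 $ a else A $ a $ b) / det A"
    by simp
  then show ?thesis by (simp add: matrix_vec_axis column_def divide_inverse)
qed

lemma smooth_on_matrix_inv:
  fixes A :: "'a::real_normed_vector \<Rightarrow> complex^'n^'n"
  assumes S: "open S" and A: "smooth_on S A" and d: "\<And>x. x \<in> S \<Longrightarrow> det (A x) \<noteq> 0"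
  shows "smooth_on S (\<lambda>x. matrix_inv (A x))"
  unfolding smooth_on_matrix_iff[OF S]
proof (intro allI)
  fix i j
  have Aij: "smooth_on S (\<lambda>x. A x $ i $ j)" for i j using A smooth_on_matrix_iff[OF S] by blast
  have "smooth_on S (\<lambda>x. det (\<chi> a b. if b = i then axis j 1 $ a else A x $ a $ b) * inverse (det (A x)))"
    by (intro smooth_on_mult smooth_on_inverse smooth_on_det S d)
      (auto simp: Aij smooth_on_const[OF S] intro!: smooth_on_if)
  then show "smooth_on S (\<lambda>x. matrix_inv (A x) $ i $ j)"
    by (rule smooth_on_cong[OF S, rotated]) (simp add: matrix_inv_nth d)
qed

text \<open>The projection onto the span of the vectors \<open>t l\<close>, \<open>l \<in> I\<close>, is \<open>X K\<^sup>-\<^sup>1 B\<close> with \<open>X\<close> the matrix of the frame,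
  \<open>B\<close> the matrix of \<open>v \<mapsto> (t l, v)\<^sub>l\<close> and \<open>K\<close> the Gram matrix, padded by the identity outside \<open>I\<close>.\<close>

definition frame_matrix :: "'n set \<Rightarrow> ('n \<Rightarrow> complex^'n) \<Rightarrow> complex^'n^'n" where
  "frame_matrix I t = (\<chi> i l. if l \<in> I then t l $ i else 0)"

definition gram_matrix :: "'n::finite \<Rightarrow> 'n set \<Rightarrow> ('n \<Rightarrow> complex^'n) \<Rightarrow> complex^'n^'n" where
  "gram_matrix \<tau> I t = (\<chi> l m. if l \<in> I then if m \<in> I then mink \<tau> (t l) (t m) else 0 else if l = m then 1 else 0)"

definition coframe_matrix :: "'n::finite \<Rightarrow> 'n set \<Rightarrow> ('n \<Rightarrow> complex^'n) \<Rightarrow> complex^'n^'n" where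
  "coframe_matrix \<tau> I t = (\<chi> l j. if l \<in> I then mink \<tau> (t l) (axis j 1) else 0)"

lemma frame_matrix_vec: "frame_matrix I t *v y = (\<Sum>l\<in>I. y $ l *s t l)"
proof -
  have "(frame_matrix I t *v y) $ i = (\<Sum>l\<in>UNIV. if l \<in> I then y $ l * t l $ i else 0)" for i
    unfolding matrix_vector_mult_def frame_matrix_def vec_lambda_beta by (rule sum.cong) auto
  then show ?thesis by (simp add: vec_eq_iff sum.If_cases)
qed

lemma mink_sum_right: "mink \<tau> v (\<Sum>l\<in>I. f l) = (\<Sum>l\<in>I. mink \<tau> v (f l))"
  by (induction I rule: infinite_finite_induct) (simp_all add: mink_linear)

lemma gram_matrix_vec:
  "(gram_matrix \<tau> I t *v y) $ l = (if l \<in> I then mink \<tau> (t l) (frame_matrix I t *v y) else y $ l)"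
proof (cases "l \<in> I")
  case True
  have "(gram_matrix \<tau> I t *v y) $ l = (\<Sum>m\<in>UNIV. if m \<in> I then y $ m * mink \<tau> (t l) (t m) else 0)"
    unfolding matrix_vector_mult_def gram_matrix_def vec_lambda_beta using True
    by (intro sum.cong) auto
  also have "\<dots> = mink \<tau> (t l) (frame_matrix I t *v y)"
    by (simp add: frame_matrix_vec mink_sum_right mink_linear sum.If_cases)
  finally show ?thesis using True by simp
next
  case False
  have "(gram_matrix \<tau> I t *v y) $ l = (\<Sum>m\<in>UNIV. if m = l then y $ l else 0)"
    unfolding matrix_vector_mult_def gram_matrix_def vec_lambda_beta using False
    by (intro sum.cong) auto
  then show ?thesis using False by simp
qed

lemma coframe_matrix_vec:
  "(coframe_matrix \<tau> I t *v v) $ l = (if l \<in> I then mink \<tau> (t l) v else 0)"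
proof (cases "l \<in> I")
  case True
  have "(coframe_matrix \<tau> I t *v v) $ l = (\<Sum>j\<in>UNIV. mink \<tau> (t l) (axis j 1) * v $ j)"
    using True by (simp add: matrix_vector_mult_def coframe_matrix_def)
  also have "\<dots> = mink \<tau> (t l) v"
    unfolding mink_sym[of \<tau> "t l" "axis _ 1"] mink_axis by (simp add: mink_def)
  finally show ?thesis using True by simp
qed (simp add: matrix_vector_mult_def coframe_matrix_def)

text \<open>For \<open>y\<close> in the kernel of the Gram matrix, the frame combination of
  \<open>y\<close> is orthogonal to the span, hence zero by non-degeneracy; independence then kills
  the entries of \<open>y\<close> in \<open>I\<close>, and the identity padding those
  outside.\<close>

lemma frame_projection:
  fixes t :: "'n::finite \<Rightarrow> complex^'n"
  assumes inj: "inj_on t I" and ind: "vec.independent (t ` I)"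
    and nd: "\<And>v. v \<in> vec.span (t ` I) \<Longrightarrow> (\<And>w. w \<in> vec.span (t ` I) \<Longrightarrow> mink \<tau> v w = 0) \<Longrightarrow> v = 0"
  shows "det (gram_matrix \<tau> I t) \<noteq> 0" (is "det ?K \<noteq> 0")
    and "nondeg_proj \<tau> (vec.span (t ` I)) (frame_matrix I t ** matrix_inv (gram_matrix \<tau> I t) ** coframe_matrix \<tau> I t)"
proof -
  let ?W = "vec.span (t ` I)" and ?X = "frame_matrix I t" and ?B = "coframe_matrix \<tau> I t"
  have XW: "?X *v y \<in> ?W" for y
    unfolding frame_matrix_vec by (intro vec.span_sum vec.span_scale vec.span_base) auto
  have X0: "y $ l = 0" if "?X *v y = 0" "l \<in> I" for y :: "complex^'n" and l
  proof -
    have "(\<Sum>v\<in>t ` I. y $ the_inv_into I t v *s v) = 0"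
      using that(1) unfolding frame_matrix_vec by (simp add: sum.reindex[OF inj] the_inv_into_f_f[OF inj])
    then have "y $ the_inv_into I t (t l) = 0"
      using ind that(2) unfolding vec.independent_explicit
      by (auto dest!: spec[of _ "\<lambda>v. y $ the_inv_into I t v"])
    then show ?thesis by (simp add: the_inv_into_f_f[OF inj that(2)])
  qed
  have orth: "mink \<tau> v w = 0" if "\<And>l. l \<in> I \<Longrightarrow> mink \<tau> (t l) v = 0" "w \<in> ?W" for v w
    using that(2)
    by (induction rule: vec.span_induct_alt) (auto simp: mink_linear mink_sym[of \<tau> v] that(1))
  have "y = 0" if "?K *v y = 0" for y
  proof -
    have *: "(if l \<in> I then mink \<tau> (t l) (?X *v y) else y $ l) = 0" for l
      using that gram_matrix_vec[of \<tau> I t y l] by simp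
    have "?X *v y = 0"
      by (rule nd[OF XW orth]) (use * in \<open>metis\<close>)
    then show ?thesis using X0 * by (simp add: vec_eq_iff) metis
  qed
  then have "invertible ?K"
    by (simp add: invertible_left_inverse matrix_left_invertible_ker)
  then show "det ?K \<noteq> 0" by (simp add: invertible_det_nz)
  note inv = matrix_mult_inv[OF \<open>invertible ?K\<close>]
  show "nondeg_proj \<tau> ?W (?X ** matrix_inv ?K ** ?B)"
    unfolding nondeg_proj_def
  proof (intro conjI allI ballI impI)
    fix v
    define y where "y = matrix_inv ?K *v (?B *v v)"
    have Py: "(?X ** matrix_inv ?K ** ?B) *v v = ?X *v y"
      by (simp add: y_def matrix_vector_mul_assoc matrix_mul_assoc)
    then show "(?X ** matrix_inv ?K ** ?B) *v v \<in> ?W" by (simp add: XW)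
    have "?K *v y = ?B *v v" by (simp add: y_def matrix_vector_mul_assoc matrix_mul_assoc inv)
    then have "mink \<tau> (t l) (?X *v y) = mink \<tau> (t l) v" if "l \<in> I" for l
      using gram_matrix_vec[of \<tau> I t y l] coframe_matrix_vec[of \<tau> I t v l] that by simp
    then have "mink \<tau> (t l) (v - ?X *v y) = 0" if "l \<in> I" for l
      using that by (simp add: mink_diff_right)
    then have "mink \<tau> (v - ?X *v y) w = 0" if "w \<in> ?W" for w
      using that by (rule orth)
    then show "v - (?X ** matrix_inv ?K ** ?B) *v v \<in> perp \<tau> ?W"
      unfolding Py perp_def by blast
  next
    show "v = 0" if "v \<in> ?W" "\<forall>w\<in>?W. mink \<tau> v w = 0" for v
      by (rule nd[OF that(1)]) (use that(2) in blast)
  qed (rule vec.subspace_span)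
qed

text \<open>The frame is reindexed by a subset of \<open>'n\<close>, possible because the rank is at
  most \<open>CARD('n)\<close>. Frame and Gram matrices then have a fixed square type although the
  rank is only given locally.\<close>

lemma subbundle_frame:
  assumes "smooth_subbundle \<A> V"
  obtains W I and t :: "'n::finite \<Rightarrow> 'm::topological_space \<Rightarrow> complex^'n" where
    "open W" "p \<in> W" "\<And>l. l \<in> I \<Longrightarrow> smooth_map_on \<A> W (t l)"
    "\<And>x. x \<in> W \<Longrightarrow> inj_on (\<lambda>l. t l x) I \<and> vec.independent ((\<lambda>l. t l x) ` I) \<and> vec.span ((\<lambda>l. t l x) ` I) = V x"
proof -
  obtain W k and s :: "nat \<Rightarrow> 'm \<Rightarrow> complex^'n" where W: "open W" "p \<in> W"
    "\<And>j. j < k \<Longrightarrow> smooth_map_on \<A> W (s j)"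
    "\<And>x. x \<in> W \<Longrightarrow> inj_on (\<lambda>j. s j x) {..<k} \<and> vec.independent ((\<lambda>j. s j x) ` {..<k}) \<and>
       vec.span ((\<lambda>j. s j x) ` {..<k}) = V x"
    using assms unfolding smooth_subbundle_def by (metis lessThan_iff)
  have "card ((\<lambda>j. s j p) ` {..<k}) \<le> vec.dim (UNIV :: (complex^'n) set)"
    using W(2,4) by (intro vec.independent_card_le_dim) auto
  then have "k \<le> CARD('n)"
    using W(2,4) by (simp add: card_cart_basis card_image)
  then obtain e :: "nat \<Rightarrow> 'n" where e: "inj_on e {..<k}"
    using card_le_inj[of "{..<k}" "UNIV :: 'n set"] by auto
  define t where "t l = s (the_inv_into {..<k} e l)" for l
  have te: "t (e j) = s j" if "j < k" for j
    using that by (simp add: t_def the_inv_into_f_f[OF e])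
  have im: "(\<lambda>l. t l x) ` e ` {..<k} = (\<lambda>j. s j x) ` {..<k}" for x
    by (auto simp: image_image te)
  show ?thesis
  proof (rule that[of W "e ` {..<k}" t])
    show "smooth_map_on \<A> W (t l)" if "l \<in> e ` {..<k}" for l
      using that W(3) te by auto
    show "inj_on (\<lambda>l. t l x) (e ` {..<k}) \<and> vec.independent ((\<lambda>l. t l x) ` e ` {..<k}) \<and>
      vec.span ((\<lambda>l. t l x) ` e ` {..<k}) = V x" if "x \<in> W" for x
      using W(4)[OF that] unfolding im by (auto simp: inj_on_def te)
  qed (use W in auto)
qed

lemma smooth_on_mink:
  assumes S: "open S" and "smooth_on S f" "smooth_on S h"
  shows "smooth_on S (\<lambda>x. mink \<tau> (f x) (h x :: complex^'n))"
  unfolding mink_def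
  using assms by (intro smooth_on_sum smooth_on_mult smooth_on_const S) (simp_all add: smooth_on_vec_iff)

locale nondeg_bundle =
  fixes \<A> :: "'m::{t2_space,second_countable_topology} chart set"
    and \<tau> :: "'n::finite" and V :: "'m \<Rightarrow> (complex^'n) set"
  assumes atlas: "oriented_surface_atlas \<A>"
    and subbundle: "smooth_subbundle \<A> V"
    and nondeg: "nondegenerate \<tau> V"
begin

definition P :: "'m \<Rightarrow> complex^'n^'n" where "P p = proj \<tau> (V p)"

definition \<rho> :: "'m \<Rightarrow> complex^'n^'n" where "\<rho> p = P p + P p - mat 1"

lemma local_proj:
  obtains W I and t :: "'n \<Rightarrow> 'm \<Rightarrow> complex^'n" where
    "open W" "p \<in> W" "\<And>l. l \<in> I \<Longrightarrow> smooth_map_on \<A> W (t l)"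
    "\<And>x. x \<in> W \<Longrightarrow> det (gram_matrix \<tau> I (\<lambda>l. t l x)) \<noteq> 0"
    "\<And>x. x \<in> W \<Longrightarrow> nondeg_proj \<tau> (V x)
       (frame_matrix I (\<lambda>l. t l x) ** matrix_inv (gram_matrix \<tau> I (\<lambda>l. t l x)) ** coframe_matrix \<tau> I (\<lambda>l. t l x))"
proof -
  obtain W I and t :: "'n \<Rightarrow> 'm \<Rightarrow> complex^'n" where W: "open W" "p \<in> W"
    "\<And>l. l \<in> I \<Longrightarrow> smooth_map_on \<A> W (t l)"
    "\<And>x. x \<in> W \<Longrightarrow> inj_on (\<lambda>l. t l x) I \<and> vec.independent ((\<lambda>l. t l x) ` I) \<and> vec.span ((\<lambda>l. t l x) ` I) = V x"
    by (rule subbundle_frame[OF subbundle, of p]) blast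
  have nd: "v = 0" if "v \<in> V x" "\<And>w. w \<in> V x \<Longrightarrow> mink \<tau> v w = 0" for v x
    using nondeg that unfolding nondegenerate_def by blast
  show ?thesis
  proof (rule that[OF W(1-3)])
    fix x assume "x \<in> W"
    then have f: "inj_on (\<lambda>l. t l x) I" "vec.independent ((\<lambda>l. t l x) ` I)" "vec.span ((\<lambda>l. t l x) ` I) = V x"
      using W(4) by blast+
    have nd': "v = 0" if "v \<in> vec.span ((\<lambda>l. t l x) ` I)"
      "\<And>w. w \<in> vec.span ((\<lambda>l. t l x) ` I) \<Longrightarrow> mink \<tau> v w = 0" for v
      by (rule nd) (use that f(3) in simp_all)
    show "det (gram_matrix \<tau> I (\<lambda>l. t l x)) \<noteq> 0"
      by (rule frame_projection(1)[OF f(1,2) nd'])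
    show "nondeg_proj \<tau> (V x) (frame_matrix I (\<lambda>l. t l x) ** matrix_inv (gram_matrix \<tau> I (\<lambda>l. t l x)) ** coframe_matrix \<tau> I (\<lambda>l. t l x))"
      using frame_projection(2)[OF f(1,2) nd'] unfolding f(3) .
  qed
qed

lemma nondeg_proj_P: "nondeg_proj \<tau> (V p) (P p)"
proof (rule local_proj[of p])
  fix W I and t :: "'n \<Rightarrow> 'm \<Rightarrow> complex^'n"
  assume "p \<in> W" and np: "\<And>x. x \<in> W \<Longrightarrow> nondeg_proj \<tau> (V x)
       (frame_matrix I (\<lambda>l. t l x) ** matrix_inv (gram_matrix \<tau> I (\<lambda>l. t l x)) ** coframe_matrix \<tau> I (\<lambda>l. t l x))"
  from np[OF this(1)] show ?thesis
    using np_proj[OF np[OF \<open>p \<in> W\<close>]] by (simp add: P_def)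
qed

lemma chart_smooth_P:
  assumes c: "c \<in> \<A>"
  shows "chart_smooth c P"
  unfolding chart_smooth_def
proof (rule smooth_on_locally)
  interpret surface_chart c by (rule surface_chart_atlas[OF atlas c])
  fix y assume "y \<in> chart_map c ` chart_dom c"
  then obtain p where p: "p \<in> chart_dom c" "y = chart_map c p" by auto
  obtain W I and t :: "'n \<Rightarrow> 'm \<Rightarrow> complex^'n" where W: "open W" "p \<in> W"
    and t: "\<And>l. l \<in> I \<Longrightarrow> smooth_map_on \<A> W (t l)"
    and det: "\<And>x. x \<in> W \<Longrightarrow> det (gram_matrix \<tau> I (\<lambda>l. t l x)) \<noteq> 0"
    and np: "\<And>x. x \<in> W \<Longrightarrow> nondeg_proj \<tau> (V x)
       (frame_matrix I (\<lambda>l. t l x) ** matrix_inv (gram_matrix \<tau> I (\<lambda>l. t l x)) ** coframe_matrix \<tau> I (\<lambda>l. t l x))"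
    by (rule local_proj[of p]) blast
  let ?T = "chart_map c ` (chart_dom c \<inter> W)"
  have T: "open ?T" by (rule open_chart_image[OF W(1)])
  let ?t = "\<lambda>l x. t l (chart_inv c x)"
  have sm: "smooth_on ?T (?t l)" if "l \<in> I" for l
    using t[OF that] c by (auto simp: smooth_map_on_def o_def)
  have sm_entry: "smooth_on ?T (\<lambda>x. ?t l x $ i)" if "l \<in> I" for l i
    using sm[OF that] by (simp add: smooth_on_vec_iff[OF T])
  have X: "smooth_on ?T (\<lambda>x. frame_matrix I (\<lambda>l. ?t l x))"
    unfolding smooth_on_matrix_iff[OF T] frame_matrix_def
    by (auto simp: sm_entry smooth_on_const[OF T] intro!: smooth_on_if)
  have K: "smooth_on ?T (\<lambda>x. gram_matrix \<tau> I (\<lambda>l. ?t l x))"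
    unfolding smooth_on_matrix_iff[OF T] gram_matrix_def
    by (auto simp: sm smooth_on_const[OF T] smooth_on_mink[OF T] intro!: smooth_on_if)
  have B: "smooth_on ?T (\<lambda>x. coframe_matrix \<tau> I (\<lambda>l. ?t l x))"
    unfolding smooth_on_matrix_iff[OF T] coframe_matrix_def
    by (auto simp: sm smooth_on_const[OF T] smooth_on_mink[OF T] intro!: smooth_on_if)
  have "smooth_on ?T (\<lambda>x. frame_matrix I (\<lambda>l. ?t l x) ** matrix_inv (gram_matrix \<tau> I (\<lambda>l. ?t l x))
      ** coframe_matrix \<tau> I (\<lambda>l. ?t l x))"
    by (intro smooth_on_bilinear[OF T bounded_bilinear_matrix_mult] smooth_on_matrix_inv X K B T det) auto
  then have "smooth_on ?T (P \<circ> chart_inv c)"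
    by (rule smooth_on_cong[OF T, rotated]) (auto simp: P_def np_proj[OF np])
  then show "\<exists>T. open T \<and> y \<in> T \<and> smooth_on T (P \<circ> chart_inv c)"
    using T p W(2) by blast
qed

lemma P_idem: "P p ** P p = P p"
  by (rule np_idem[OF nondeg_proj_P])

lemma proj_perp: "proj \<tau> (perp \<tau> (V p)) = mat 1 - P p"
  by (rule np_proj_perp[OF nondeg_proj_P])

lemma reflection_eq: "reflection \<tau> V p = \<rho> p"
  by (simp add: reflection_def proj_perp \<rho>_def P_def)

lemma \<rho>_square: "\<rho> p ** \<rho> p = mat 1"
  by (simp only: \<rho>_def matrix_ring P_idem matrix_mul_lid matrix_mul_rid) simp

lemma chart_smooth_\<rho>: "c \<in> \<A> \<Longrightarrow> chart_smooth c \<rho>"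
  using surface_chart.chart_smooth_add[OF surface_chart_atlas[OF atlas]]
    surface_chart.chart_smooth_diff[OF surface_chart_atlas[OF atlas]]
    surface_chart.chart_smooth_const[OF surface_chart_atlas[OF atlas]] chart_smooth_P
  unfolding \<rho>_def[abs_def] by blast

end

section \<open>Matrix-valued one-forms in a chart\<close>

text \<open>The transformation law between charts is left out on purpose: exterior derivatives and
  curvature are computed inside one chart.\<close>

definition chart_form :: "'m chart \<Rightarrow> ('m, 'b::real_normed_vector) form1 \<Rightarrow> bool" where
  "chart_form c \<omega> \<longleftrightarrow> (\<forall>p\<in>chart_dom c. linear (\<omega> c p)) \<and> (\<forall>u. chart_smooth c (\<lambda>p. \<omega> c p u))"

lemma chart_form_smooth_form1: "smooth_form1 \<A> \<omega> \<Longrightarrow> c \<in> \<A> \<Longrightarrow> chart_form c \<omega>"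
  by (simp add: smooth_form1_def chart_form_def chart_smooth_def o_def)

lemma commutator_add_left: "commutator (A + B) C = commutator A C + commutator B C"
  and commutator_add_right: "commutator C (A + B) = commutator C A + commutator C B"
  and commutator_cscale_left: "commutator (cscale z A) C = cscale z (commutator A C)"
  and commutator_cscale_right: "commutator C (cscale z A) = cscale z (commutator C A)"
  and commutator_minus_left: "commutator (- A) C = - commutator A C"
  and commutator_minus_right: "commutator C (- A) = - commutator C A"
  and commutator_swap: "commutator A B = - commutator B A"
  by (simp_all add: commutator_def matrix_ring algebra_simps)

lemma commutator_zero: "commutator 0 A = 0" "commutator A 0 = 0"
  by (simp_all add: commutator_def matrix_ring)

lemma bracket_wedge_sym: "bracket_wedge \<mu> \<eta> c p u v = bracket_wedge \<eta> \<mu> c p u v"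
  unfolding bracket_wedge_def
  by (subst (1 2) commutator_swap) simp

definition dext :: "('m, complex^'n^'n) form1 \<Rightarrow> ('m, complex^'n^'n) form2" where
  "dext \<omega> c p u v = extd (\<lambda>x. \<omega> c x v) c p u - extd (\<lambda>x. \<omega> c x u) c p v"

text \<open>Curvature of the connection \<open>d + \<omega>\<close> on the trivial bundle; the
  commutator is half of \<open>bracket_wedge \<omega> \<omega>\<close>.\<close>

definition curv :: "('m, complex^'n^'n) form1 \<Rightarrow> ('m, complex^'n^'n) form2" where
  "curv \<omega> c p u v = dext \<omega> c p u v + commutator (\<omega> c p u) (\<omega> c p v)"

context surface_chart
begin

lemma chart_form_cong:
  assumes "\<And>p u. p \<in> chart_dom c \<Longrightarrow> \<omega> c p u = \<eta> c p u" "chart_form c \<omega>"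
  shows "chart_form c \<eta>"
  using assms(2) unfolding chart_form_def
proof (elim conjE, intro conjI ballI allI)
  fix p assume p: "p \<in> chart_dom c" and "\<forall>p\<in>chart_dom c. linear (\<omega> c p)"
  moreover have "\<omega> c p = \<eta> c p" using assms(1)[OF p] by blast
  ultimately show "linear (\<eta> c p)" by auto
next
  show "chart_smooth c (\<lambda>p. \<eta> c p u)" for u
    by (rule chart_smooth_cong[where f = "\<lambda>p. \<omega> c p u"]) (use assms in \<open>auto simp: chart_form_def\<close>)
qed

lemma chart_form_add:
  "chart_form c \<omega> \<Longrightarrow> chart_form c \<eta> \<Longrightarrow> chart_form c (\<lambda>c p u. \<omega> c p u + \<eta> c p u)"
  by (auto simp: chart_form_def intro: linear_compose_add chart_smooth_add)

lemma chart_form_minus: "chart_form c \<omega> \<Longrightarrow> chart_form c (\<lambda>c p u. - \<omega> c p u)"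
  by (auto simp: chart_form_def intro: linear_compose_neg chart_smooth_minus)

lemma chart_form_cscale: "chart_form c \<omega> \<Longrightarrow> chart_form c (\<lambda>c p u. cscale z (\<omega> c p u))"
  unfolding chart_form_def
  using linear_compose[OF _ bounded_linear.linear[OF bounded_linear_cscale], unfolded o_def]
  by (auto intro: chart_smooth_cscale)

lemma chart_form_matrix_mult:
  fixes \<omega> :: "('m, complex^'n^'n) form1"
  assumes "chart_form c \<omega>" "chart_smooth c A" "chart_smooth c B"
  shows "chart_form c (\<lambda>c p u. A p ** \<omega> c p u ** B p)"
proof -
  have "linear (\<lambda>X. A p ** X ** B p)" for p
    by (rule linearI) (simp_all add: matrix_ring scaleR_cscale)
  then have "linear (\<lambda>u. A p ** \<omega> c p u ** B p)" if "p \<in> chart_dom c" for p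
    using assms(1) that linear_compose[of "\<omega> c p" "\<lambda>X. A p ** X ** B p"] by (simp add: chart_form_def o_def)
  then show ?thesis
    using assms by (auto simp: chart_form_def intro!: chart_smooth_matrix_mult)
qed

lemma chart_form_extd: "chart_smooth c f \<Longrightarrow> chart_form c (extd f)"
  by (auto simp: chart_form_def linear_extd chart_smooth_extd)

lemma chart_formD:
  assumes "chart_form c \<omega>"
  shows "p \<in> chart_dom c \<Longrightarrow> linear (\<omega> c p)" "chart_smooth c (\<lambda>p. \<omega> c p u)"
  using assms by (auto simp: chart_form_def)

lemma dext_add:
  "chart_form c \<omega> \<Longrightarrow> chart_form c \<eta> \<Longrightarrow> p \<in> chart_dom c \<Longrightarrow>
    dext (\<lambda>c p u. \<omega> c p u + \<eta> c p u) c p u v = dext \<omega> c p u v + dext \<eta> c p u v"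
  by (simp add: dext_def extd_add chart_formD)

lemma dext_minus:
  "chart_form c \<omega> \<Longrightarrow> p \<in> chart_dom c \<Longrightarrow> dext (\<lambda>c p u. - \<omega> c p u) c p u v = - dext \<omega> c p u v"
  by (simp add: dext_def extd_minus chart_formD)

lemma dext_cscale:
  "chart_form c \<omega> \<Longrightarrow> p \<in> chart_dom c \<Longrightarrow>
    dext (\<lambda>c p u. cscale z (\<omega> c p u)) c p u v = cscale z (dext \<omega> c p u v)"
  by (simp add: dext_def extd_cscale chart_formD cscale_diff)

lemma dext_cong:
  assumes "\<And>p u. p \<in> chart_dom c \<Longrightarrow> \<omega> c p u = \<eta> c p u" "chart_form c \<omega>" "p \<in> chart_dom c"
  shows "dext \<eta> c p u v = dext \<omega> c p u v"
proof -
  have "extd (\<lambda>x. \<eta> c x w) c p w' = extd (\<lambda>x. \<omega> c x w) c p w'" for w w'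
    by (rule extd_cong) (use assms in \<open>auto simp: chart_formD\<close>)
  then show ?thesis by (simp add: dext_def)
qed

lemma curv_cong:
  assumes "\<And>p u. p \<in> chart_dom c \<Longrightarrow> \<omega> c p u = \<eta> c p u" "chart_form c \<omega>" "p \<in> chart_dom c"
  shows "curv \<eta> c p u v = curv \<omega> c p u v"
  using dext_cong[of \<omega> \<eta>, OF assms] assms(1,3) by (simp add: curv_def)

text \<open>The transformed form is that of \<open>G (d + \<omega>) H\<close>. Second derivatives of
  \<open>H\<close> cancel by symmetry, and substituting \<open>dG = - G dH G\<close> cancels all
  terms with first derivatives of \<open>H\<close>.\<close>

lemma curv_gauge:
  fixes \<omega> :: "('m, complex^'n^'n) form1" and G H :: "'m \<Rightarrow> complex^'n^'n"
  assumes \<omega>: "chart_form c \<omega>" and G: "chart_smooth c G" and H: "chart_smooth c H"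
    and GH: "\<And>p. p \<in> chart_dom c \<Longrightarrow> G p ** H p = mat 1" and p: "p \<in> chart_dom c"
  shows "curv (\<lambda>c p u. G p ** \<omega> c p u ** H p + G p ** extd H c p u) c p u v = G p ** curv \<omega> c p u v ** H p"
proof -
  let ?\<beta> = "\<lambda>c p u. G p ** \<omega> c p u ** H p + G p ** extd H c p u"
  have dGH: "extd G c p u ** H p = - (G p ** extd H c p u)" for u
  proof -
    have "extd (\<lambda>x. G x ** H x) c p u = extd (\<lambda>_. mat 1 :: complex^'n^'n) c p u"
      by (rule extd_cong[OF _ chart_smooth_const p]) (simp add: GH)
    then show ?thesis
      by (simp add: extd_matrix_mult[OF G H p] extd_const eq_neg_iff_add_eq_0)
  qed
  have HG: "H p ** G p = mat 1" using GH[OF p] by (simp add: matrix_left_right_inverse)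
  have dG: "extd G c p u = - (G p ** extd H c p u ** G p)" for u
  proof -
    have "extd G c p u = extd G c p u ** H p ** G p" by (simp add: matrix_mul_assoc[symmetric] HG)
    then show ?thesis by (simp add: dGH matrix_mult_minus_left)
  qed
  have HGl: "H p ** (G p ** X) = X" for X :: "complex^'n^'n"
    by (simp add: matrix_mul_assoc HG)
  have 1: "extd (\<lambda>x. ?\<beta> c x v) c p u =
      extd G c p u ** \<omega> c p v ** H p + G p ** extd (\<lambda>x. \<omega> c x v) c p u ** H p + G p ** \<omega> c p v ** extd H c p u
      + extd G c p u ** extd H c p v + G p ** extd (\<lambda>x. extd H c x v) c p u" for u v
    using p \<omega> G H
    by (simp add: extd_add extd_matrix_mult chart_smooth_matrix_mult chart_smooth_extd chart_formD matrix_ring)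
  have 2: "extd (\<lambda>x. extd H c x v) c p u = extd (\<lambda>x. extd H c x u) c p v"
    by (rule extd_commute[OF H p])
  show ?thesis
    unfolding curv_def dext_def 1 2 dG commutator_def
    by (simp add: matrix_ring HGl)
qed

end

section \<open>The complex structure\<close>

locale surface_metric =
  fixes \<A> :: "'m::{t2_space,second_countable_topology} chart set" and g :: "('m, real) form2"
  assumes atlas: "oriented_surface_atlas \<A>" and metric: "riemannian_metric \<A> g"
begin

lemma metricD:
  assumes "c \<in> \<A>" "p \<in> chart_dom c"
  shows "bilinear (g c p)" "g c p u v = g c p v u" "u \<noteq> 0 \<Longrightarrow> g c p u u > 0"
  using metric assms unfolding riemannian_metric_def by blast+

context
  fixes c assumes c: "c \<in> \<A>"
begin

interpretation surface_chart c by (rule surface_chart_atlas[OF atlas c])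

lemma rotJ_rotJ: "p \<in> chart_dom c \<Longrightarrow> rotJ g c p (rotJ g c p u) = - u"
  by (rule rotJ_characterisation(4)) (use metricD[OF c] in auto)

lemma rotJ_pos: "p \<in> chart_dom c \<Longrightarrow> u \<noteq> 0 \<Longrightarrow> u$1 * rotJ g c p u $ 2 - u$2 * rotJ g c p u $ 1 > 0"
  by (rule rotJ_characterisation(3)) (use metricD[OF c] in auto)

lemma linear_rotJ:
  assumes p: "p \<in> chart_dom c" shows "linear (rotJ g c p)"
  using metricD(1)[OF c p] unfolding rotJ_def Let_def
  by (intro linearI) (simp_all add: bilinear_ladd bilinear_lmul algebra_simps)

lemma chart_smooth_metric: "chart_smooth c (\<lambda>p. g c p u v)"
  using metric c unfolding riemannian_metric_def chart_smooth_def o_def by blast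

lemma chart_smooth_rotJ: "chart_smooth c (\<lambda>p. rotJ g c p u)"
proof -
  let ?d = "\<lambda>p. g c p (axis 1 1) (axis 1 1) * g c p (axis 2 1) (axis 2 1) - (g c p (axis 1 1) (axis 2 1))\<^sup>2"
  have d: "chart_smooth c ?d"
    unfolding power2_eq_square
    by (intro chart_smooth_diff chart_smooth_bilinear[OF bounded_bilinear_mult] chart_smooth_metric)
  have pos: "?d p > 0" if "p \<in> chart_dom c" for p
    by (rule metric_det_pos) (use metricD[OF c that] in auto)
  have "smooth_on (chart_map c ` chart_dom c) (\<lambda>x. 1 / sqrt ((?d \<circ> chart_inv c) x))"
    by (rule smooth_on_inverse_sqrt[OF open_img d[unfolded chart_smooth_def]]) (use pos in auto)
  then have "chart_smooth c (\<lambda>p. 1 / sqrt (?d p))"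
    by (simp add: chart_smooth_def o_def)
  then show ?thesis
    unfolding rotJ_def Let_def
    by (intro chart_smooth_bilinear[OF bounded_bilinear_scaleR] chart_smooth_diff chart_smooth_metric chart_smooth_const)
qed

lemma chart_form_rotJ:
  assumes \<omega>: "chart_form c \<omega>"
  shows "chart_form c (\<lambda>c p u. \<omega> c p (rotJ g c p u))"
  unfolding chart_form_def
proof (intro conjI ballI allI)
  show "linear (\<lambda>u. \<omega> c p (rotJ g c p u))" if "p \<in> chart_dom c" for p
    using linear_compose[OF linear_rotJ[OF that] chart_formD(1)[OF \<omega> that]] by (simp add: o_def)
  fix u
  have "chart_smooth c (\<lambda>p. rotJ g c p u $ 1 *\<^sub>R \<omega> c p (axis 1 1) + rotJ g c p u $ 2 *\<^sub>R \<omega> c p (axis 2 1))"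
    by (intro chart_smooth_add chart_smooth_bilinear[OF bounded_bilinear_scaleR] chart_formD[OF \<omega>]
        chart_smooth_linear[OF bounded_linear_vec_nth] chart_smooth_rotJ)
  moreover have "rotJ g c p u $ 1 *\<^sub>R \<omega> c p (axis 1 1) + rotJ g c p u $ 2 *\<^sub>R \<omega> c p (axis 2 1) = \<omega> c p (rotJ g c p u)"
    if "p \<in> chart_dom c" for p
  proof -
    have "\<omega> c p (rotJ g c p u) = \<omega> c p (rotJ g c p u $ 1 *\<^sub>R axis 1 1 + rotJ g c p u $ 2 *\<^sub>R axis 2 1)"
      by (metis axis2_expand)
    then show ?thesis
      using chart_formD(1)[OF \<omega> that] by (simp add: linear_add linear_cmul)
  qed
  ultimately show "chart_smooth c (\<lambda>p. \<omega> c p (rotJ g c p u))"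
    by (rule chart_smooth_cong[rotated])
qed

lemma chart_form_part10: "chart_form c \<omega> \<Longrightarrow> chart_form c (part10 g \<omega>)"
  using chart_form_cscale[OF chart_form_add[OF _ chart_form_minus[OF chart_form_cscale[OF chart_form_rotJ]]], of \<omega> \<omega> "1/2" \<i>]
  by (simp add: part10_def[abs_def])

lemma chart_form_part01: "chart_form c \<omega> \<Longrightarrow> chart_form c (part01 g \<omega>)"
  using chart_form_cscale[OF chart_form_add[OF _ chart_form_cscale[OF chart_form_rotJ]], of \<omega> \<omega> "1/2" \<i>]
  by (simp add: part01_def[abs_def])

lemma chart_form_star: "chart_form c \<omega> \<Longrightarrow> chart_form c (star g \<omega>)"
  using chart_form_minus[OF chart_form_rotJ] by (simp add: star_def[abs_def])

definition type10 :: "('m, complex^'n^'n) form1 \<Rightarrow> bool" where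
  "type10 \<omega> \<longleftrightarrow> (\<forall>p\<in>chart_dom c. \<forall>u. \<omega> c p (rotJ g c p u) = cscale \<i> (\<omega> c p u))"

definition type01 :: "('m, complex^'n^'n) form1 \<Rightarrow> bool" where
  "type01 \<omega> \<longleftrightarrow> (\<forall>p\<in>chart_dom c. \<forall>u. \<omega> c p (rotJ g c p u) = cscale (- \<i>) (\<omega> c p u))"

lemma type10_part10: "chart_form c \<omega> \<Longrightarrow> type10 (part10 g \<omega>)"
  unfolding type10_def part10_def
  by (auto simp: rotJ_rotJ linear_neg[OF chart_formD(1)] vec_eq_iff cscale_nth complex_eq_iff algebra_simps)

lemma type01_part01: "chart_form c \<omega> \<Longrightarrow> type01 (part01 g \<omega>)"
  unfolding type01_def part01_def
  by (auto simp: rotJ_rotJ linear_neg[OF chart_formD(1)] vec_eq_iff cscale_nth complex_eq_iff algebra_simps)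

lemma part10_eqI:
  assumes "\<omega> c p u = \<mu> + \<eta>" "\<omega> c p (rotJ g c p u) = cscale \<i> \<mu> + cscale (- \<i>) \<eta>"
  shows "part10 g \<omega> c p u = \<mu>" "part01 g \<omega> c p u = \<eta>"
  by (simp_all add: part10_def part01_def assms vec_eq_iff cscale_nth complex_eq_iff)

lemma rotJ_basis:
  assumes p: "p \<in> chart_dom c" and u: "u \<noteq> 0"
  obtains s t where "v = s *\<^sub>R u + t *\<^sub>R rotJ g c p u"
proof -
  define w where "w = rotJ g c p u"
  define d where "d = u$1 * w$2 - u$2 * w$1"
  have d: "d > 0" using rotJ_pos[OF p u] by (simp add: d_def w_def)
  \<comment> \<open>Cramer's rule in the basis \<open>u\<close>, \<open>w = J u\<close>, whose
    determinant is \<open>d\<close>.\<close>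
  have "v = ((v$1 * w$2 - v$2 * w$1) / d) *\<^sub>R u + ((u$1 * v$2 - u$2 * v$1) / d) *\<^sub>R w"
    using d by (simp add: vec_eq_iff forall_2 field_simps) (simp add: d_def algebra_simps)
  then show ?thesis unfolding w_def by (rule that)
qed

text \<open>In real dimension two there are no forms of type (2,0) or (0,2): with \<open>v\<close>
  written in the basis \<open>u\<close>, \<open>J u\<close>, every term is a multiple of the
  commutator of \<open>\<mu>\<close> and \<open>\<eta>\<close> at \<open>u\<close>, and the terms
  cancel. It is applied with \<open>k\<close> equal to \<open>\<i>\<close> or
  \<open>- \<i>\<close>.\<close>

lemma bracket_wedge_same_type:
  assumes p: "p \<in> chart_dom c" and lin: "linear (\<mu> c p)" "linear (\<eta> c p)"
    and J: "\<And>u. \<mu> c p (rotJ g c p u) = cscale k (\<mu> c p u)" "\<And>u. \<eta> c p (rotJ g c p u) = cscale k (\<eta> c p u)"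
  shows "bracket_wedge \<mu> \<eta> c p u v = 0"
proof (cases "u = 0")
  case True
  then show ?thesis
    by (simp add: bracket_wedge_def linear_0[OF lin(1)] linear_0[OF lin(2)] commutator_zero)
next
  case False
  then obtain s t where "v = s *\<^sub>R u + t *\<^sub>R rotJ g c p u" using rotJ_basis[OF p] by blast
  then show ?thesis
    by (simp add: bracket_wedge_def linear_add[OF lin(1)] linear_add[OF lin(2)] linear_cmul[OF lin(1)]
        linear_cmul[OF lin(2)] J scaleR_cscale commutator_add_left commutator_add_right
        commutator_cscale_left commutator_cscale_right)
qed

lemma commutator_same_type:
  assumes "p \<in> chart_dom c" "linear (\<mu> c p)" "\<And>u. \<mu> c p (rotJ g c p u) = cscale k (\<mu> c p u)"
  shows "commutator (\<mu> c p u) (\<mu> c p v) = 0"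
proof -
  have "2 *\<^sub>R commutator (\<mu> c p u) (\<mu> c p v) = bracket_wedge \<mu> \<mu> c p u v"
    unfolding bracket_wedge_def by (subst (3) commutator_swap) (simp add: scaleR_2)
  moreover have "bracket_wedge \<mu> \<mu> c p u v = 0"
    by (rule bracket_wedge_same_type[where k = k]) (use assms in auto)
  ultimately show ?thesis by simp
qed

end

end

section \<open>Curvature of the associated family\<close>

lemma matrix_vec_minus: "(- A) *v x = - (A *v (x :: 'a::ring_1^'n))"
  by (simp add: vec_eq_iff matrix_vector_mult_def sum_negf)

locale bundle_form = nondeg_bundle \<A> \<tau> V + surface_metric \<A> g
  for \<A> :: "'m::{t2_space,second_countable_topology} chart set" and \<tau> :: "'n::finite" and V g +
  fixes q :: "('m, complex^'n^'n) form1"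
  assumes split: "split_form1 \<A> \<tau> V q"
begin

text \<open>The connection form of \<open>connD\<close>: \<open>D = d + a\<close> and
  \<open>N = - a\<close>. Since \<open>\<rho> d \<rho> = d + 2 a\<close>, \<open>D\<close> is the
  mean of \<open>d\<close> and its conjugate by the reflection.\<close>

definition a :: "('m, complex^'n^'n) form1" where
  "a c p u = \<rho> p ** extd P c p u"

abbreviation N10 :: "('m, complex^'n^'n) form1" where "N10 \<equiv> part10 g (formN \<tau> V)"
abbreviation N01 :: "('m, complex^'n^'n) form1" where "N01 \<equiv> part01 g (formN \<tau> V)"
abbreviation q10 :: "('m, complex^'n^'n) form1" where "q10 \<equiv> part10 g q"
abbreviation q01 :: "('m, complex^'n^'n) form1" where "q01 \<equiv> part01 g q"

text \<open>The connection form of \<open>d_lambda\<close>, see \<open>d_lambda_eq\<close>.\<close>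

definition alpha :: "complex \<Rightarrow> ('m, complex^'n^'n) form1" where
  "alpha z c p u = a c p u + cscale (inverse z) (N10 c p u) + cscale z (N01 c p u)
     + cscale (inverse (z\<^sup>2) - 1) (q10 c p u) + cscale (z\<^sup>2 - 1) (q01 c p u)"

context
  fixes c assumes c: "c \<in> \<A>"
begin

interpretation surface_chart c by (rule surface_chart_atlas[OF atlas c])

lemmas smooth_P = chart_smooth_P[OF c] and smooth_\<rho> = chart_smooth_\<rho>[OF c]

lemma q_form: "chart_form c q"
  using split c by (auto simp: split_form1_def intro: chart_form_smooth_form1)

lemma extd_P: "p \<in> chart_dom c \<Longrightarrow> extd P c p u = extd P c p u ** P p + P p ** extd P c p u"
  using extd_matrix_mult[OF smooth_P smooth_P, of p u] by (simp add: P_idem)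

lemma extd_\<rho>: "p \<in> chart_dom c \<Longrightarrow> extd \<rho> c p u = extd P c p u + extd P c p u"
  unfolding \<rho>_def[abs_def]
  by (simp only: extd_diff[OF chart_smooth_add[OF smooth_P smooth_P] chart_smooth_const]
      extd_add[OF smooth_P smooth_P] extd_const diff_zero)

text \<open>Differentiating \<open>P P = P\<close> shows that \<open>dP\<close> exchanges the bundle
  and its complement, so it anticommutes with the reflection.\<close>

lemma \<rho>_extd_P:
  assumes p: "p \<in> chart_dom c"
  shows "\<rho> p ** extd P c p u = - (extd P c p u ** \<rho> p)"
proof -
  let ?X = "extd P c p u"
  have "\<rho> p ** ?X + ?X ** \<rho> p = ((?X ** P p + P p ** ?X) - ?X) + ((?X ** P p + P p ** ?X) - ?X)"
    by (simp only: \<rho>_def matrix_ring matrix_mul_lid matrix_mul_rid) simp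
  also have "\<dots> = 0" using extd_P[OF p] by simp
  finally show ?thesis by (simp add: eq_neg_iff_add_eq_0)
qed

lemma \<rho>_extd_P': "p \<in> chart_dom c \<Longrightarrow> \<rho> p ** (extd P c p u ** X) = - (extd P c p u ** (\<rho> p ** X))"
  using \<rho>_extd_P[of p u] by (simp add: matrix_mul_assoc matrix_mult_minus_left)

lemma \<rho>_square': "\<rho> p ** (\<rho> p ** X) = X"
  by (simp add: matrix_mul_assoc \<rho>_square)

lemma a_form: "chart_form c a"
  using chart_form_matrix_mult[OF chart_form_extd[OF smooth_P] smooth_\<rho> chart_smooth_const[of "mat 1"]]
  by (simp add: a_def[abs_def])

lemma \<rho>_a_\<rho>: "p \<in> chart_dom c \<Longrightarrow> \<rho> p ** a c p u ** \<rho> p = - a c p u"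
  by (simp add: a_def matrix_ring \<rho>_square \<rho>_square' \<rho>_extd_P)

lemma \<rho>_extd_\<rho>: "p \<in> chart_dom c \<Longrightarrow> \<rho> p ** extd \<rho> c p u = a c p u + a c p u"
  by (simp only: extd_\<rho> a_def matrix_ring)

text \<open>The Gauss and Codazzi equations at once: this is flatness of
  \<open>d + 2 a = \<rho> d \<rho>\<close>.\<close>

lemma dext_a:
  assumes p: "p \<in> chart_dom c"
  shows "dext a c p u v = - bracket_wedge a a c p u v"
proof -
  have 1: "extd (\<lambda>x. a c x v) c p u
      = (extd P c p u ** extd P c p v + extd P c p u ** extd P c p v) + \<rho> p ** extd (\<lambda>x. extd P c x v) c p u" for u v
    unfolding a_def
    by (subst extd_matrix_mult[OF smooth_\<rho> chart_smooth_extd[OF smooth_P] p]) (simp only: extd_\<rho>[OF p] matrix_ring)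
  have 2: "extd (\<lambda>x. extd P c x v) c p u = extd (\<lambda>x. extd P c x u) c p v"
    by (rule extd_commute[OF smooth_P p])
  have 3: "a c p u ** a c p v = - (extd P c p u ** extd P c p v)" for u v
    by (simp add: a_def matrix_ring \<rho>_square' \<rho>_extd_P'[OF p])
  show ?thesis
    unfolding dext_def 1 2 bracket_wedge_def commutator_def 3 by simp
qed

lemma connD_eq:
  assumes s: "chart_smooth c s" and p: "p \<in> chart_dom c"
  shows "connD \<tau> V s c p u = extd s c p u + a c p u *v s p"
proof -
  let ?X = "extd P c p u" and ?w = "extd s c p u"
  have 1: "extd (\<lambda>x. P x *v s x) c p u = ?X *v s p + P p *v ?w"
    by (rule extd_matrix_vec[OF smooth_P s p])
  have 2: "extd (\<lambda>x. (mat 1 - P x) *v s x) c p u = - (?X *v s p) + (mat 1 - P p) *v ?w"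
    by (subst extd_matrix_vec[OF chart_smooth_diff[OF chart_smooth_const smooth_P] s p])
      (simp add: extd_diff[OF chart_smooth_const smooth_P p] extd_const matrix_vec_minus)
  have "connD \<tau> V s c p u = P p *v (?X *v s p + P p *v ?w) + (mat 1 - P p) *v (- (?X *v s p) + (mat 1 - P p) *v ?w)"
    unfolding connD_def P_def[symmetric] proj_perp 1 2 ..
  also have "\<dots> = (P p ** P p) *v ?w + ((mat 1 - P p) ** (mat 1 - P p)) *v ?w
      + (P p ** ?X) *v s p - ((mat 1 - P p) ** ?X) *v s p"
    by (simp only: matrix_vector_right_distrib matrix_vector_mul_assoc vec.neg) simp
  also have "\<dots> = ?w + (P p ** ?X + P p ** ?X - ?X) *v s p"
    by (simp only: matrix_ring P_idem matrix_mul_lid matrix_mul_rid matrix_vector_mult_diff_rdistrib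
        matrix_vector_mult_add_rdistrib matrix_vector_mul_lid) simp
  also have "P p ** ?X + P p ** ?X - ?X = a c p u"
    by (simp only: a_def \<rho>_def matrix_ring matrix_mul_lid)
  finally show ?thesis .
qed

lemma formN_eq: "p \<in> chart_dom c \<Longrightarrow> formN \<tau> V c p u = - a c p u"
  unfolding formN_def
  by (simp add: connD_eq chart_smooth_const extd_const matrix_vec_minus[symmetric])

lemma formN_form: "chart_form c (formN \<tau> V)"
  by (rule chart_form_cong[OF _ chart_form_minus[OF a_form]]) (simp add: formN_eq)

lemmas parts_form = chart_form_part10[OF c formN_form] chart_form_part01[OF c formN_form]
  chart_form_part10[OF c q_form] chart_form_part01[OF c q_form]

lemma part_sum: "part10 g \<omega> c p u + part01 g \<omega> c p u = \<omega> c p u"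
  by (simp add: part10_def part01_def vec_eq_iff cscale_nth algebra_simps)

lemma a_eq: "p \<in> chart_dom c \<Longrightarrow> a c p u = - (N10 c p u + N01 c p u)"
  by (simp add: part_sum formN_eq)

lemma dnabla_eq:
  assumes \<omega>: "chart_form c \<omega>" and p: "p \<in> chart_dom c"
  shows "dnabla (connD \<tau> V) \<omega> c p u v = dext \<omega> c p u v + bracket_wedge a \<omega> c p u v"
proof -
  have 1: "connD \<tau> V (\<lambda>x. \<omega> c x v *v w) c p u - \<omega> c p v *v connD \<tau> V (\<lambda>_. w) c p u
      = (extd (\<lambda>x. \<omega> c x v) c p u + commutator (a c p u) (\<omega> c p v)) *v w" for u v w
    by (simp add: connD_eq p chart_smooth_matrix_vec chart_formD[OF \<omega>] chart_smooth_const extd_matrix_vec extd_const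
        commutator_def matrix_vector_mul_assoc algebra_simps)
  show ?thesis
    unfolding dnabla_def 1
    by (simp add: matrix_vector_mult_diff_rdistrib[symmetric] dext_def bracket_wedge_def)
qed

lemma alpha_form: "chart_form c (alpha z)"
  unfolding alpha_def[abs_def]
  by (intro chart_form_add chart_form_cscale a_form parts_form)

text \<open>Replacing \<open>a\<close> by \<open>- N\<close> makes it visible that the form vanishes
  at \<open>z = 1\<close>, where the family passes through \<open>d\<close>.\<close>

lemma alpha_eq:
  "p \<in> chart_dom c \<Longrightarrow> alpha z c p u = cscale (inverse z - 1) (N10 c p u) + cscale (z - 1) (N01 c p u)
     + cscale (inverse (z\<^sup>2) - 1) (q10 c p u) + cscale (z\<^sup>2 - 1) (q01 c p u)"
  by (simp add: alpha_def a_eq vec_eq_iff cscale_nth algebra_simps)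

lemma d_lambda_eq:
  "chart_smooth c s \<Longrightarrow> p \<in> chart_dom c \<Longrightarrow>
    d_lambda g \<tau> V q z s c p u = extd s c p u + alpha z c p u *v s p"
  by (simp add: d_lambda_def connD_eq alpha_def cscale_mult_vec algebra_simps)

lemma part10_J:
  "chart_form c \<omega> \<Longrightarrow> p \<in> chart_dom c \<Longrightarrow> part10 g \<omega> c p (rotJ g c p u) = cscale \<i> (part10 g \<omega> c p u)"
  using type10_part10[OF c] by (auto simp: type10_def[OF c])

lemma part01_J:
  "chart_form c \<omega> \<Longrightarrow> p \<in> chart_dom c \<Longrightarrow> part01 g \<omega> c p (rotJ g c p u) = cscale (- \<i>) (part01 g \<omega> c p u)"
  using type01_part01[OF c] by (auto simp: type01_def[OF c])

lemmas J_parts = part10_J[OF formN_form] part10_J[OF q_form] part01_J[OF formN_form] part01_J[OF q_form]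

section \<open>Brackets, curvature and the defects of the three equations at a point\<close>

context
  fixes p and u v :: "real^2"
  assumes p: "p \<in> chart_dom c"
begin

text \<open>Brackets of equal type vanish, so only these four survive in the curvature.\<close>

abbreviation "NN \<equiv> bracket_wedge N10 N01 c p u v"
abbreviation "Nq \<equiv> bracket_wedge N10 q01 c p u v"
abbreviation "qN \<equiv> bracket_wedge q10 N01 c p u v"
abbreviation "qq \<equiv> bracket_wedge q10 q01 c p u v"

text \<open>\<open>defY\<close> and \<open>defZ\<close> are the differences of the two sides of the
  equations for \<open>q10\<close> and \<open>q01\<close>; \<open>defX\<close> is that of the
  equation for \<open>star\<close> of \<open>N\<close>, up to the factor
  \<open>- 2 * \<i>\<close>.\<close>

definition defX :: "complex^'n^'n" where "defX = dext N10 c p u v - NN - Nq + qN"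
definition defY :: "complex^'n^'n" where "defY = dext q10 c p u v - qN - qq"
definition defZ :: "complex^'n^'n" where "defZ = dext q01 c p u v - Nq - qq"

lemma linear_parts: "linear (N10 c p)" "linear (N01 c p)" "linear (q10 c p)" "linear (q01 c p)"
  using parts_form[THEN chart_formD(1)] p by blast+

lemma zero_brackets:
  "commutator (N10 c p u) (N10 c p v) = 0" "commutator (N01 c p u) (N01 c p v) = 0"
  "commutator (q10 c p u) (q10 c p v) = 0" "commutator (q01 c p u) (q01 c p v) = 0"
  "bracket_wedge N10 q10 c p u v = 0" "bracket_wedge N01 q01 c p u v = 0"
  by (rule commutator_same_type[OF c p] bracket_wedge_same_type[OF c p], (rule linear_parts J_parts p)+)+

text \<open>Treats the quadratic terms of \<open>a\<close>, \<open>q\<close> and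
  \<open>alpha\<close> together. The products \<open>k1 * k3\<close> and \<open>k2 * k4\<close> and
  all squares are absent because they belong to brackets of equal type.\<close>

lemma commutator_combination:
  assumes "\<And>w. \<omega> w = cscale k1 (N10 c p w) + cscale k2 (N01 c p w) + cscale k3 (q10 c p w) + cscale k4 (q01 c p w)"
  shows "commutator (\<omega> u) (\<omega> v) = cscale (k1 * k2) NN + cscale (k1 * k4) Nq + cscale (k3 * k2) qN + cscale (k3 * k4) qq"
proof -
  have e: "commutator (N10 c p v) (q10 c p u) = commutator (N10 c p u) (q10 c p v)"
    "commutator (N01 c p v) (q01 c p u) = commutator (N01 c p u) (q01 c p v)"
    using zero_brackets(5,6) by (simp_all add: bracket_wedge_def)
  have s: "commutator (N01 c p u) (N10 c p v) = - commutator (N10 c p v) (N01 c p u)"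
    "commutator (q10 c p u) (N10 c p v) = - commutator (N10 c p u) (q10 c p v)"
    "commutator (q01 c p u) (N10 c p v) = - commutator (N10 c p v) (q01 c p u)"
    "commutator (N01 c p u) (q10 c p v) = - commutator (q10 c p v) (N01 c p u)"
    "commutator (q01 c p u) (N01 c p v) = - commutator (N01 c p u) (q01 c p v)"
    "commutator (q01 c p u) (q10 c p v) = - commutator (q10 c p v) (q01 c p u)"
    by (subst commutator_swap, simp add: e)+
  show ?thesis
    unfolding assms commutator_add_left commutator_add_right commutator_cscale_left commutator_cscale_right
      zero_brackets s bracket_wedge_def
    by (simp add: vec_eq_iff cscale_nth algebra_simps)
qed

text \<open>Flatness of \<open>d\<close> fixes the sum of the derivatives of \<open>N10\<close> and
  \<open>N01\<close>, which leaves \<open>dext N10\<close> as the only free derivative of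
  \<open>N\<close>.\<close>

lemma dext_N01: "dext N01 c p u v = NN + NN - dext N10 c p u v"
proof -
  have "bracket_wedge a a c p u v = commutator (a c p u) (a c p v) + commutator (a c p u) (a c p v)"
    unfolding bracket_wedge_def by (subst (3) commutator_swap) simp
  also have "commutator (a c p u) (a c p v) = NN"
    by (subst commutator_combination[of "a c p" "-1" "-1" 0 0])
      (simp_all add: a_eq p vec_eq_iff cscale_nth)
  finally have "dext a c p u v = - (NN + NN)" using dext_a[OF p] by simp
  moreover have "dext a c p u v = - (dext N10 c p u v + dext N01 c p u v)"
  proof -
    have "dext a c p u v = dext (\<lambda>c p u. - (N10 c p u + N01 c p u)) c p u v"
      by (rule dext_cong[OF _ chart_form_minus[OF chart_form_add[OF parts_form(1,2)]] p]) (simp add: a_eq)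
    then show ?thesis by (simp only: dext_minus dext_add chart_form_add parts_form p)
  qed
  ultimately show ?thesis by (simp add: algebra_simps)
qed

text \<open>All three coefficients vanish at 1 and -1, as they must: the connections there are
  \<open>d\<close> and \<open>\<rho> d \<rho>\<close>. That the powers \<open>inverse z\<close> and
  \<open>z\<close> share a single defect is due to \<open>dext_N01\<close>.\<close>

lemma curv_alpha:
  assumes z: "z \<noteq> 0"
  shows "curv (alpha z) c p u v
    = cscale (inverse z - z) defX + cscale (inverse (z\<^sup>2) - 1) defY + cscale (z\<^sup>2 - 1) defZ"
proof -
  have 1: "dext (alpha z) c p u v = cscale (inverse z - 1) (dext N10 c p u v) + cscale (z - 1) (dext N01 c p u v)
      + cscale (inverse (z\<^sup>2) - 1) (dext q10 c p u v) + cscale (z\<^sup>2 - 1) (dext q01 c p u v)"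
  proof -
    have "dext (alpha z) c p u v = dext (\<lambda>c p u. cscale (inverse z - 1) (N10 c p u) + cscale (z - 1) (N01 c p u)
       + cscale (inverse (z\<^sup>2) - 1) (q10 c p u) + cscale (z\<^sup>2 - 1) (q01 c p u)) c p u v"
      by (rule dext_cong[OF _ _ p], rule alpha_eq[symmetric], assumption) (intro chart_form_add chart_form_cscale parts_form)
    then show ?thesis
      by (simp only: dext_add dext_cscale chart_form_add chart_form_cscale parts_form p)
  qed
  have 2: "commutator (alpha z c p u) (alpha z c p v) =
      cscale ((inverse z - 1) * (z - 1)) NN + cscale ((inverse z - 1) * (z\<^sup>2 - 1)) Nq
      + cscale ((inverse (z\<^sup>2) - 1) * (z - 1)) qN + cscale ((inverse (z\<^sup>2) - 1) * (z\<^sup>2 - 1)) qq"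
    by (rule commutator_combination) (rule alpha_eq[OF p])
  show ?thesis
    unfolding curv_def 1 2 dext_N01 defX_def defY_def defZ_def
    using z by (simp add: vec_eq_iff cscale_nth) (simp add: field_simps power2_eq_square)
qed

lemma dnabla_q10: "dnabla (connD \<tau> V) q10 c p u v = dext q10 c p u v - qN"
  and dnabla_q01: "dnabla (connD \<tau> V) q01 c p u v = dext q01 c p u v - Nq"
proof -
  have "bracket_wedge a \<eta> c p u v = - (bracket_wedge N10 \<eta> c p u v + bracket_wedge N01 \<eta> c p u v)" for \<eta>
    unfolding bracket_wedge_def a_eq[OF p] commutator_minus_left commutator_add_left by simp
  then show "dnabla (connD \<tau> V) q10 c p u v = dext q10 c p u v - qN"
    "dnabla (connD \<tau> V) q01 c p u v = dext q01 c p u v - Nq"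
    using bracket_wedge_sym[of N01 q10 c p u v]
    by (simp_all add: dnabla_eq parts_form p zero_brackets)
qed

lemma bracket_q_q: "cscale (1/2) (bracket_wedge q q c p u v) = qq"
proof -
  have "bracket_wedge q q c p u v = commutator (q c p u) (q c p v) + commutator (q c p u) (q c p v)"
    unfolding bracket_wedge_def by (subst (3) commutator_swap) simp
  also have "commutator (q c p u) (q c p v) = qq"
    by (subst commutator_combination[of "q c p" 0 0 1 1])
      (simp_all add: part_sum cscale_0 cscale_1)
  finally show ?thesis by (simp add: vec_eq_iff cscale_nth)
qed

lemma star_N_eq: "x \<in> chart_dom c \<Longrightarrow> star g (formN \<tau> V) c x w = cscale (- \<i>) (N10 c x w) + cscale \<i> (N01 c x w)"
proof -
  assume x: "x \<in> chart_dom c"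
  have "star g (formN \<tau> V) c x w = - (N10 c x (rotJ g c x w) + N01 c x (rotJ g c x w))"
    by (simp only: star_def part_sum)
  then show ?thesis by (simp add: J_parts x vec_eq_iff cscale_nth)
qed

text \<open>\<open>star\<close> multiplies \<open>N10\<close> by \<open>- \<i>\<close> and
  \<open>N01\<close> by \<open>\<i>\<close>; eliminating \<open>dext N01\<close> doubles the
  derivative of \<open>N10\<close>, whence the factor on the right.\<close>

lemma dnabla_star_N:
  "dnabla (connD \<tau> V) (star g (formN \<tau> V)) c p u v - cscale 2 (bracket_wedge q (star g (formN \<tau> V)) c p u v)
     = cscale (- 2 * \<i>) defX"
proof -
  have 1: "dext (star g (formN \<tau> V)) c p u v = cscale (- \<i>) (dext N10 c p u v) + cscale \<i> (dext N01 c p u v)"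
  proof -
    have "dext (star g (formN \<tau> V)) c p u v = dext (\<lambda>c p u. cscale (- \<i>) (N10 c p u) + cscale \<i> (N01 c p u)) c p u v"
      by (rule dext_cong[OF _ _ p], rule star_N_eq[symmetric], assumption) (intro chart_form_add chart_form_cscale parts_form)
    then show ?thesis by (simp only: dext_add dext_cscale chart_form_cscale parts_form p)
  qed
  have b: "bracket_wedge \<eta> (star g (formN \<tau> V)) c p u v
      = cscale (- \<i>) (bracket_wedge N10 \<eta> c p u v) + cscale \<i> (bracket_wedge \<eta> N01 c p u v)" for \<eta>
    unfolding bracket_wedge_sym[of N10 \<eta>]
    by (simp add: bracket_wedge_def star_N_eq[OF p] commutator_add_right commutator_cscale_right cscale_diff)
  have ba: "bracket_wedge N10 a c p u v = - NN" "bracket_wedge a N01 c p u v = - NN"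
    unfolding bracket_wedge_def a_eq[OF p] commutator_minus_left commutator_minus_right commutator_add_left
      commutator_add_right commutator_swap[of "N10 c p v" "N10 c p u"] commutator_swap[of "N01 c p v" "N01 c p u"]
      zero_brackets by simp_all
  have bq: "bracket_wedge N10 q c p u v = Nq" "bracket_wedge q N01 c p u v = qN"
    using zero_brackets(5) zero_brackets(6)[unfolded bracket_wedge_sym[of N01]]
    by (simp_all add: bracket_wedge_def part_sum[of q, symmetric] commutator_add_left commutator_add_right algebra_simps)
  show ?thesis
    unfolding dnabla_eq[OF chart_form_star[OF c formN_form] p] 1 b ba bq dext_N01 defX_def
    by (simp add: vec_eq_iff cscale_nth algebra_simps)
qed

end

end

lemma constrained_harmonic_iff:
  "constrained_harmonic \<A> g \<tau> V q \<longleftrightarrow>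
    (\<forall>c\<in>\<A>. \<forall>p\<in>chart_dom c. \<forall>u v. defX c p u v = 0 \<and> defY c p u v = 0 \<and> defZ c p u v = 0)"
proof -
  have c0: "cscale (- 2 * \<i>) A = 0 \<longleftrightarrow> A = 0" for A :: "complex^'n^'n"
    by (simp add: vec_eq_iff cscale_nth)
  have X: "dnabla (connD \<tau> V) (star g (formN \<tau> V)) c p u v = cscale 2 (bracket_wedge q (star g (formN \<tau> V)) c p u v)
      \<longleftrightarrow> defX c p u v = 0"
    and Y: "dnabla (connD \<tau> V) q10 c p u v = cscale (1/2) (bracket_wedge q q c p u v) \<longleftrightarrow> defY c p u v = 0"
    and Z: "dnabla (connD \<tau> V) q01 c p u v = cscale (1/2) (bracket_wedge q q c p u v) \<longleftrightarrow> defZ c p u v = 0"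
    if "c \<in> \<A>" "p \<in> chart_dom c" for c p u v
    using dnabla_star_N[OF that, of u v] c0[of "defX c p u v"]
    unfolding dnabla_q10[OF that] dnabla_q01[OF that] bracket_q_q[OF that] defY_def[OF that] defZ_def[OF that]
    by auto
  show ?thesis
    unfolding constrained_harmonic_def eq_form2_def using subbundle nondeg split X Y Z by auto
qed

text \<open>The three coefficient functions of \<open>curv_alpha\<close> are linearly independent on any infinite set.\<close>

lemma constrained_harmonicI:
  assumes D: "infinite D" "0 \<notin> D"
    and flat: "\<And>c p u v z. c \<in> \<A> \<Longrightarrow> p \<in> chart_dom c \<Longrightarrow> z \<in> D \<Longrightarrow> curv (alpha z) c p u v = 0"
  shows "constrained_harmonic \<A> g \<tau> V q"
  unfolding constrained_harmonic_iff
proof (intro ballI allI)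
  fix c p u v assume cp: "c \<in> \<A>" "p \<in> chart_dom c"
  have "defX c p u v $ i $ j = 0 \<and> defY c p u v $ i $ j = 0 \<and> defZ c p u v $ i $ j = 0" for i j
  proof -
    define x y w where "x = defX c p u v $ i $ j" and "y = defY c p u v $ i $ j" and "w = defZ c p u v $ i $ j"
    \<comment> \<open>The curvature entry multiplied by \<open>z\<^sup>2\<close>, with the constant
      term first.\<close>
    have "poly [:y, x, - y - w, - x, w:] z = 0" if "z \<in> D" for z
    proof -
      have z: "z \<noteq> 0" using D that by auto
      have "(inverse z - z) * x + (inverse (z\<^sup>2) - 1) * y + (z\<^sup>2 - 1) * w = 0"
        using flat[OF cp that, of u v] unfolding curv_alpha[OF cp z]
        by (simp add: vec_eq_iff cscale_nth x_def y_def w_def)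
      then have "0 = z\<^sup>2 * (inverse z - z) * x + z\<^sup>2 * (inverse (z\<^sup>2) - 1) * y + z\<^sup>2 * (z\<^sup>2 - 1) * w"
        by (metis (no_types, opaque_lifting) distrib_left mult.assoc mult_zero_right)
      moreover have "z\<^sup>2 * (inverse z - z) = z - z^3" "z\<^sup>2 * (inverse (z\<^sup>2) - 1) = 1 - z\<^sup>2"
        using z by (simp_all add: field_simps power2_eq_square power3_eq_cube)
      ultimately have "0 = (z - z^3) * x + (1 - z\<^sup>2) * y + z\<^sup>2 * (z\<^sup>2 - 1) * w" by simp
      then show ?thesis by (simp add: algebra_simps power2_eq_square power3_eq_cube)
    qed
    then have "D \<subseteq> {z. poly [:y, x, - y - w, - x, w:] z = 0}" by blast
    then have "[:y, x, - y - w, - x, w:] = 0"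
      using D(1) poly_roots_finite finite_subset by metis
    then show ?thesis unfolding x_def[symmetric] y_def[symmetric] w_def[symmetric] by simp
  qed
  then show "defX c p u v = 0 \<and> defY c p u v = 0 \<and> defZ c p u v = 0" by (simp add: vec_eq_iff)
qed

lemma constrained_harmonic_flat:
  assumes "constrained_harmonic \<A> g \<tau> V q" "c \<in> \<A>" "p \<in> chart_dom c" "z \<noteq> 0"
  shows "curv (alpha z) c p u v = 0"
  using assms unfolding constrained_harmonic_iff by (simp add: curv_alpha cscale_zero)

end

section \<open>Laurent polynomials and rational families\<close>

text \<open>\<open>z\<^sup>2 * f z\<close> extends over 0 and grows at most like the fourth power,
  so by Liouville it is a polynomial of degree at most 4. Its constant term is the limit at 0, its
  top coefficient the limit at infinity.\<close>

lemma laurent_polynomial: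
  fixes f :: "complex \<Rightarrow> complex"
  assumes hol: "f holomorphic_on - {0}"
    and l0: "((\<lambda>z. z\<^sup>2 * f z) \<longlongrightarrow> l) (at 0)" and linf: "((\<lambda>z. inverse (z\<^sup>2) * f z) \<longlongrightarrow> m) at_infinity"
  obtains a b d where "\<And>z. z \<noteq> 0 \<Longrightarrow> f z = inverse (z\<^sup>2) * l + inverse z * a + b + z * d + z\<^sup>2 * m"
proof -
  define h where "h z = (if z = 0 then l else z\<^sup>2 * f z)" for z
  have h0: "(h \<longlongrightarrow> h 0) (at 0)"
    unfolding h_def by (rule Lim_transform_eventually[OF l0[THEN tendsto_eq_rhs]])
      (auto simp: eventually_at intro!: exI[of _ 1])
  have hol_h: "h holomorphic_on UNIV"
  proof (rule no_isolated_singularity'[where K = "{0}"])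
    have "(\<lambda>z. z\<^sup>2 * f z) holomorphic_on - {0}" by (intro holomorphic_intros hol)
    then have "h holomorphic_on - {0}"
      by (rule holomorphic_transform) (auto simp: h_def)
    then show "h holomorphic_on (UNIV - {0})" by (simp add: Compl_eq_Diff_UNIV)
    show "(h \<longlongrightarrow> h z) (at z within UNIV)" if "z \<in> {0}" for z using h0 that by simp
  qed auto
  have "\<forall>\<^sub>F z in at_infinity. norm (inverse (z\<^sup>2) * f z) < norm m + 1"
    using tendsto_norm[OF linf] by (rule order_tendstoD) simp
  then obtain A where A: "\<And>z. A \<le> norm z \<Longrightarrow> norm (inverse (z\<^sup>2) * f z) < norm m + 1"
    by (auto simp: eventually_at_infinity)
  \<comment> \<open>The maximum with 1 keeps \<open>z\<close> away from 0, where \<open>h\<close> is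
    not given by \<open>f\<close>.\<close>
  have bound: "norm (h z) \<le> (norm m + 1) * norm z ^ 4" if z: "max A 1 \<le> norm z" for z
  proof -
    have "z \<noteq> 0" using z by auto
    then have "norm (h z) = norm (inverse (z\<^sup>2) * f z) * norm z ^ 4"
      by (simp add: h_def norm_mult norm_power norm_inverse norm_divide power4_eq_xxxx power2_eq_square divide_simps)
    also have "\<dots> \<le> (norm m + 1) * norm z ^ 4"
      using A[of z] z by (intro mult_right_mono) auto
    finally show ?thesis .
  qed
  define k where "k i = (deriv ^^ i) h 0 / fact i" for i
  have k: "h z = (\<Sum>i\<le>4. k i * z ^ i)" for z
    unfolding k_def using hol_h bound by (rule Liouville_polynomial[of h "max A 1" "norm m + 1" 4])
  have hk: "h z = k 0 + k 1 * z + k 2 * z\<^sup>2 + k 3 * z ^ 3 + k 4 * z ^ 4" for z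
    by (simp add: k numeral_eq_Suc)
  have k0: "k 0 = l" using hk[of 0] by (simp add: h_def)
  have fz: "f z = inverse (z\<^sup>2) * k 0 + inverse z * k 1 + k 2 + z * k 3 + z\<^sup>2 * k 4" if "z \<noteq> 0" for z
  proof -
    have "z\<^sup>2 * f z = z\<^sup>2 * (inverse (z\<^sup>2) * k 0 + inverse z * k 1 + k 2 + z * k 3 + z\<^sup>2 * k 4)"
      using hk[of z] that by (simp add: h_def power2_eq_square power3_eq_cube power4_eq_xxxx field_simps)
    then show ?thesis using that by simp
  qed
  have inv0: "((\<lambda>z :: complex. inverse z) \<longlongrightarrow> 0) at_infinity" by (rule tendsto_inverse_0)
  have "((\<lambda>z. (inverse z)^4 * k 0 + (inverse z)^3 * k 1 + (inverse z)\<^sup>2 * k 2 + inverse z * k 3 + k 4)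
      \<longlongrightarrow> 0^4 * k 0 + 0^3 * k 1 + 0\<^sup>2 * k 2 + 0 * k 3 + k 4) at_infinity"
    by (intro tendsto_intros inv0)
  moreover have "\<forall>\<^sub>F z :: complex in at_infinity. z \<noteq> 0"
    unfolding eventually_at_infinity by (intro exI[of _ 1]) auto
  then have "\<forall>\<^sub>F z in at_infinity. (inverse z)^4 * k 0 + (inverse z)^3 * k 1 + (inverse z)\<^sup>2 * k 2 + inverse z * k 3 + k 4
      = inverse (z\<^sup>2) * f z"
    by eventually_elim (simp add: fz power2_eq_square power3_eq_cube power4_eq_xxxx field_simps)
  ultimately have "((\<lambda>z. inverse (z\<^sup>2) * f z) \<longlongrightarrow> k 4) at_infinity"
    by (auto dest: Lim_transform_eventually)
  then have "k 4 = m" using linf by (intro tendsto_unique[OF trivial_limit_at_infinity])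
  then show ?thesis using fz that k0 by blast
qed

lemma bounded_bilinear_cscale: "bounded_bilinear (cscale :: complex \<Rightarrow> complex^'n^'k \<Rightarrow> _)"
  unfolding bilinear_conv_bounded_bilinear[symmetric] bilinear_def
  by (auto intro!: linearI simp: cscale_add cscale_scaleR)
    (auto simp: vec_eq_iff cscale_nth algebra_simps)

lemmas tendsto_cscale = bounded_bilinear.tendsto[OF bounded_bilinear_cscale]
lemmas tendsto_matrix_mult = bounded_bilinear.tendsto[OF bounded_bilinear_matrix_mult]

lemma tendsto_matrix_iff:
  fixes B :: "'z \<Rightarrow> complex^'n^'k"
  shows "(B \<longlongrightarrow> L) F \<longleftrightarrow> (\<forall>i j. ((\<lambda>z. B z $ i $ j) \<longlongrightarrow> L $ i $ j) F)"
proof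
  show "(B \<longlongrightarrow> L) F" if "\<forall>i j. ((\<lambda>z. B z $ i $ j) \<longlongrightarrow> L $ i $ j) F"
    using that by (intro vec_tendstoI) blast
qed (auto intro!: tendsto_vec_nth)

lemma laurent_polynomial_matrix:
  fixes B :: "complex \<Rightarrow> complex^'n^'k"
  assumes hol: "\<And>i j. (\<lambda>z. B z $ i $ j) holomorphic_on - {0}"
    and l0: "((\<lambda>z. cscale (z\<^sup>2) (B z)) \<longlongrightarrow> L) (at 0)"
    and linf: "((\<lambda>z. cscale (inverse (z\<^sup>2)) (B z)) \<longlongrightarrow> M) at_infinity"
  obtains C1 C2 C3 where "\<And>z. z \<noteq> 0 \<Longrightarrow>
    B z = cscale (inverse (z\<^sup>2)) L + cscale (inverse z) C1 + C2 + cscale z C3 + cscale (z\<^sup>2) M"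
proof -
  have "\<exists>x y w. \<forall>z. z \<noteq> 0 \<longrightarrow>
      B z $ i $ j = inverse (z\<^sup>2) * L $ i $ j + inverse z * x + y + z * w + z\<^sup>2 * M $ i $ j" for i j
  proof -
    have "((\<lambda>z. z\<^sup>2 * B z $ i $ j) \<longlongrightarrow> L $ i $ j) (at 0)"
      "((\<lambda>z. inverse (z\<^sup>2) * B z $ i $ j) \<longlongrightarrow> M $ i $ j) at_infinity"
      using l0 linf by (simp_all add: tendsto_matrix_iff cscale_nth)
    from laurent_polynomial[OF hol this] show ?thesis by metis
  qed
  then obtain x y w where "\<And>i j z. z \<noteq> 0 \<Longrightarrow>
      B z $ i $ j = inverse (z\<^sup>2) * L $ i $ j + inverse z * x i j + y i j + z * w i j + z\<^sup>2 * M $ i $ j"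
    by metis
  then show ?thesis
    by (intro that[of "\<chi> i j. x i j" "\<chi> i j. y i j" "\<chi> i j. w i j"]) (simp add: vec_eq_iff cscale_nth)
qed

section \<open>Rational functions at infinity\<close>

lemma power_over_poly_at_infinity:
  fixes Q :: "complex poly"
  assumes Q: "Q \<noteq> 0" and k: "k \<le> degree Q"
  shows "((\<lambda>z. z ^ k * inverse (poly Q z)) \<longlongrightarrow> (if k = degree Q then inverse (lead_coeff Q) else 0)) at_infinity"
  unfolding lim_at_infinity_0
proof (rule Lim_transform_eventually)
  have "((\<lambda>w. w ^ (degree Q - k) * inverse (poly (reflect_poly Q) w))
      \<longlongrightarrow> 0 ^ (degree Q - k) * inverse (poly (reflect_poly Q) 0)) (at 0)"
    using Q by (intro tendsto_intros) simp_all
  then show "((\<lambda>w. w ^ (degree Q - k) * inverse (poly (reflect_poly Q) w))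
      \<longlongrightarrow> (if k = degree Q then inverse (lead_coeff Q) else 0)) (at 0)"
    by (rule tendsto_eq_rhs) (use k in auto)
  \<comment> \<open>At \<open>z = inverse w\<close> the denominator turns into
    \<open>reflect_poly Q\<close>, whose value at 0 is the nonzero leading coefficient of
    \<open>Q\<close>.\<close>
  have "w ^ (degree Q - k) * inverse (poly (reflect_poly Q) w) = ((\<lambda>z. z ^ k * inverse (poly Q z)) \<circ> inverse) w"
    if w: "w \<noteq> 0" for w :: complex
  proof -
    have e: "w ^ degree Q = w ^ (degree Q - k) * w ^ k" using k by (simp flip: power_add)
    show ?thesis using w by (simp add: poly_reflect_poly_nz e power_inverse)
  qed
  then show "\<forall>\<^sub>F w in at 0. w ^ (degree Q - k) * inverse (poly (reflect_poly Q) w)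
      = ((\<lambda>z. z ^ k * inverse (poly Q z)) \<circ> inverse) w"
    by (auto simp: eventually_at intro!: exI[of _ 1])
qed

lemma eventually_poly_nonzero_at_infinity:
  fixes Q :: "complex poly"
  assumes "Q \<noteq> 0"
  shows "\<forall>\<^sub>F z in at_infinity. poly Q z \<noteq> 0"
proof -
  have "bounded {z. poly Q z = 0}" using assms by (simp add: poly_roots_finite finite_imp_bounded)
  then obtain b where "\<And>z. poly Q z = 0 \<Longrightarrow> norm z \<le> b" by (auto simp: bounded_iff)
  then show ?thesis
    unfolding eventually_at_infinity by (intro exI[of _ "b + 1"]) force
qed

text \<open>If \<open>R\<close> had larger degree, \<open>Q / R\<close> would tend to 0, while its
  product with the convergent \<open>R / Q\<close> is eventually 1.\<close>

lemma degree_le_of_bounded_quotient: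
  fixes R Q :: "complex poly"
  assumes Q: "Q \<noteq> 0" and lim: "((\<lambda>z. inverse (poly Q z) * poly R z) \<longlongrightarrow> l) at_infinity"
  shows "degree R \<le> degree Q"
proof (rule ccontr)
  assume "\<not> degree R \<le> degree Q"
  then have deg: "degree Q < degree R" and R: "R \<noteq> 0" by auto
  have "((\<lambda>z. \<Sum>k\<le>degree Q. coeff Q k * (z ^ k * inverse (poly R z))) \<longlongrightarrow> (\<Sum>k\<le>degree Q. coeff Q k * 0)) at_infinity"
  proof (intro tendsto_intros)
    fix k assume "k \<in> {..degree Q}"
    then show "((\<lambda>z. z ^ k * inverse (poly R z)) \<longlongrightarrow> 0) at_infinity"
      using power_over_poly_at_infinity[OF R, of k] deg by (auto split: if_splits)
  qed
  then have "((\<lambda>z. poly Q z * inverse (poly R z)) \<longlongrightarrow> 0) at_infinity"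
    by (simp add: poly_altdef sum_distrib_right mult.assoc)
  from tendsto_mult[OF this lim]
  have "((\<lambda>z. (poly Q z * inverse (poly R z)) * (inverse (poly Q z) * poly R z)) \<longlongrightarrow> 0) at_infinity" by simp
  moreover have "\<forall>\<^sub>F z in at_infinity. (poly Q z * inverse (poly R z)) * (inverse (poly Q z) * poly R z) = 1"
    using eventually_poly_nonzero_at_infinity[OF Q] eventually_poly_nonzero_at_infinity[OF R]
    by eventually_elim (simp add: field_simps)
  ultimately have "((\<lambda>z. 1 :: complex) \<longlongrightarrow> 0) (at_infinity :: complex filter)"
    by (rule Lim_transform_eventually)
  then show False using tendsto_unique[OF trivial_limit_at_infinity tendsto_const, of "1 :: complex" 0] by simp
qed

text \<open>Numerators of degree at most \<open>degree Q\<close> suffice, since \<open>r\<close> is regular at \<open>\<infinity>\<close>.\<close>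

definition rational_matrix :: "complex poly \<Rightarrow> (nat \<Rightarrow> complex^'n^'k) \<Rightarrow> complex \<Rightarrow> complex^'n^'k" where
  "rational_matrix Q X z = (\<Sum>k\<le>degree Q. cscale (z ^ k * inverse (poly Q z)) (X k))"

lemma rational_matrix_at_0:
  assumes "poly Q 0 \<noteq> 0"
  shows "(rational_matrix Q X \<longlongrightarrow> rational_matrix Q X 0) (at 0)"
  unfolding rational_matrix_def[abs_def]
  by (intro tendsto_sum tendsto_cscale tendsto_mult tendsto_power tendsto_inverse tendsto_const
      tendsto_ident_at assms isContD[OF poly_isCont])

lemma rational_matrix_at_infinity:
  assumes "Q \<noteq> 0"
  shows "(rational_matrix Q X \<longlongrightarrow> cscale (inverse (lead_coeff Q)) (X (degree Q))) at_infinity"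
proof -
  have "(rational_matrix Q X \<longlongrightarrow> (\<Sum>k\<le>degree Q. cscale (if k = degree Q then inverse (lead_coeff Q) else 0) (X k))) at_infinity"
    unfolding rational_matrix_def[abs_def]
    by (intro tendsto_sum tendsto_cscale tendsto_const power_over_poly_at_infinity assms) auto
  moreover have "(\<Sum>k\<le>degree Q. cscale (if k = degree Q then inverse (lead_coeff Q) else 0) (X k))
      = (\<Sum>k\<le>degree Q. if k = degree Q then cscale (inverse (lead_coeff Q)) (X k) else 0)"
    by (rule sum.cong) (auto simp: cscale_0)
  ultimately show ?thesis by simp
qed

lemma holomorphic_at_inf_tendsto:
  assumes "holomorphic_at_inf r"
  shows "((\<lambda>z. r z p) \<longlongrightarrow> at_inf r p) at_infinity"
  unfolding tendsto_matrix_iff lim_at_infinity_0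
proof (intro allI)
  fix i j
  let ?f = "\<lambda>w. if w = 0 then at_inf r p $ i $ j else r (inverse w) p $ i $ j"
  have "?f analytic_on {0}" using assms by (simp add: holomorphic_at_inf_def)
  then have "isCont ?f 0" by (rule analytic_at_imp_isCont)
  then have "(?f \<longlongrightarrow> at_inf r p $ i $ j) (at 0)" by (simp add: isCont_def)
  then show "(((\<lambda>z. r z p $ i $ j) \<circ> inverse) \<longlongrightarrow> at_inf r p $ i $ j) (at 0)"
    by (rule Lim_transform_eventually) (auto simp: eventually_at intro!: exI[of _ 1])
qed

text \<open>The dependence on \<open>z\<close> is confined to scalar factors and that on the point
  to finitely many smooth \<open>X k\<close>. Hence the limit at infinity is smooth, and derivatives
  along the surface pass to limits in \<open>z\<close>.\<close>

lemma rational_family_normal_form: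
  fixes r :: "complex \<Rightarrow> 'm::topological_space \<Rightarrow> complex^'n^'n"
  assumes r: "rational_family \<A> r D" and inf: "holomorphic_at_inf r"
    and charts: "\<And>c. c \<in> \<A> \<Longrightarrow> surface_chart c"
  obtains Q X where "Q \<noteq> 0" "D = {z. poly Q z \<noteq> 0}" "\<And>c k. c \<in> \<A> \<Longrightarrow> chart_smooth c (X k)"
    "\<And>z p. z \<in> D \<Longrightarrow> r z p = rational_matrix Q (\<lambda>k. X k p) z"
proof -
  obtain Q N A where Q: "Q \<noteq> 0" and A: "\<And>k. k \<le> N \<Longrightarrow> smooth_map \<A> (A k)" and D: "D = {z. poly Q z \<noteq> 0}"
    and rA: "\<And>z p. z \<in> D \<Longrightarrow> r z p = cscale (inverse (poly Q z)) (\<Sum>k\<le>N. cscale (z ^ k) (A k p))"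
    using r unfolding rational_family_def by (elim exE conjE) blast
  define X where "X k p = (if k \<le> N then A k p else 0)" for k p
  have nth: "r z p $ i $ j = inverse (poly Q z) * (\<Sum>k\<le>N. z ^ k * X k p $ i $ j)" if "z \<in> D" for z p i j
    unfolding rA[OF that] by (simp add: cscale_nth X_def)
  have X0: "X k p = 0" if "k > degree Q" for k p
  proof -
    have "X k p $ i $ j = 0" for i j
    proof -
      \<comment> \<open>One entry of the numerator as a scalar polynomial; finiteness of
        \<open>r\<close> at infinity bounds its degree and so annihilates its higher
        coefficients.\<close>
      define R where "R = (\<Sum>k\<le>N. monom (X k p $ i $ j) k)"
      have coeff: "coeff R k = X k p $ i $ j" for k
        by (simp add: R_def coeff_sum X_def)
      have poly: "poly R z = (\<Sum>k\<le>N. z ^ k * X k p $ i $ j)" for z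
        by (simp add: R_def poly_sum poly_monom mult.commute)
      have "((\<lambda>z. r z p $ i $ j) \<longlongrightarrow> at_inf r p $ i $ j) at_infinity"
        using holomorphic_at_inf_tendsto[OF inf] by (simp add: tendsto_matrix_iff)
      moreover have "\<forall>\<^sub>F z in at_infinity. r z p $ i $ j = inverse (poly Q z) * poly R z"
        using eventually_poly_nonzero_at_infinity[OF Q] by eventually_elim (simp add: nth D poly)
      ultimately have "((\<lambda>z. inverse (poly Q z) * poly R z) \<longlongrightarrow> at_inf r p $ i $ j) at_infinity"
        by (rule Lim_transform_eventually)
      then have "degree R \<le> degree Q" by (rule degree_le_of_bounded_quotient[OF Q])
      then show ?thesis using that coeff[of k] coeff_eq_0[of R k] by simp
    qed
    then show ?thesis by (simp add: vec_eq_iff)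
  qed
  have eq: "r z p = rational_matrix Q (\<lambda>k. X k p) z" if "z \<in> D" for z p
  proof -
    have "(\<Sum>k\<le>N. cscale (z ^ k) (A k p)) = (\<Sum>k\<le>N. cscale (z ^ k) (X k p))"
      by (rule sum.cong) (auto simp: X_def)
    also have "\<dots> = (\<Sum>k\<le>max N (degree Q). cscale (z ^ k) (X k p))"
      by (rule sum.mono_neutral_left) (auto simp: X_def cscale_zero)
    also have "\<dots> = (\<Sum>k\<le>degree Q. cscale (z ^ k) (X k p))"
      by (rule sum.mono_neutral_right) (auto simp: X0 cscale_zero)
    finally have "r z p = (\<Sum>k\<le>degree Q. cscale (inverse (poly Q z)) (cscale (z ^ k) (X k p)))"
      by (simp add: rA[OF that] linear_sum[OF bounded_linear.linear[OF bounded_linear_cscale]])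
    then show ?thesis
      by (simp add: rational_matrix_def cscale_cscale mult.commute)
  qed
  have smooth: "chart_smooth c (X k)" if c: "c \<in> \<A>" for c k
    using smooth_map_chart_smooth[OF A c, of k] surface_chart.chart_smooth_const[OF charts[OF c], of 0]
    by (cases "k \<le> N") (simp_all add: X_def[abs_def])
  show ?thesis by (rule that[OF Q D smooth eq])
qed

section \<open>Transport of the bundle data by an orthogonal gauge transformation\<close>

lemma orthogonal_section_isometry: "orthogonal_section \<A> \<tau> R \<Longrightarrow> isometry \<tau> (R p)"
  by (simp add: orthogonal_section_def isometry_def)

context nondeg_bundle
begin

lemma transport_bundle:
  assumes S: "smooth_map \<A> S" and iso: "\<And>p. isometry \<tau> (S p)"
  shows "nondeg_bundle \<A> \<tau> (\<lambda>p. (*v) (S p) ` V p)"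
proof
  show "oriented_surface_atlas \<A>" by (rule atlas)
  have inv: "madj \<tau> (S p) *v (S p *v v) = v" for p v
    by (simp add: matrix_vector_mul_assoc madj_mult_isometry[OF iso])
  have inj: "inj_on ((*v) (S p)) A" for p A
    by (rule inj_on_inverseI[of _ "(*v) (madj \<tau> (S p))"]) (rule inv)
  show "smooth_subbundle \<A> (\<lambda>p. (*v) (S p) ` V p)"
    unfolding smooth_subbundle_def
  proof
    fix p
    obtain W k and s :: "nat \<Rightarrow> 'm \<Rightarrow> complex^'n" where W: "open W" "p \<in> W"
      and s: "\<And>j. j < k \<Longrightarrow> smooth_map_on \<A> W (s j)"
      and f: "\<And>x. x \<in> W \<Longrightarrow> inj_on (\<lambda>j. s j x) {..<k} \<and> vec.independent ((\<lambda>j. s j x) ` {..<k}) \<and>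
         vec.span ((\<lambda>j. s j x) ` {..<k}) = V x"
      using subbundle unfolding smooth_subbundle_def by metis
    show "\<exists>W k (s :: nat \<Rightarrow> 'm \<Rightarrow> complex^'n). open W \<and> p \<in> W \<and> (\<forall>j<k. smooth_map_on \<A> W (s j)) \<and>
        (\<forall>x\<in>W. inj_on (\<lambda>j. s j x) {..<k} \<and> vec.independent ((\<lambda>j. s j x) ` {..<k}) \<and>
          vec.span ((\<lambda>j. s j x) ` {..<k}) = (*v) (S x) ` V x)"
    proof (rule exI[of _ W], rule exI[of _ k], rule exI[of _ "\<lambda>j x. S x *v s j x"], intro conjI allI impI ballI)
      fix j assume j: "j < k"
      show "smooth_map_on \<A> W (\<lambda>x. S x *v s j x)"
        unfolding smooth_map_on_def
      proof
        fix c assume c: "c \<in> \<A>"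
        interpret surface_chart c by (rule surface_chart_atlas[OF atlas c])
        have "smooth_on (chart_map c ` (chart_dom c \<inter> W)) (\<lambda>x. (S \<circ> chart_inv c) x *v (s j \<circ> chart_inv c) x)"
        proof (rule smooth_on_bilinear[OF open_chart_image[OF W(1)] bounded_bilinear_matrix_vec])
          show "smooth_on (chart_map c ` (chart_dom c \<inter> W)) (S \<circ> chart_inv c)"
            using S c unfolding smooth_map_on_def by (auto intro: smooth_on_subset)
          show "smooth_on (chart_map c ` (chart_dom c \<inter> W)) (s j \<circ> chart_inv c)"
            using s[OF j] c unfolding smooth_map_on_def by blast
        qed
        then show "smooth_on (chart_map c ` (chart_dom c \<inter> W)) ((\<lambda>x. S x *v s j x) \<circ> chart_inv c)"
          by (simp add: o_def)
      qed
    next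
      fix x assume x: "x \<in> W"
      have im: "(\<lambda>j. S x *v s j x) ` {..<k} = (*v) (S x) ` (\<lambda>j. s j x) ` {..<k}" by auto
      show "inj_on (\<lambda>j. S x *v s j x) {..<k}"
        using f[OF x] inj[of x UNIV] by (auto simp: inj_on_def)
      show "vec.independent ((\<lambda>j. S x *v s j x) ` {..<k})"
        unfolding im using f[OF x] inj
        by (intro vec.linear_independent_injective_image matrix_vector_mul_linear_gen) auto
      show "vec.span ((\<lambda>j. S x *v s j x) ` {..<k}) = (*v) (S x) ` V x"
        unfolding im using f[OF x]
        by (simp add: vec.linear_span_image[OF matrix_vector_mul_linear_gen])
    qed (use W in auto)
  qed
  show "nondegenerate \<tau> (\<lambda>p. (*v) (S p) ` V p)"
    using nondeg_proj_isometry[OF nondeg_proj_P iso] unfolding nondegenerate_def nondeg_proj_def by blast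
qed

end

section \<open>Independence of the type decomposition from the chart\<close>

context surface_metric
begin

lemma chart_transition_derivative:
  assumes c: "c \<in> \<A>" "c' \<in> \<A>" and p: "p \<in> chart_dom c" "p \<in> chart_dom c'"
  shows "linear (extd (chart_map c') c p)" "det (matrix (extd (chart_map c') c p)) > 0"
proof -
  have "smooth_on (chart_map c ` (chart_dom c \<inter> chart_dom c')) (chart_map c' \<circ> chart_inv c)"
    using atlas c unfolding oriented_surface_atlas_def by blast
  from smooth_on_has_derivative[OF this, of "chart_map c p"]
  show "linear (extd (chart_map c') c p)"
    using p by (auto simp: extd_def[abs_def] dest: has_derivative_linear)
  show "det (matrix (extd (chart_map c') c p)) > 0"
    using atlas c p unfolding oriented_surface_atlas_def by blast
qed

text \<open>\<open>J\<close> is determined by the metric and the orientation, hence does not depend on the chart.\<close>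

lemma rotJ_transition:
  assumes c: "c \<in> \<A>" "c' \<in> \<A>" and p: "p \<in> chart_dom c" "p \<in> chart_dom c'"
  shows "rotJ g c' p (extd (chart_map c') c p u) = extd (chart_map c') c p (rotJ g c p u)"
proof (cases "u = 0")
  case True
  then show ?thesis
    using chart_transition_derivative[OF c p] linear_rotJ[OF c(1) p(1)] linear_rotJ[OF c(2) p(2)]
    by (simp add: linear_0)
next
  case False
  define L where "L = extd (chart_map c') c p"
  define u' w where "u' = L u" and "w = L (rotJ g c p u)"
  have lin: "linear L" and det: "det (matrix L) > 0"
    using chart_transition_derivative[OF c p] by (simp_all add: L_def)
  have gL: "g c p x y = g c' p (L x) (L y)" for x y
    using metric c p unfolding riemannian_metric_def L_def by blast
  note J = rotJ_characterisation[of g c p, OF metricD(1)[OF c(1) p(1)] metricD(2)[OF c(1) p(1)] metricD(3)[OF c(1) p(1)]]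
  note J' = rotJ_characterisation[of g c' p, OF metricD(1)[OF c(2) p(2)] metricD(2)[OF c(2) p(2)] metricD(3)[OF c(2) p(2)]]
  have cross: "L x $ 1 * L y $ 2 - L x $ 2 * L y $ 1 = det (matrix L) * (x $ 1 * y $ 2 - x $ 2 * y $ 1)" for x y
  proof -
    have "L z $ i = matrix L $ i $ 1 * z $ 1 + matrix L $ i $ 2 * z $ 2" for z i
      using matrix_works[OF lin[folded linear_matrix_vector_mul_eq], of z]
      by (metis (no_types, lifting) lin matrix_vector_mul_linear matrix_vector_mul(1) matrix_vector_mult_def sum_2 vec_lambda_beta)
    then show ?thesis by (simp add: det_2 algebra_simps)
  qed
  have o: "g c' p u' w = 0" and n: "g c' p w w = g c' p u' u'"
    unfolding u'_def w_def gL[symmetric] using J(1,2)[of u] by simp_all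
  have pos: "u' $ 1 * w $ 2 - u' $ 2 * w $ 1 > 0"
    unfolding u'_def w_def cross using det rotJ_pos[OF c(1) p(1) False] by simp
  have pu: "g c' p u' u' > 0"
    unfolding u'_def gL[symmetric] using metricD(3)[OF c(1) p(1) False] .
  have u0: "u' \<noteq> 0" using pos by auto
  \<comment> \<open>Three facts fix the image of \<open>J u\<close>: orthogonality to
    \<open>u'\<close> gives \<open>s = 0\<close>, equality of lengths gives
    \<open>t * t = 1\<close>, and orientation excludes \<open>t = -1\<close>.\<close>
  obtain s t where st: "w = s *\<^sub>R u' + t *\<^sub>R rotJ g c' p u'"
    by (rule rotJ_basis[OF c(2) p(2) u0])
  note bil = metricD(1)[OF c(2) p(2)]
  have "s * g c' p u' u' = 0"
    using o J'(1)[of u'] unfolding st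
    by (simp add: bilinear_radd[OF bil] bilinear_rmul[OF bil])
  then have s: "s = 0" using pu by simp
  have "t * t * g c' p u' u' = g c' p u' u'"
    using n J'(2)[of u'] unfolding st s
    by (simp add: bilinear_rmul[OF bil] bilinear_lmul[OF bil])
  then have t2: "t * t = 1" using pu by simp
  have "t * (u' $ 1 * rotJ g c' p u' $ 2 - u' $ 2 * rotJ g c' p u' $ 1) > 0"
    using pos unfolding st s by (simp add: algebra_simps)
  then have "t > 0" using rotJ_pos[OF c(2) p(2) u0] by (simp add: zero_less_mult_iff)
  then have "t = 1" using t2 by (simp add: square_eq_1_iff)
  then show ?thesis using st s by (simp add: u'_def w_def L_def)
qed

lemma smooth_form1_intro:
  assumes "\<And>c. c \<in> \<A> \<Longrightarrow> chart_form c \<omega>"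
    "\<And>c c' p u. c \<in> \<A> \<Longrightarrow> c' \<in> \<A> \<Longrightarrow> p \<in> chart_dom c \<Longrightarrow> p \<in> chart_dom c' \<Longrightarrow>
      \<omega> c p u = \<omega> c' p (extd (chart_map c') c p u)"
  shows "smooth_form1 \<A> \<omega>"
  using assms unfolding smooth_form1_def chart_form_def chart_smooth_def o_def by blast

text \<open>Dressing conjugates the two types by different matrices, so each part has to transform
  as a form by itself for the dressed form to be one.\<close>

lemma part_transition:
  assumes \<omega>: "smooth_form1 \<A> \<omega>" and c: "c \<in> \<A>" "c' \<in> \<A>" and p: "p \<in> chart_dom c" "p \<in> chart_dom c'"
  shows "part10 g \<omega> c p u = part10 g \<omega> c' p (extd (chart_map c') c p u)"
    "part01 g \<omega> c p u = part01 g \<omega> c' p (extd (chart_map c') c p u)"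
proof -
  have "\<omega> c p u = \<omega> c' p (extd (chart_map c') c p u)" for u
    using \<omega> c p unfolding smooth_form1_def by blast
  then show "part10 g \<omega> c p u = part10 g \<omega> c' p (extd (chart_map c') c p u)"
    "part01 g \<omega> c p u = part01 g \<omega> c' p (extd (chart_map c') c p u)"
    by (simp_all add: part10_def part01_def rotJ_transition[OF c p])
qed

end

section \<open>Dressing\<close>

lemma isometry_of_left_inverse: "madj \<tau> R ** R = mat 1 \<Longrightarrow> isometry \<tau> R"
  by (simp add: isometry_def mink_madj matrix_vector_mul_assoc)

lemma smooth_map_iff: "smooth_map \<A> f \<longleftrightarrow> (\<forall>c\<in>\<A>. chart_smooth c f)"
  by (simp add: smooth_map_on_def chart_smooth_def)

text \<open>The gauge term stays bounded and is killed by \<open>\<kappa>\<close>, so only the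
  conjugated form contributes. It is used at 0 and at infinity, with \<open>\<kappa>\<close> of
  order two for the extreme coefficients and of order one for the types of the next ones.\<close>

lemma dressing_limit:
  fixes G H \<omega> d :: "'z \<Rightarrow> complex^'n^'n"
  assumes "(\<kappa> \<longlongrightarrow> 0) F" "((\<lambda>z. cscale (\<kappa> z) (\<omega> z)) \<longlongrightarrow> L) F"
    and "(G \<longlongrightarrow> G0) F" "(H \<longlongrightarrow> H0) F" "(d \<longlongrightarrow> d0) F"
  shows "((\<lambda>z. cscale (\<kappa> z) (G z ** \<omega> z ** H z + G z ** d z)) \<longlongrightarrow> G0 ** L ** H0) F"
proof -
  have "((\<lambda>z. G z ** cscale (\<kappa> z) (\<omega> z) ** H z + cscale (\<kappa> z) (G z ** d z)) \<longlongrightarrow> G0 ** L ** H0 + cscale 0 (G0 ** d0)) F"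
    by (intro tendsto_add tendsto_matrix_mult tendsto_cscale assms)
  then show ?thesis by (simp add: cscale_0 matrix_ring)
qed

text \<open>Collects the hypotheses with \<open>r\<close> in its normal form and with the extension
  \<open>E\<close> recorded on constant sections, from which connection forms are read off.\<close>

locale dressing = bundle_form \<A> \<tau> V g q
  for \<A> :: "'m::{t2_space,second_countable_topology} chart set" and \<tau> :: "'n::finite" and V g q +
  fixes r :: "complex \<Rightarrow> 'm \<Rightarrow> complex^'n^'n" and D :: "complex set"
    and Q :: "complex poly" and X :: "nat \<Rightarrow> 'm \<Rightarrow> complex^'n^'n" and E :: "complex \<Rightarrow> ('m, 'n) conn"
  assumes harmonic: "constrained_harmonic \<A> g \<tau> V q"
    and Q: "Q \<noteq> 0" and D_eq: "D = {z. poly Q z \<noteq> 0}"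
    and X: "\<And>c k. c \<in> \<A> \<Longrightarrow> chart_smooth c (X k)"
    and r_eq: "\<And>z p. z \<in> D \<Longrightarrow> r z p = rational_matrix Q (\<lambda>k. X k p) z"
    and orth: "\<And>z. z \<in> D \<Longrightarrow> orthogonal_section \<A> \<tau> (r z)"
    and D0: "0 \<in> D" and D1: "1 \<in> D"
    and inf: "holomorphic_at_inf r"
    and twist: "twisted \<tau> V r D"
    and E_hol: "\<And>c p u w i. c \<in> \<A> \<Longrightarrow> p \<in> chart_dom c \<Longrightarrow> (\<lambda>z. E z (\<lambda>_. w) c p u $ i) holomorphic_on - {0}"
    and E_eq: "\<And>c p u w z. c \<in> \<A> \<Longrightarrow> p \<in> chart_dom c \<Longrightarrow> z \<in> D \<Longrightarrow> z \<noteq> 0 \<Longrightarrow>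
      E z (\<lambda>_. w) c p u = gauge_conn (r z) (d_lambda g \<tau> V q z) (\<lambda>_. w) c p u"
begin

abbreviation r_inf :: "'m \<Rightarrow> complex^'n^'n" where "r_inf \<equiv> at_inf r"

definition T :: "'m \<Rightarrow> complex^'n^'n" where "T p = r 1 p"
definition S :: "'m \<Rightarrow> complex^'n^'n" where "S p = madj \<tau> (r 1 p)"

lemma isometry_r: "z \<in> D \<Longrightarrow> isometry \<tau> (r z p)"
  by (rule orthogonal_section_isometry[OF orth])

lemma chart_smooth_r: "c \<in> \<A> \<Longrightarrow> z \<in> D \<Longrightarrow> chart_smooth c (r z)"
  using orth[of z] by (auto simp: orthogonal_section_def smooth_map_iff)

lemma chart_smooth_madj: "c \<in> \<A> \<Longrightarrow> chart_smooth c R \<Longrightarrow> chart_smooth c (\<lambda>p. madj \<tau> (R p))"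
  by (rule surface_chart.chart_smooth_linear[OF surface_chart_atlas[OF atlas] bounded_linear_madj])

section \<open>The values of \<open>r\<close> at 0 and at infinity\<close>

lemma eventually_D_inf: "\<forall>\<^sub>F z in at_infinity. z \<in> D \<and> z \<noteq> 0"
proof -
  have "\<forall>\<^sub>F z :: complex in at_infinity. z \<noteq> 0"
    unfolding eventually_at_infinity by (intro exI[of _ 1]) auto
  with eventually_poly_nonzero_at_infinity[OF Q] show ?thesis
    by eventually_elim (simp add: D_eq)
qed

lemma eventually_D_0: "\<forall>\<^sub>F z in at 0. z \<in> D \<and> z \<noteq> 0"
proof -
  have "(poly Q \<longlongrightarrow> poly Q 0) (at 0)" using poly_isCont[of 0 Q] by (simp only: isCont_def)
  then have "\<forall>\<^sub>F z in at 0. poly Q z \<noteq> 0"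
    by (rule tendsto_imp_eventually_ne) (use D0 D_eq in simp)
  moreover have "\<forall>\<^sub>F z in at 0. z \<noteq> (0::complex)" by (simp add: eventually_at_filter)
  ultimately show ?thesis by eventually_elim (simp add: D_eq)
qed

lemma r_at_0: "((\<lambda>z. r z p) \<longlongrightarrow> r 0 p) (at 0)"
proof (rule Lim_transform_eventually)
  show "(rational_matrix Q (\<lambda>k. X k p) \<longlongrightarrow> r 0 p) (at 0)"
    unfolding r_eq[OF D0] by (rule rational_matrix_at_0) (use D0 D_eq in simp)
  show "\<forall>\<^sub>F z in at 0. rational_matrix Q (\<lambda>k. X k p) z = r z p"
    using eventually_D_0 by eventually_elim (simp add: r_eq)
qed

lemma r_at_inf: "((\<lambda>z. r z p) \<longlongrightarrow> r_inf p) at_infinity"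
  by (rule holomorphic_at_inf_tendsto[OF inf])

lemma r_inf_eq: "r_inf p = cscale (inverse (lead_coeff Q)) (X (degree Q) p)"
proof (rule tendsto_unique[OF trivial_limit_at_infinity r_at_inf])
  show "((\<lambda>z. r z p) \<longlongrightarrow> cscale (inverse (lead_coeff Q)) (X (degree Q) p)) at_infinity"
    using rational_matrix_at_infinity[OF Q, of "\<lambda>k. X k p"]
    by (rule Lim_transform_eventually) (use eventually_D_inf in eventually_elim, simp add: r_eq)
qed

lemma chart_smooth_r_inf: "c \<in> \<A> \<Longrightarrow> chart_smooth c r_inf"
  unfolding r_inf_eq[abs_def] by (rule surface_chart.chart_smooth_cscale[OF surface_chart_atlas[OF atlas] X])

lemmas tendsto_madj = bounded_linear.tendsto[OF bounded_linear_madj]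

lemma isometry_r_inf: "isometry \<tau> (r_inf p)"
proof (rule isometry_of_left_inverse, rule tendsto_unique[OF trivial_limit_at_infinity])
  show "((\<lambda>z. madj \<tau> (r z p) ** r z p) \<longlongrightarrow> madj \<tau> (r_inf p) ** r_inf p) at_infinity"
    by (intro tendsto_matrix_mult tendsto_madj r_at_inf)
  show "((\<lambda>z. madj \<tau> (r z p) ** r z p) \<longlongrightarrow> mat 1) at_infinity"
    by (rule Lim_transform_eventually[OF tendsto_const])
      (use eventually_D_inf in eventually_elim, simp add: madj_mult_isometry isometry_r)
qed

lemma twist_eq: "z \<in> D \<Longrightarrow> \<rho> p ** r z p ** \<rho> p = r (- z) p" and minus_D: "z \<in> D \<Longrightarrow> - z \<in> D"
  using twist by (auto simp: twisted_def reflection_eq matrix_inv_unique[OF \<rho>_square])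

text \<open>Since \<open>- z\<close> tends to infinity along with \<open>z\<close>, the twisting
  condition passes to the limit: \<open>r_inf\<close> commutes with the reflection, as
  \<open>r 0\<close> does because \<open>- 0 = 0\<close>.\<close>

lemma twist_inf: "\<rho> p ** r_inf p ** \<rho> p = r_inf p"
proof (rule tendsto_unique[OF trivial_limit_at_infinity])
  show "((\<lambda>z. \<rho> p ** r z p ** \<rho> p) \<longlongrightarrow> \<rho> p ** r_inf p ** \<rho> p) at_infinity"
    by (intro tendsto_matrix_mult tendsto_const r_at_inf)
  have "filterlim (\<lambda>z :: complex. - z) at_infinity at_infinity"
    using filterlim_ident[of at_infinity] by (simp add: filterlim_at_infinity_conv_norm_at_top)
  then have "((\<lambda>z. r (- z) p) \<longlongrightarrow> r_inf p) at_infinity" by (rule filterlim_compose[OF r_at_inf])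
  then show "((\<lambda>z. \<rho> p ** r z p ** \<rho> p) \<longlongrightarrow> r_inf p) at_infinity"
    by (rule Lim_transform_eventually) (use eventually_D_inf in eventually_elim, simp add: twist_eq)
qed

lemma preserves_V:
  assumes R: "isometry \<tau> R" and comm: "\<rho> p ** R ** \<rho> p = R"
  shows "(*v) R ` V p = V p"
proof -
  have "R ** \<rho> p = (\<rho> p ** R ** \<rho> p) ** \<rho> p" by (simp only: comm)
  also have "\<dots> = \<rho> p ** R" by (simp add: matrix_mul_assoc[symmetric] \<rho>_square)
  finally have "2 *\<^sub>R (R ** P p) = 2 *\<^sub>R (P p ** R)"
    by (simp only: \<rho>_def matrix_ring matrix_mul_lid matrix_mul_rid scaleR_2) simp
  then have RP: "R ** P p = P p ** R" by simp
  note mem = np_mem_iff[OF nondeg_proj_P]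
  have 1: "R *v v \<in> V p" if "v \<in> V p" for v
    using that by (simp only: mem matrix_vector_mul_assoc RP[symmetric]) (simp add: matrix_vector_mul_assoc[symmetric])
  have 2: "madj \<tau> R *v v \<in> V p" if "v \<in> V p" for v
  proof -
    have "P p ** madj \<tau> R = madj \<tau> R ** R ** P p ** madj \<tau> R" by (simp add: madj_mult_isometry[OF R])
    also have "\<dots> = madj \<tau> R ** P p ** (R ** madj \<tau> R)" by (simp only: matrix_mul_assoc[symmetric] RP)
    finally have "P p ** madj \<tau> R = madj \<tau> R ** P p" by (simp add: madj_mult_isometry[OF R])
    then show ?thesis
      using that by (simp only: mem matrix_vector_mul_assoc) (simp add: matrix_vector_mul_assoc[symmetric])
  qed
  have 3: "v = R *v (madj \<tau> R *v v)" for v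
    by (simp add: matrix_vector_mul_assoc madj_mult_isometry[OF R])
  show ?thesis using 1 2 3 by blast
qed

lemma ST: "S p ** T p = mat 1" and TS: "T p ** S p = mat 1"
  by (simp_all add: S_def T_def madj_mult_isometry[OF isometry_r[OF D1]])

lemma isometry_S: "isometry \<tau> (S p)"
  by (simp add: S_def isometry_madj isometry_r D1)

lemma chart_smooth_T: "c \<in> \<A> \<Longrightarrow> chart_smooth c T"
  unfolding T_def[abs_def] by (rule chart_smooth_r[OF _ D1])

lemma chart_smooth_S: "c \<in> \<A> \<Longrightarrow> chart_smooth c S"
  unfolding S_def[abs_def] by (intro chart_smooth_madj chart_smooth_r D1)

lemma matrix_inv_r: "z \<in> D \<Longrightarrow> matrix_inv (r z p) = madj \<tau> (r z p)"
  by (rule matrix_inv_isometry[OF isometry_r])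

lemma matrix_inv_S: "matrix_inv (S p) = T p"
  by (rule matrix_inv_unique[OF TS])

section \<open>The dressed bundle and the dressed form\<close>

definition W :: "'m \<Rightarrow> (complex^'n) set" where "W p = (*v) (S p) ` V p"

definition qt :: "('m, complex^'n^'n) form1" where "qt = Ad_form S (dressed_form g r q)"

lemma qt_eq: "qt c p u = S p ** (r 0 p ** q10 c p u ** madj \<tau> (r 0 p)) ** T p
    + S p ** (r_inf p ** q01 c p u ** madj \<tau> (r_inf p)) ** T p"
  by (simp add: qt_def Ad_form_def dressed_form_def matrix_inv_S matrix_inv_r[OF D0]
      matrix_inv_isometry[OF isometry_r_inf] matrix_ring)

lemma q_smooth: "smooth_form1 \<A> q"
  using split by (simp add: split_form1_def)

lemma parts_qt:
  assumes c: "c \<in> \<A>" "p \<in> chart_dom c"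
  shows "part10 g qt c p u = S p ** (r 0 p ** q10 c p u ** madj \<tau> (r 0 p)) ** T p"
    and "part01 g qt c p u = S p ** (r_inf p ** q01 c p u ** madj \<tau> (r_inf p)) ** T p"
  by (rule part10_eqI[OF c(1) qt_eq], simp add: qt_eq part10_J[OF c(1) q_form[OF c(1)] c(2)]
      part01_J[OF c(1) q_form[OF c(1)] c(2)] matrix_ring)+

text \<open>The dressed form is split because \<open>r 0\<close> and \<open>r_inf\<close> are
  isometries preserving \<open>V\<close>, by twisting, and \<open>S\<close> carries \<open>V\<close>
  to \<open>W\<close>.\<close>

lemma bundle_W: "bundle_form \<A> \<tau> W g qt"
proof -
  have "nondeg_bundle \<A> \<tau> W"
    unfolding W_def[abs_def]
    by (rule transport_bundle) (auto simp: smooth_map_iff chart_smooth_S isometry_S)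
  moreover have "split_form1 \<A> \<tau> W qt"
    unfolding split_form1_def
  proof (intro conjI ballI allI)
    show "smooth_form1 \<A> qt"
    proof (rule smooth_form1_intro)
      fix c assume c: "c \<in> \<A>"
      interpret surface_chart c by (rule surface_chart_atlas[OF atlas c])
      show "chart_form c qt"
        unfolding qt_eq[abs_def]
        by (intro chart_form_add chart_form_matrix_mult parts_form c chart_smooth_S chart_smooth_T chart_smooth_r D0
            chart_smooth_madj chart_smooth_r_inf)
    next
      fix c c' p u assume "c \<in> \<A>" "c' \<in> \<A>" "p \<in> chart_dom c" "p \<in> chart_dom c'"
      from part_transition[OF q_smooth this, of u]
      show "qt c p u = qt c' p (extd (chart_map c') c p u)" by (simp only: qt_eq)
    qed
    fix c p u assume c: "c \<in> \<A>" "p \<in> chart_dom c"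
    note sub = np_subspace[OF nondeg_proj_P]
    have q: "q c p u \<in> split_endos \<tau> (V p)" for u
      using split c by (auto simp: split_form1_def)
    have "q10 c p u = cscale (1/2) (q c p u + cscale (- \<i>) (q c p (rotJ g c p u)))"
      "q01 c p u = cscale (1/2) (q c p u + cscale \<i> (q c p (rotJ g c p u)))"
      by (simp_all add: part10_def part01_def vec_eq_iff cscale_nth)
    then have parts: "q10 c p u \<in> split_endos \<tau> (V p)" "q01 c p u \<in> split_endos \<tau> (V p)"
      by (simp_all only: split_endos_cscale[OF _ sub] split_endos_add q)
    have conj: "S p ** (R ** A ** madj \<tau> R) ** T p \<in> split_endos \<tau> (W p)"
      if "A \<in> split_endos \<tau> (V p)" "isometry \<tau> R" "\<rho> p ** R ** \<rho> p = R" for A R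
    proof -
      have "R ** A ** madj \<tau> R \<in> split_endos \<tau> (V p)"
        using split_endos_isometry[OF that(1,2)] preserves_V[OF that(2,3)] by simp
      from split_endos_isometry[OF this isometry_S[of p]] show ?thesis
        by (simp add: W_def) (simp add: S_def T_def madj_madj)
    qed
    show "qt c p u \<in> split_endos \<tau> (W p)"
      unfolding qt_eq using twist_eq[OF D0]
      by (intro split_endos_add conj parts isometry_r D0 isometry_r_inf twist_inf) simp
  qed
  ultimately show ?thesis
    by (rule bundle_form.intro[OF _ surface_metric_axioms bundle_form_axioms.intro])
qed

section \<open>The gauge and the gauged connection form\<close>

definition G :: "complex \<Rightarrow> 'm \<Rightarrow> complex^'n^'n" where "G z p = S p ** r z p"
definition H :: "complex \<Rightarrow> 'm \<Rightarrow> complex^'n^'n" where "H z p = madj \<tau> (r z p) ** T p"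

lemma GH: "z \<in> D \<Longrightarrow> G z p ** H z p = mat 1"
proof -
  assume z: "z \<in> D"
  have "G z p ** H z p = S p ** (r z p ** madj \<tau> (r z p)) ** T p"
    by (simp only: G_def H_def matrix_mul_assoc)
  then show ?thesis by (simp add: madj_mult_isometry[OF isometry_r[OF z]] ST)
qed

text \<open>Defined through \<open>E\<close>, hence meaningful for every nonzero \<open>z\<close>,
  also at poles of \<open>r\<close>; on \<open>D\<close> it is the gauge transform of
  \<open>alpha\<close>, by \<open>beta_eq\<close>. Conjugating by \<open>S\<close> normalises the
  family to be \<open>d\<close> at \<open>z = 1\<close>.\<close>

definition beta :: "complex \<Rightarrow> ('m, complex^'n^'n) form1" where
  "beta z c p u = S p ** matrix (\<lambda>w. E z (\<lambda>_. w) c p u) ** T p + S p ** extd T c p u"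

context
  fixes c assumes c: "c \<in> \<A>"
begin

interpretation surface_chart c by (rule surface_chart_atlas[OF atlas c])

lemma smooth_GH: "z \<in> D \<Longrightarrow> chart_smooth c (G z)" "z \<in> D \<Longrightarrow> chart_smooth c (H z)"
  unfolding G_def[abs_def] H_def[abs_def]
  by (intro chart_smooth_matrix_mult chart_smooth_madj chart_smooth_S chart_smooth_T chart_smooth_r c, assumption)+

context
  fixes p assumes p: "p \<in> chart_dom c"
begin

lemma extd_H:
  assumes z: "z \<in> D"
  shows "extd (H z) c p u = extd (\<lambda>x. madj \<tau> (r z x)) c p u ** T p + madj \<tau> (r z p) ** extd T c p u"
  unfolding H_def[abs_def]
  by (rule extd_matrix_mult[OF chart_smooth_madj[OF c chart_smooth_r[OF c z]] chart_smooth_T[OF c] p])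

lemma beta_eq:
  assumes z: "z \<in> D" "z \<noteq> 0"
  shows "beta z c p u = G z p ** alpha z c p u ** H z p + G z p ** extd (H z) c p u"
proof -
  let ?m = "\<lambda>x. madj \<tau> (r z x)"
  have m: "chart_smooth c ?m" by (intro chart_smooth_madj chart_smooth_r c z)
  have mw: "chart_smooth c (\<lambda>x. ?m x *v w)" for w
    by (intro chart_smooth_matrix_vec m chart_smooth_const)
  have "E z (\<lambda>_. w) c p u = (r z p ** extd ?m c p u + r z p ** alpha z c p u ** ?m p) *v w" for w
    using extd_matrix_vec[OF m chart_smooth_const p, of w u]
    by (simp add: E_eq[OF c p z] gauge_conn_def matrix_inv_r[OF z(1)] d_lambda_eq[OF c mw p] extd_const
        matrix_vector_right_distrib matrix_vector_mult_add_rdistrib matrix_vector_mul_assoc matrix_mul_assoc)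
  then have "beta z c p u = S p ** (r z p ** extd ?m c p u + r z p ** alpha z c p u ** ?m p) ** T p + S p ** extd T c p u"
    by (simp add: beta_def)
  also have "S p ** extd T c p u = S p ** (r z p ** ?m p) ** extd T c p u"
    by (simp add: madj_mult_isometry[OF isometry_r[OF z(1)]])
  finally show ?thesis by (simp add: extd_H[OF z(1)] G_def H_def matrix_ring)
qed

lemma beta_holomorphic: "(\<lambda>z. beta z c p u $ i $ j) holomorphic_on - {0}"
proof -
  have E: "(\<lambda>z. matrix (\<lambda>w. E z (\<lambda>_. w) c p u) $ i $ j) holomorphic_on - {0}" for i j
    using E_hol[OF c p] by (simp add: matrix_def)
  show ?thesis
    unfolding beta_def vector_add_component matrix_matrix_mult_def vec_lambda_beta
    by (intro holomorphic_intros E)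
qed

text \<open>The derivative along the surface passes through the finite sum over \<open>k\<close>, so
  it is again rational in \<open>z\<close> over \<open>Q\<close>; this is why its limits at 0 and
  infinity exist.\<close>

lemma extd_madj_r:
  assumes z: "z \<in> D"
  shows "extd (\<lambda>x. madj \<tau> (r z x)) c p u = rational_matrix Q (\<lambda>k. extd (\<lambda>x. madj \<tau> (X k x)) c p u) z"
proof -
  have "(\<lambda>x. madj \<tau> (r z x)) = (\<lambda>x. \<Sum>k\<le>degree Q. cscale (z ^ k * inverse (poly Q z)) (madj \<tau> (X k x)))"
    by (simp add: r_eq[OF z] rational_matrix_def linear_sum[OF bounded_linear.linear[OF bounded_linear_madj]] madj_cscale)
  then show ?thesis
    by (simp add: extd_sum extd_cscale chart_smooth_cscale chart_smooth_madj X c p rational_matrix_def)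
qed

text \<open>The gauge, its inverse and the derivative of the inverse are regular at 0, so gauging
  creates no poles there.\<close>

lemma limits_0:
  "((\<lambda>z. G z p) \<longlongrightarrow> S p ** r 0 p) (at 0)" "((\<lambda>z. H z p) \<longlongrightarrow> madj \<tau> (r 0 p) ** T p) (at 0)"
  "\<exists>L. ((\<lambda>z. extd (H z) c p u) \<longlongrightarrow> L) (at 0)"
proof -
  show "((\<lambda>z. G z p) \<longlongrightarrow> S p ** r 0 p) (at 0)" "((\<lambda>z. H z p) \<longlongrightarrow> madj \<tau> (r 0 p) ** T p) (at 0)"
    unfolding G_def H_def by (intro tendsto_matrix_mult tendsto_madj tendsto_const r_at_0)+
  let ?R = "rational_matrix Q (\<lambda>k. extd (\<lambda>x. madj \<tau> (X k x)) c p u)"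
  have "((\<lambda>z. ?R z ** T p + madj \<tau> (r z p) ** extd T c p u)
      \<longlongrightarrow> ?R 0 ** T p + madj \<tau> (r 0 p) ** extd T c p u) (at 0)"
    using D0 D_eq
    by (intro tendsto_add tendsto_matrix_mult tendsto_madj tendsto_const r_at_0 rational_matrix_at_0) simp
  then have "((\<lambda>z. extd (H z) c p u) \<longlongrightarrow> ?R 0 ** T p + madj \<tau> (r 0 p) ** extd T c p u) (at 0)"
    by (rule Lim_transform_eventually)
      (use eventually_D_0 in eventually_elim, simp add: extd_H extd_madj_r)
  then show "\<exists>L. ((\<lambda>z. extd (H z) c p u) \<longlongrightarrow> L) (at 0)" by blast
qed

lemma limits_inf:
  "((\<lambda>z. G z p) \<longlongrightarrow> S p ** r_inf p) at_infinity" "((\<lambda>z. H z p) \<longlongrightarrow> madj \<tau> (r_inf p) ** T p) at_infinity"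
  "\<exists>L. ((\<lambda>z. extd (H z) c p u) \<longlongrightarrow> L) at_infinity"
proof -
  show "((\<lambda>z. G z p) \<longlongrightarrow> S p ** r_inf p) at_infinity" "((\<lambda>z. H z p) \<longlongrightarrow> madj \<tau> (r_inf p) ** T p) at_infinity"
    unfolding G_def H_def by (intro tendsto_matrix_mult tendsto_madj tendsto_const r_at_inf)+
  let ?X = "\<lambda>k. extd (\<lambda>x. madj \<tau> (X k x)) c p u"
  have "((\<lambda>z. rational_matrix Q ?X z ** T p + madj \<tau> (r z p) ** extd T c p u)
      \<longlongrightarrow> cscale (inverse (lead_coeff Q)) (?X (degree Q)) ** T p + madj \<tau> (r_inf p) ** extd T c p u) at_infinity"
    by (intro tendsto_add tendsto_matrix_mult tendsto_madj tendsto_const r_at_inf rational_matrix_at_infinity Q)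
  then have "((\<lambda>z. extd (H z) c p u)
      \<longlongrightarrow> cscale (inverse (lead_coeff Q)) (?X (degree Q)) ** T p + madj \<tau> (r_inf p) ** extd T c p u) at_infinity"
    by (rule Lim_transform_eventually)
      (use eventually_D_inf in eventually_elim, simp add: extd_H extd_madj_r)
  then show "\<exists>L. ((\<lambda>z. extd (H z) c p u) \<longlongrightarrow> L) at_infinity" by blast
qed

text \<open>After rescaling, \<open>alpha\<close> is polynomial in \<open>z\<close>, respectively in
  \<open>inverse z\<close>, so its limits at 0 and at infinity are evaluations.\<close>

lemma alpha_scaled:
  assumes "z \<noteq> 0"
  shows "cscale (z\<^sup>2) (alpha z c p u) = cscale (z\<^sup>2) (a c p u) + cscale z (N10 c p u) + cscale (z ^ 3) (N01 c p u)
      + cscale (1 - z\<^sup>2) (q10 c p u) + cscale (z\<^sup>2 * (z\<^sup>2 - 1)) (q01 c p u)"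
    and "cscale (inverse (z\<^sup>2)) (alpha z c p u) = cscale ((inverse z)\<^sup>2) (a c p u)
      + cscale ((inverse z) ^ 3) (N10 c p u) + cscale (inverse z) (N01 c p u)
      + cscale ((inverse z)\<^sup>2 * ((inverse z)\<^sup>2 - 1)) (q10 c p u) + cscale (1 - (inverse z)\<^sup>2) (q01 c p u)"
proof -
  have "z\<^sup>2 * inverse z = z" "z\<^sup>2 * z = z ^ 3" "z\<^sup>2 * (inverse (z\<^sup>2) - 1) = 1 - z\<^sup>2"
    "inverse (z\<^sup>2) * inverse z = (inverse z) ^ 3" "inverse (z\<^sup>2) * z = inverse z"
    "inverse (z\<^sup>2) * (z\<^sup>2 - 1) = 1 - (inverse z)\<^sup>2"
    using assms by (simp_all add: power2_eq_square power3_eq_cube field_simps)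
  then show "cscale (z\<^sup>2) (alpha z c p u) = cscale (z\<^sup>2) (a c p u) + cscale z (N10 c p u) + cscale (z ^ 3) (N01 c p u)
      + cscale (1 - z\<^sup>2) (q10 c p u) + cscale (z\<^sup>2 * (z\<^sup>2 - 1)) (q01 c p u)"
    "cscale (inverse (z\<^sup>2)) (alpha z c p u) = cscale ((inverse z)\<^sup>2) (a c p u)
      + cscale ((inverse z) ^ 3) (N10 c p u) + cscale (inverse z) (N01 c p u)
      + cscale ((inverse z)\<^sup>2 * ((inverse z)\<^sup>2 - 1)) (q10 c p u) + cscale (1 - (inverse z)\<^sup>2) (q01 c p u)"
    by (simp_all only: alpha_def cscale_add cscale_cscale) (simp add: power_inverse)
qed

lemma beta_laurent:
  obtains C1 C2 C3 where "\<And>z. z \<noteq> 0 \<Longrightarrow>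
    beta z c p u = cscale (inverse (z\<^sup>2)) (part10 g qt c p u) + cscale (inverse z) C1 + C2 + cscale z C3
      + cscale (z\<^sup>2) (part01 g qt c p u)"
proof (rule laurent_polynomial_matrix[OF beta_holomorphic])
  obtain L where L: "((\<lambda>z. extd (H z) c p u) \<longlongrightarrow> L) (at 0)" using limits_0(3) by blast
  have "((\<lambda>z. cscale (z\<^sup>2) (a c p u) + cscale z (N10 c p u) + cscale (z ^ 3) (N01 c p u)
      + cscale (1 - z\<^sup>2) (q10 c p u) + cscale (z\<^sup>2 * (z\<^sup>2 - 1)) (q01 c p u)) \<longlongrightarrow>
      cscale (0\<^sup>2) (a c p u) + cscale 0 (N10 c p u) + cscale (0 ^ 3) (N01 c p u)
      + cscale (1 - 0\<^sup>2) (q10 c p u) + cscale (0\<^sup>2 * (0\<^sup>2 - 1)) (q01 c p u)) (at 0)"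
    by (intro tendsto_add tendsto_cscale tendsto_intros)
  then have "((\<lambda>z. cscale (z\<^sup>2) (alpha z c p u)) \<longlongrightarrow>
      cscale (0\<^sup>2) (a c p u) + cscale 0 (N10 c p u) + cscale (0 ^ 3) (N01 c p u)
      + cscale (1 - 0\<^sup>2) (q10 c p u) + cscale (0\<^sup>2 * (0\<^sup>2 - 1)) (q01 c p u)) (at 0)"
    by (rule Lim_transform_eventually)
      (use eventually_D_0 in eventually_elim, rule alpha_scaled(1)[symmetric], simp)
  then have \<alpha>: "((\<lambda>z. cscale (z\<^sup>2) (alpha z c p u)) \<longlongrightarrow> q10 c p u) (at 0)"
    by (simp add: cscale_0 cscale_1)
  have "((\<lambda>z :: complex. z\<^sup>2) \<longlongrightarrow> 0\<^sup>2) (at 0)" by (intro tendsto_intros)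
  then have "((\<lambda>z. cscale (z\<^sup>2) (G z p ** alpha z c p u ** H z p + G z p ** extd (H z) c p u))
      \<longlongrightarrow> S p ** r 0 p ** q10 c p u ** (madj \<tau> (r 0 p) ** T p)) (at 0)"
    by (intro dressing_limit[OF _ \<alpha> limits_0(1,2) L]) simp
  then show "((\<lambda>z. cscale (z\<^sup>2) (beta z c p u)) \<longlongrightarrow> part10 g qt c p u) (at 0)"
    unfolding parts_qt[OF c p] by (rule Lim_transform_eventually[THEN tendsto_eq_rhs])
      (use eventually_D_0 in eventually_elim, simp add: beta_eq, simp add: matrix_ring)
next
  obtain L where L: "((\<lambda>z. extd (H z) c p u) \<longlongrightarrow> L) at_infinity" using limits_inf(3) by blast
  note inv = tendsto_inverse_0[where ?'a = complex]
  have "((\<lambda>z. cscale ((inverse z)\<^sup>2) (a c p u) + cscale ((inverse z) ^ 3) (N10 c p u) + cscale (inverse z) (N01 c p u)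
      + cscale ((inverse z)\<^sup>2 * ((inverse z)\<^sup>2 - 1)) (q10 c p u) + cscale (1 - (inverse z)\<^sup>2) (q01 c p u)) \<longlongrightarrow>
      cscale (0\<^sup>2) (a c p u) + cscale (0 ^ 3) (N10 c p u) + cscale 0 (N01 c p u)
      + cscale (0\<^sup>2 * (0\<^sup>2 - 1)) (q10 c p u) + cscale (1 - 0\<^sup>2) (q01 c p u)) at_infinity"
    by (intro tendsto_add tendsto_cscale tendsto_intros inv)
  then have "((\<lambda>z. cscale (inverse (z\<^sup>2)) (alpha z c p u)) \<longlongrightarrow>
      cscale (0\<^sup>2) (a c p u) + cscale (0 ^ 3) (N10 c p u) + cscale 0 (N01 c p u)
      + cscale (0\<^sup>2 * (0\<^sup>2 - 1)) (q10 c p u) + cscale (1 - 0\<^sup>2) (q01 c p u)) at_infinity"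
    by (rule Lim_transform_eventually)
      (use eventually_D_inf in eventually_elim, rule alpha_scaled(2)[symmetric], simp)
  then have \<alpha>: "((\<lambda>z. cscale (inverse (z\<^sup>2)) (alpha z c p u)) \<longlongrightarrow> q01 c p u) at_infinity"
    by (simp add: cscale_0 cscale_1)
  have "((\<lambda>z :: complex. (inverse z)\<^sup>2) \<longlongrightarrow> 0\<^sup>2) at_infinity" by (intro tendsto_intros inv)
  then have "((\<lambda>z. cscale (inverse (z\<^sup>2)) (G z p ** alpha z c p u ** H z p + G z p ** extd (H z) c p u))
      \<longlongrightarrow> S p ** r_inf p ** q01 c p u ** (madj \<tau> (r_inf p) ** T p)) at_infinity"
    by (intro dressing_limit[OF _ \<alpha> limits_inf(1,2) L]) (simp add: power_inverse)
  then show "((\<lambda>z. cscale (inverse (z\<^sup>2)) (beta z c p u)) \<longlongrightarrow> part01 g qt c p u) at_infinity"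
    unfolding parts_qt[OF c p] by (rule Lim_transform_eventually[THEN tendsto_eq_rhs])
      (use eventually_D_inf in eventually_elim, simp add: beta_eq, simp add: matrix_ring)
qed (rule that, blast)

text \<open>Forces the coefficient of \<open>inverse z\<close> to have type (1,0). Composing
  \<open>alpha\<close> with \<open>J\<close> and subtracting \<open>\<i>\<close> times
  \<open>alpha\<close> cancels the (1,0)-parts of \<open>N\<close> and \<open>q\<close>, which carry
  the whole pole at 0; conjugation respects this combination and the gauge term is regular.\<close>

lemma beta_J_at_0:
  "((\<lambda>z. cscale z (beta z c p (rotJ g c p u) - cscale \<i> (beta z c p u))) \<longlongrightarrow> 0) (at 0)"
proof -
  let ?v = "rotJ g c p u"
  obtain L M where L: "((\<lambda>z. extd (H z) c p u) \<longlongrightarrow> L) (at 0)" and M: "((\<lambda>z. extd (H z) c p ?v) \<longlongrightarrow> M) (at 0)"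
    using limits_0(3) by meson
  let ?K = "a c p ?v - cscale \<i> (a c p u)"
  have J: "alpha z c p ?v - cscale \<i> (alpha z c p u)
      = ?K + cscale z (cscale (- 2 * \<i>) (N01 c p u)) + cscale (z\<^sup>2 - 1) (cscale (- 2 * \<i>) (q01 c p u))" for z
    by (simp add: alpha_def J_parts[OF c p] vec_eq_iff cscale_nth algebra_simps)
  have "((\<lambda>z. cscale z (?K + cscale z (cscale (- 2 * \<i>) (N01 c p u)) + cscale (z\<^sup>2 - 1) (cscale (- 2 * \<i>) (q01 c p u)))) \<longlongrightarrow>
     cscale 0 (?K + cscale 0 (cscale (- 2 * \<i>) (N01 c p u)) + cscale (0\<^sup>2 - 1) (cscale (- 2 * \<i>) (q01 c p u)))) (at 0)"
    by (intro tendsto_add tendsto_cscale tendsto_intros)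
  then have \<alpha>: "((\<lambda>z. cscale z (alpha z c p ?v - cscale \<i> (alpha z c p u))) \<longlongrightarrow> 0) (at 0)"
    unfolding J by (simp only: cscale_0)
  have "((\<lambda>z. cscale z (G z p ** (alpha z c p ?v - cscale \<i> (alpha z c p u)) ** H z p
      + G z p ** (extd (H z) c p ?v - cscale \<i> (extd (H z) c p u))))
     \<longlongrightarrow> S p ** r 0 p ** 0 ** (madj \<tau> (r 0 p) ** T p)) (at 0)"
    by (rule dressing_limit[OF tendsto_ident_at \<alpha> limits_0(1,2) tendsto_diff[OF M tendsto_cscale[OF tendsto_const L]]])
  then show ?thesis
    by (rule Lim_transform_eventually[THEN tendsto_eq_rhs])
      (use eventually_D_0 in eventually_elim, simp add: beta_eq matrix_ring algebra_simps, simp add: matrix_ring)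
qed

text \<open>The mirror image: growth at infinity comes from the (0,1)-parts alone, which gives type
  (0,1) for the coefficient of \<open>z\<close>.\<close>

lemma beta_J_at_inf:
  "((\<lambda>z. cscale (inverse z) (beta z c p (rotJ g c p u) + cscale \<i> (beta z c p u))) \<longlongrightarrow> 0) at_infinity"
proof -
  let ?v = "rotJ g c p u"
  note inv = tendsto_inverse_0[where ?'a = complex]
  obtain L M where L: "((\<lambda>z. extd (H z) c p u) \<longlongrightarrow> L) at_infinity" and M: "((\<lambda>z. extd (H z) c p ?v) \<longlongrightarrow> M) at_infinity"
    using limits_inf(3) by meson
  let ?K = "a c p ?v + cscale \<i> (a c p u)"
  have J: "alpha z c p ?v + cscale \<i> (alpha z c p u)
      = ?K + cscale (inverse z) (cscale (2 * \<i>) (N10 c p u)) + cscale ((inverse z)\<^sup>2 - 1) (cscale (2 * \<i>) (q10 c p u))" for z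
    by (simp add: alpha_def J_parts[OF c p] vec_eq_iff cscale_nth algebra_simps power_inverse)
  have "((\<lambda>z. cscale (inverse z) (?K + cscale (inverse z) (cscale (2 * \<i>) (N10 c p u)) + cscale ((inverse z)\<^sup>2 - 1) (cscale (2 * \<i>) (q10 c p u)))) \<longlongrightarrow>
     cscale 0 (?K + cscale 0 (cscale (2 * \<i>) (N10 c p u)) + cscale (0\<^sup>2 - 1) (cscale (2 * \<i>) (q10 c p u)))) at_infinity"
    by (intro tendsto_add tendsto_cscale tendsto_intros inv)
  then have \<alpha>: "((\<lambda>z. cscale (inverse z) (alpha z c p ?v + cscale \<i> (alpha z c p u))) \<longlongrightarrow> 0) at_infinity"
    unfolding J by (simp only: cscale_0)
  have "((\<lambda>z. cscale (inverse z) (G z p ** (alpha z c p ?v + cscale \<i> (alpha z c p u)) ** H z p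
      + G z p ** (extd (H z) c p ?v + cscale \<i> (extd (H z) c p u))))
     \<longlongrightarrow> S p ** r_inf p ** 0 ** (madj \<tau> (r_inf p) ** T p)) at_infinity"
    by (rule dressing_limit[OF inv \<alpha> limits_inf(1,2) tendsto_add[OF M tendsto_cscale[OF tendsto_const L]]])
  then show ?thesis
    by (rule Lim_transform_eventually[THEN tendsto_eq_rhs])
      (use eventually_D_inf in eventually_elim, simp add: beta_eq matrix_ring algebra_simps, simp add: matrix_ring)
qed

end

end

end

text \<open>The hypotheses are the values at 1 and -1 of a Laurent polynomial with coefficients
  \<open>x\<close>, \<open>c1\<close>, \<open>c2\<close>, \<open>c3\<close>, \<open>y\<close>; half
  their difference is the odd part, and the middle coefficient remains.\<close>

lemma sum_and_alternating_sum:
  fixes a :: "'a::real_vector"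
  assumes 1: "x + c1 + c2 + c3 + y = 0" and 2: "x - c1 + c2 - c3 + y = a + a"
  shows "c1 + c3 = - a" "c2 = a - x - y"
proof -
  have "2 *\<^sub>R (c1 + c3) = (x + c1 + c2 + c3 + y) - (x - c1 + c2 - c3 + y)"
    by (simp add: scaleR_2)
  also have "\<dots> = 2 *\<^sub>R (- a)" unfolding 1 2 by (simp add: scaleR_2)
  finally show c: "c1 + c3 = - a" unfolding scaleR_cancel_left by simp
  have "c2 = (x + c1 + c2 + c3 + y) - (c1 + c3) - x - y" by simp
  then show "c2 = a - x - y" unfolding 1 c by simp
qed

section \<open>Identification of the gauged family with the family of the dressed bundle\<close>

context dressing
begin

interpretation B: bundle_form \<A> \<tau> W g qt by (rule bundle_W)

lemma reflection_W: "B.\<rho> p = S p ** \<rho> p ** T p"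
proof -
  have "nondeg_proj \<tau> (W p) (S p ** P p ** madj \<tau> (S p))"
    unfolding W_def by (rule nondeg_proj_isometry[OF nondeg_proj_P isometry_S])
  then have "B.P p = S p ** P p ** T p"
    unfolding B.P_def by (subst np_proj) (auto simp: S_def T_def madj_madj)
  then show ?thesis
    by (simp only: B.\<rho>_def \<rho>_def matrix_ring matrix_mul_lid matrix_mul_rid ST)
qed

context
  fixes c p assumes c: "c \<in> \<A>" and p: "p \<in> chart_dom c"
begin

interpretation surface_chart c by (rule surface_chart_atlas[OF atlas c])

lemma beta_1: "beta 1 c p u = 0"
proof -
  have H1: "H 1 = (\<lambda>_. mat 1)"
    by (rule ext) (simp add: H_def T_def madj_mult_isometry[OF isometry_r[OF D1]])
  have "alpha 1 c p u = 0"
    by (simp add: alpha_eq[OF c p] cscale_0)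
  then show ?thesis
    by (simp add: beta_eq[OF c p D1] H1 extd_const matrix_ring)
qed

text \<open>At -1 the original connection is \<open>\<rho> d \<rho>\<close> and, by twisting, the
  gauge is \<open>B.\<rho> \<rho>\<close>. The result is \<open>d\<close> conjugated by
  \<open>B.\<rho>\<close>, with form \<open>B.\<rho>\<close> times its own derivative.\<close>

lemma beta_minus_1: "beta (- 1) c p u = B.a c p u + B.a c p u"
proof -
  have D: "- 1 \<in> D" by (rule minus_D[OF D1])
  have r1: "r (- 1) x = \<rho> x ** T x ** \<rho> x" for x
    using twist_eq[OF D1, of x] by (simp add: T_def)
  have "(\<rho> x ** S x ** \<rho> x) ** (\<rho> x ** T x ** \<rho> x) = mat 1" for x
  proof -
    have "(\<rho> x ** S x ** \<rho> x) ** (\<rho> x ** T x ** \<rho> x) = \<rho> x ** S x ** (\<rho> x ** \<rho> x) ** T x ** \<rho> x"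
      by (simp only: matrix_mul_assoc)
    also have "\<dots> = \<rho> x ** (S x ** T x) ** \<rho> x" by (simp add: \<rho>_square matrix_mul_assoc)
    finally show ?thesis by (simp add: ST \<rho>_square)
  qed
  from matrix_inv_unique[OF this] have m1: "madj \<tau> (r (- 1) x) = \<rho> x ** S x ** \<rho> x" for x
    unfolding r1[symmetric] matrix_inv_r[OF D] .
  have H: "H (- 1) = (\<lambda>x. \<rho> x ** B.\<rho> x)"
    by (rule ext) (simp add: H_def m1 reflection_W matrix_mul_assoc)
  then have Hp: "H (- 1) p = \<rho> p ** B.\<rho> p" by simp
  have G: "G (- 1) p = B.\<rho> p ** \<rho> p"
    by (simp add: G_def r1 reflection_W matrix_mul_assoc)
  have al: "alpha (- 1) c p u = a c p u + a c p u"
    by (simp add: alpha_def a_eq[OF c p] vec_eq_iff cscale_nth)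
  have dH: "extd (H (- 1)) c p u = extd \<rho> c p u ** B.\<rho> p + \<rho> p ** extd B.\<rho> c p u"
    unfolding H by (rule extd_matrix_mult[OF chart_smooth_\<rho>[OF c] B.chart_smooth_\<rho>[OF c] p])
  let ?R = "B.\<rho> p"
  have "beta (- 1) c p u = ?R ** (\<rho> p ** (a c p u + a c p u) ** \<rho> p) ** ?R
      + ?R ** (\<rho> p ** extd \<rho> c p u) ** ?R + ?R ** (\<rho> p ** \<rho> p) ** extd B.\<rho> c p u"
    by (simp only: beta_eq[OF c p D] neg_equal_zero one_neq_zero neg_equal_0_iff_equal simp_thms al dH G Hp matrix_ring add.assoc)
  also have "\<rho> p ** (a c p u + a c p u) ** \<rho> p = - (a c p u + a c p u)"
    using \<rho>_a_\<rho>[OF c p, of u] by (simp only: matrix_add_ldistrib matrix_mult_add_left) simp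
  also have "\<rho> p ** extd \<rho> c p u = a c p u + a c p u" by (rule \<rho>_extd_\<rho>[OF c p])
  \<comment> \<open>The conjugated form of the old connection cancels against the derivative of the
    old reflection; only the derivative of the new reflection survives.\<close>
  also have "?R ** - (a c p u + a c p u) ** ?R + ?R ** (a c p u + a c p u) ** ?R + ?R ** (\<rho> p ** \<rho> p) ** extd B.\<rho> c p u
      = ?R ** extd B.\<rho> c p u"
    by (simp only: \<rho>_square matrix_mul_rid matrix_mult_minus_left matrix_mult_minus_right) simp
  also have "\<dots> = B.a c p u + B.a c p u" by (rule B.\<rho>_extd_\<rho>[OF c p])
  finally show ?thesis .
qed

text \<open>The Laurent coefficients of \<open>beta\<close> are read off from its type at \<open>0\<close> and \<open>\<infinity>\<close> and from its
  values at \<open>1\<close> and \<open>-1\<close>.\<close>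

lemma beta_eq_alpha:
  assumes z: "z \<noteq> 0"
  shows "beta z c p u = B.alpha z c p u"
proof -
  let ?v = "rotJ g c p u"
  let ?A = "\<lambda>u. part10 g qt c p u" and ?B = "\<lambda>u. part01 g qt c p u"
  obtain C1 C2 C3 where C: "\<And>z. z \<noteq> 0 \<Longrightarrow>
    beta z c p u = cscale (inverse (z\<^sup>2)) (?A u) + cscale (inverse z) C1 + C2 + cscale z C3 + cscale (z\<^sup>2) (?B u)"
    using beta_laurent[OF c p, of u] by blast
  \<comment> \<open>Primed coefficients belong to \<open>J u\<close>; comparing them with the
    unprimed ones determines types.\<close>
  obtain C1' C2' C3' where C': "\<And>z. z \<noteq> 0 \<Longrightarrow>
    beta z c p ?v = cscale (inverse (z\<^sup>2)) (?A ?v) + cscale (inverse z) C1' + C2' + cscale z C3' + cscale (z\<^sup>2) (?B ?v)"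
    using beta_laurent[OF c p, of ?v] by blast
  note J = B.part10_J[OF c B.q_form[OF c] p, of u] B.part01_J[OF c B.q_form[OF c] p, of u]
  \<comment> \<open>The combination of \<open>beta_J_at_0\<close> computed from the two expansions.
    The order -2 terms have dropped out because \<open>?A\<close> has type (1,0), so the limit at 0
    is \<open>C1' - \<i> C1\<close>.\<close>
  have "((\<lambda>z. (C1' - cscale \<i> C1) + cscale z (C2' - cscale \<i> C2) + cscale (z\<^sup>2) (C3' - cscale \<i> C3)
      + cscale (z ^ 3) (?B ?v - cscale \<i> (?B u)))
     \<longlongrightarrow> (C1' - cscale \<i> C1) + cscale 0 (C2' - cscale \<i> C2) + cscale (0\<^sup>2) (C3' - cscale \<i> C3)
      + cscale (0 ^ 3) (?B ?v - cscale \<i> (?B u))) (at 0)"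
    by (intro tendsto_add tendsto_cscale tendsto_intros)
  then have "((\<lambda>z. cscale z (beta z c p ?v - cscale \<i> (beta z c p u)))
     \<longlongrightarrow> (C1' - cscale \<i> C1) + cscale 0 (C2' - cscale \<i> C2) + cscale (0\<^sup>2) (C3' - cscale \<i> C3)
      + cscale (0 ^ 3) (?B ?v - cscale \<i> (?B u))) (at 0)"
    by (rule Lim_transform_eventually)
      (use eventually_D_0 in eventually_elim, simp add: C C' J vec_eq_iff cscale_nth field_simps power2_eq_square power3_eq_cube)
  from tendsto_unique[OF _ this beta_J_at_0[OF c p]]
  have J1: "C1' = cscale \<i> C1" by (simp add: cscale_0)
  note inv = tendsto_inverse_0[where ?'a = complex]
  have "((\<lambda>z. cscale ((inverse z) ^ 3) (?A ?v + cscale \<i> (?A u)) + cscale ((inverse z)\<^sup>2) (C1' + cscale \<i> C1)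
      + cscale (inverse z) (C2' + cscale \<i> C2) + (C3' + cscale \<i> C3))
     \<longlongrightarrow> cscale (0 ^ 3) (?A ?v + cscale \<i> (?A u)) + cscale (0\<^sup>2) (C1' + cscale \<i> C1)
      + cscale 0 (C2' + cscale \<i> C2) + (C3' + cscale \<i> C3)) at_infinity"
    by (intro tendsto_add tendsto_cscale tendsto_intros inv)
  then have "((\<lambda>z. cscale (inverse z) (beta z c p ?v + cscale \<i> (beta z c p u)))
     \<longlongrightarrow> cscale (0 ^ 3) (?A ?v + cscale \<i> (?A u)) + cscale (0\<^sup>2) (C1' + cscale \<i> C1)
      + cscale 0 (C2' + cscale \<i> C2) + (C3' + cscale \<i> C3)) at_infinity"
    by (rule Lim_transform_eventually)
      (use eventually_D_inf in eventually_elim, simp add: C C' J vec_eq_iff cscale_nth field_simps power2_eq_square power3_eq_cube)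
  from tendsto_unique[OF trivial_limit_at_infinity this beta_J_at_inf[OF c p]]
  have J3: "C3' = cscale (- \<i>) C3"
    by (simp add: cscale_0 eq_neg_iff_add_eq_0 vec_eq_iff cscale_nth)
  have 1: "?A u + C1 + C2 + C3 + ?B u = 0" "?A ?v + C1' + C2' + C3' + ?B ?v = 0"
    using beta_1 C[of 1] C'[of 1] by (simp_all add: cscale_1)
  have m1: "cscale (- 1) X = - X" for X :: "complex^'n^'n" by (simp add: vec_eq_iff cscale_nth)
  have 2: "?A u - C1 + C2 - C3 + ?B u = B.a c p u + B.a c p u" "?A ?v - C1' + C2' - C3' + ?B ?v = B.a c p ?v + B.a c p ?v"
    using beta_minus_1 C[of "- 1"] C'[of "- 1"] by (simp_all add: cscale_1 m1)
  have N: "C1 + C3 = - B.a c p u" "C1' + C3' = - B.a c p ?v"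
    by (rule sum_and_alternating_sum, rule 1, rule 2)+
  \<comment> \<open>The subtracted parts account for the \<open>- 1\<close> in the coefficients
    \<open>inverse (z\<^sup>2) - 1\<close> and \<open>z\<^sup>2 - 1\<close> of
    \<open>alpha\<close>.\<close>
  have C2: "C2 = B.a c p u - ?A u - ?B u"
    by (rule sum_and_alternating_sum[OF 1(1) 2(1)])
  \<comment> \<open>The odd coefficients add up to the new \<open>N\<close>; being of types (1,0)
    and (0,1), they are its two parts.\<close>
  have "formN \<tau> W c p u = C1 + C3" "formN \<tau> W c p ?v = cscale \<i> C1 + cscale (- \<i>) C3"
    by (simp_all add: B.formN_eq[OF c p] N[symmetric] J1 J3)
  note parts = part10_eqI[where \<omega> = "formN \<tau> W", OF c this]
  show ?thesis
    unfolding B.alpha_def parts C[OF z] C2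
    by (simp add: vec_eq_iff cscale_nth algebra_simps)
qed

end

text \<open>Flatness is checked on \<open>D - {0}\<close>, where \<open>beta\<close> is a genuine
  gauge transform of \<open>alpha\<close>; this set is cofinite, which is enough for
  \<open>B.constrained_harmonicI\<close>.\<close>

lemma dressed_constrained_harmonic: "constrained_harmonic \<A> g \<tau> W qt"
proof (rule B.constrained_harmonicI)
  have "finite (- D)" using poly_roots_finite[OF Q] by (simp add: D_eq Collect_neg_eq[symmetric])
  then have "finite (- (D - {0}))" by (simp add: Diff_eq)
  then show "infinite (D - {0})" using infinite_UNIV_char_0[where ?'a = complex]
    by (metis Compl_partition finite_UnI)
  fix c p u v z assume c: "c \<in> \<A>" "p \<in> chart_dom c" and "z \<in> D - {0}"
  then have z: "z \<in> D" "z \<noteq> 0" by auto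
  interpret surface_chart c by (rule surface_chart_atlas[OF atlas c(1)])
  let ?\<beta> = "\<lambda>c p u. G z p ** alpha z c p u ** H z p + G z p ** extd (H z) c p u"
  have "curv ?\<beta> c p u v = curv (B.alpha z) c p u v"
    by (rule curv_cong[OF _ B.alpha_form[OF c(1)] c(2)])
      (simp add: beta_eq_alpha[OF c(1) _ z(2), symmetric] beta_eq[OF c(1) _ z])
  moreover have "curv ?\<beta> c p u v = G z p ** curv (alpha z) c p u v ** H z p"
    by (rule curv_gauge[OF alpha_form[OF c(1)] smooth_GH(1)[OF c(1) z(1)] smooth_GH(2)[OF c(1) z(1)] GH[OF z(1)] c(2)])
  moreover have "curv (alpha z) c p u v = 0"
    by (rule constrained_harmonic_flat[OF harmonic c z(2)])
  ultimately show "curv (B.alpha z) c p u v = 0" by (simp add: matrix_ring)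
qed simp

end

theorem theorem6p24:
  fixes \<A> :: "'m::{t2_space,second_countable_topology} chart set"
    and g :: "('m, real) form2"
    and n :: nat
    and \<tau> :: "'n::finite"
    and V :: "'m \<Rightarrow> (complex^'n) set"
    and q :: "('m, complex^'n^'n) form1"
    and r :: "complex \<Rightarrow> 'm \<Rightarrow> complex^'n^'n"
    and D :: "complex set"
  assumes "oriented_surface_atlas \<A>"
    and "riemannian_metric \<A> g"
    and "n \<ge> 3" and "CARD('n) = n + 2"
    and "smooth_subbundle \<A> V" and "nondegenerate \<tau> V"
    and "split_form1 \<A> \<tau> V q"
    and "constrained_harmonic \<A> g \<tau> V q"
    and "rational_family \<A> r D"
    and "\<forall>z\<in>D. orthogonal_section \<A> \<tau> (r z)"
    and "0 \<in> D" and "\<forall>p. invertible (r 0 p)"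
    and "holomorphic_at_inf r" and "\<forall>p. invertible (at_inf r p)"
    and "1 \<in> D"
    and "twisted \<tau> V r D"
    and "extends_metrically \<A> \<tau> D (\<lambda>z. gauge_conn (r z) (d_lambda g \<tau> V q z))"
  shows "constrained_harmonic \<A> g \<tau>
           (\<lambda>p. (\<lambda>v. matrix_inv (r 1 p) *v v) ` V p)
           (Ad_form (\<lambda>p. matrix_inv (r 1 p)) (dressed_form g r q))"
proof -
  have charts: "surface_chart c" if "c \<in> \<A>" for c by (rule surface_chart_atlas[OF assms(1) that])
  obtain Q X where QX: "Q \<noteq> 0" "D = {z. poly Q z \<noteq> 0}" "\<And>c k. c \<in> \<A> \<Longrightarrow> chart_smooth c (X k)"
    "\<And>z p. z \<in> D \<Longrightarrow> r z p = rational_matrix Q (\<lambda>k. X k p) z"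
    by (rule rational_family_normal_form[OF assms(9,13) charts]) (assumption | rule that)+
  obtain E :: "complex \<Rightarrow> ('m, 'n) conn" where
    E: "\<forall>z\<in>D - {0}. \<forall>s. smooth_map \<A> s \<longrightarrow> eq_form1 \<A> (E z s) (gauge_conn (r z) (d_lambda g \<tau> V q z) s)"
    and hol: "\<forall>s. smooth_map \<A> s \<longrightarrow> (\<forall>c\<in>\<A>. \<forall>p\<in>chart_dom c. \<forall>u i. (\<lambda>z. E z s c p u $ i) holomorphic_on - {0})"
    using assms(17) unfolding extends_metrically_def by (elim exE conjE) (rule that; assumption)
  have const: "smooth_map \<A> (\<lambda>_. w)" for w :: "complex^'n"
    using surface_chart.chart_smooth_const[OF charts] by (auto simp: smooth_map_iff)
  have orth: "orthogonal_section \<A> \<tau> (r z)" if "z \<in> D" for z using assms(10) that by blast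
  have E_hol: "(\<lambda>z. E z (\<lambda>_. w) c p u $ i) holomorphic_on - {0}" if "c \<in> \<A>" "p \<in> chart_dom c" for c p u w i
    using hol const that by blast
  have E_eq: "E z (\<lambda>_. w) c p u = gauge_conn (r z) (d_lambda g \<tau> V q z) (\<lambda>_. w) c p u"
    if "c \<in> \<A>" "p \<in> chart_dom c" "z \<in> D" "z \<noteq> 0" for c p u w z
  proof -
    have "eq_form1 \<A> (E z (\<lambda>_. w)) (gauge_conn (r z) (d_lambda g \<tau> V q z) (\<lambda>_. w))"
      using E const that(3,4) by blast
    then show ?thesis using that(1,2) by (simp add: eq_form1_def)
  qed
  interpret dressing \<A> \<tau> V g q r D Q X E
    by unfold_locales (rule assms QX orth E_hol E_eq; assumption)+
  have "(\<lambda>p. matrix_inv (r 1 p)) = S" by (rule ext) (simp add: S_def matrix_inv_r D1)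
  then show ?thesis
    using dressed_constrained_harmonic by (simp add: qt_def W_def[abs_def] fun_eq_iff)
qed

end
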